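(* Let $d\in\mathbb{Z}$ and let $A=\bigoplus_{n\in\mathbb{Z}}A^n$ be a (nonunitary) dg algebra with product $\mu_A$ and differential $\partial_A$. Consider the dg algebra structure on $\partial_{d-1}A=A\oplus A^{\#}[d-1]$ (square-zero extension of $A$ by the dg bimodule $A^{\#}[d-1]$), with product $m_2$ and differential $m_1$, together with the natural bilinear form $\gamma_A$ of degree $d-1$ on it. Given any nice and fully manageable $d$-pre-Calabi-Yau structure $\{m_n\}_{n\in\mathbb{N}}$ on $A$, define the map $\{\!\{\,,\}\!\}:A\otimes A\to A\otimes A$ by $$(f\otimes g)\big(\{\!\{a,b\}\!\}\big)=(-1)^{|b|(|a|+|g|+1)}\,\gamma_A\big(m_3(b,tg,a),tf\big)$$ for all homogeneous $a,b\in A$ and $f,g\in A^{\#}$. Then $\{\!\{\,,\}\!\}$ is a double Poisson bracket of degree $-d$ on the dg algebra $A$. Moreover, the map $$\{\text{fully manageable nice } d\text{-pre-Calabi-Yau structures } \{m_n\}_{n\in\mathbb{N}} \text{ on } A\}\longrightarrow\{\text{double Poisson brackets on } A \text{ of degree } -d\}$$ sending $\{m_n\}_{n\in\mathbb{N}}$ to the double Poisson bracket determined from $m_3$ by the displayed formula is a bijection.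
   Context: **General conventions.** $\Bbbk$ is a field of characteristic zero; all tensor products are over $\Bbbk$; $\mathbb{N}=\{1,2,\dots\}$. Gradings are cohomological by $\mathbb{Z}$; $V[m]^n=V^{n+m}$, and if $V$ is dg then $\partial_{V[m]}=(-1)^m\partial_V$. $s_V^m:V\to V[m]$ is the map with underlying identity (so $|s^m_Vv|=|v|-m$). The Koszul sign rule is used: $(f\otimes g)(v\otimes w)=(-1)^{|g||v|}f(v)\otimes g(w)$. $\tau_{V,W}(v\otimes w)=(-1)^{|v||w|}w\otimes v$, and for $\sigma\in\mathbb{S}_n$, $\tau_{V,n}(\sigma)(v_1\otimes\dots\otimes v_n)=(-1)^{\epsilon}v_{\sigma^{-1}(1)}\otimes\dots\otimes v_{\sigma^{-1}(n)}$ with $\epsilon=\sum_{i<j,\ \sigma^{-1}(i)>\sigma^{-1}(j)}|v_{\sigma^{-1}(i)}||v_{\sigma^{-1}(j)}|$. $V^{\#}=\mathcal{H}om(V,\Bbbk)$ is the graded dual (spanned by homogeneous linear maps), with differential $f\mapsto-(-1)^{|f|}f\circ\partial_V$. Algebras are not assumed unital. **Double Poisson bracket of degree $-d$** on a dg algebra $(A,\mu_A,\partial_A)$: a homogeneous linear map $\{\!\{\,,\}\!\}_A:A[d]\otimes A[d]\to A\otimes A$ of degree $d$ with $(\partial_A\otimes\mathrm{id}+\mathrm{id}\otimes\partial_A)\circ\{\!\{\,,\}\!\}_A=(-1)^d\{\!\{\,,\}\!\}_A\circ(\partial_{A[d]}\otimes\mathrm{id}+\mathrm{id}\otimes\partial_{A[d]})$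 such that: (i) $-\{\!\{\,,\}\!\}_A\circ\tau_{A[d],A[d]}=\tau_{A,A}\circ\{\!\{\,,\}\!\}_A$; (ii) for each homogeneous $a\in A$, the map $\mathrm{AD}(a):A\to A\otimes A$, $b\mapsto\{\!\{s^da,s^db\}\!\}_A$, of degree $|a|-d$, satisfies $\mathrm{AD}(a)\circ\mu_A=(\mathrm{id}\otimes\mu_A)\circ(\mathrm{AD}(a)\otimes\mathrm{id})+(\mu_A\otimes\mathrm{id})\circ(\mathrm{id}\otimes\mathrm{AD}(a))$; (iii) $\sum_{\sigma\in C_3}\tau_{A,3}(\sigma)\circ\{\!\{\,,\,,\}\!\}_{A,L}\circ\tau_{A[d],3}(\sigma^{-1})=0$, where $C_3\subseteq\mathbb{S}_3$ is the subgroup of cyclic permutations and $\{\!\{\,,\,,\}\!\}_{A,L}=(\{\!\{\,,\}\!\}_A\otimes\mathrm{id}_A)\circ(\mathrm{id}_{A[d]}\otimes s_A^d\otimes\mathrm{id}_A)\circ(\mathrm{id}_{A[d]}\otimes\{\!\{\,,\}\!\}_A)$. On elements $a,b\in A$ one writes $\{\!\{a,b\}\!\}$ for $\{\!\{s^da,s^db\}\!\}_A$; a map $A\otimes A\to A\otimes A$ is called a double Poisson bracket of degree $-d$ if it arises in this way. **$A_\infty$-algebras.** A (nonunitary) $A_\infty$-algebra is a graded space $B$ with maps $m_n:B^{\otimes n}\to B$, $n\in\mathbb{N}$, of degree $2-n$ with $\sum_{r+s+t=n,\ s\geq1,\ r,t\ge 0}(-1)^{r+st}m_{r+1+t}\circ(\mathrm{id}^{\otimes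 r}\otimes m_s\otimes\mathrm{id}^{\otimes t})=0$ for all $n\in\mathbb{N}$. It is *small* if $m_n=0$ for $n\ge4$; *essentially odd* if $m_{2i}=0$ for all $i>1$. It is *$e$-cyclic* for a nondegenerate bilinear form $\gamma:B\otimes B\to\Bbbk$ of degree $e$ if $\gamma\circ\tau_{B,B}=\gamma$ and $\gamma(m_n(a_1,\dots,a_n),a_0)=(-1)^{n+|a_0|\sum_{i=1}^n|a_i|}\gamma(m_n(a_0,\dots,a_{n-1}),a_n)$ for all $n$ and homogeneous $a_i\in B$. **Dg algebra $\partial_{d-1}A$.** Write $tf\in A^{\#}[d-1]$ for the suspension $s^{d-1}f$ of $f\in A^{\#}$. $A^{\#}$ is a dg $A$-bimodule via $(a\cdot f\cdot b)(c)=(-1)^{|a|(|f|+|b|+|c|)}f(bca)$; for a dg bimodule $M$, $M[k]$ is a dg bimodule via $a\cdot s^km\cdot b=(-1)^{k|a|}s^k(a\cdot m\cdot b)$; $A\oplus M$ has product $(a,m)(a',m')=(aa',m\cdot a'+a\cdot m')$ and the direct sum differential. Set $\partial_{d-1}A=A\oplus A^{\#}[d-1]$. **Natural bilinear form** of degree $d-1$ on $\partial_{d-1}A$: $\gamma_A(tf,a)=(-1)^{|a||tf|}\gamma_A(a,tf)=f(a)$, $\gamma_A(a,b)=\gamma_A(tf,tg)=0$, for homogeneous $a,b\in A$, $f,g\in A^{\#}$. **$d$-pre-Calabi-Yau structure** on a graded space $A$: a $(d-1)$-cyclic $A_\infty$-algebra structure $\{m_n\}_{n\in\mathbb{N}}$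 on $\partial_{d-1}A$ for $\gamma_A$ with $m_n(A^{\otimes n})\subseteq A$ for all $n$. For a dg algebra $A$, it is *fully manageable* if $m_1$ and $m_2$ are the differential and product of the square-zero extension dg algebra $\partial_{d-1}A=A\oplus A^{\#}[d-1]$, that is, $m_1(a,x)=(\partial_A(a),\partial_{A^{\#}[d-1]}(x))$ and $m_2((a,x),(a',x'))=(aa',x\cdot a'+a\cdot x')$ for $a,a'\in A$ and $x,x'\in A^{\#}[d-1]$. **Good, nice.** Let $B=B_0\oplus B_1$ (here $B=\partial_{d-1}A$, $B_0=A$, $B_1=A^{\#}[d-1]$). For odd $n$, let $\mathscr{I}_n$ be the set of $(i_1,\dots,i_n)\in\{0,1\}^n$ with $i_j\ne i_{j+1}$ for all $j$. A map $m_n:B^{\otimes n}\to B$ is *good* if it vanishes on $B_{i_1}\otimes\dots\otimes B_{i_n}$ for $(i_1,\dots,i_n)\notin\mathscr{I}_n$ and sends $B_{i_1}\otimes\dots\otimes B_{i_n}$ into $B_{i_1}$ for $(i_1,\dots,i_n)\in\mathscr{I}_n$. An $A_\infty$-structure on $B$ is *good* if it is essentially odd and $m_n$ is good for every odd $n$; it is *nice* if it is good and small.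
   Formalization: The formula need not define a map into A⊗A if A has infinitely many nonzero degrees. The bijection is therefore from structures for which, for all a,b, m_3(b,tg,a) is nonzero for g in only finitely many degrees; this is proved equivalent to the map existing. *)

theory Defs
  imports Complex_Main "HOL-Library.Function_Algebras" "HOL-Library.Product_Plus"
begin

section \<open>Graded vector spaces\<close>

text \<open>
  A graded space is an internally graded subspace of an ambient vector space: \<open>grd V n\<close> is the
  component of degree \<open>n\<close> and \<open>total\<close> the (internally direct) sum of the components. The
  field \<open>dif\<close> is the differential and \<open>mul\<close> the product.
\<close>

record ('k, 'v) dgspace =
  smul :: "'k \<Rightarrow> 'v \<Rightarrow> 'v"
  grd :: "int \<Rightarrow> 'v set"
  dif :: "'v \<Rightarrow> 'v"

record ('k, 'v) dgalg = "('k, 'v) dgspace" +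
  mul :: "'v \<Rightarrow> 'v \<Rightarrow> 'v"

text \<open>\<open>ksg e x\<close> is $(-1)^e x$.\<close>

definition ksg :: "int \<Rightarrow> 'v::group_add \<Rightarrow> 'v" where
  "ksg e x = (if even e then x else - x)"

definition gdecomp :: "(int \<Rightarrow> 'v set) \<Rightarrow> 'v::comm_monoid_add \<Rightarrow> (int \<Rightarrow> 'v) \<Rightarrow> bool" where
  "gdecomp H x c \<longleftrightarrow> finite {i. c i \<noteq> 0} \<and> (\<forall>i. c i \<in> H i) \<and> x = (\<Sum>i | c i \<noteq> 0. c i)"

definition total :: "(int \<Rightarrow> 'v set) \<Rightarrow> 'v::comm_monoid_add set" where
  "total H = {x. \<exists>c. gdecomp H x c}"

definition hcomp :: "(int \<Rightarrow> 'v set) \<Rightarrow> 'v::comm_monoid_add \<Rightarrow> int \<Rightarrow> 'v" where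
  "hcomp H x = (THE c. gdecomp H x c)"

text \<open>Linear extension of a map that is given on homogeneous elements, by a formula \<open>\<phi> i x\<close>
  involving the degree \<open>i\<close> of \<open>x\<close>.\<close>

definition hext :: "(int \<Rightarrow> 'v set) \<Rightarrow> (int \<Rightarrow> 'v \<Rightarrow> 'w) \<Rightarrow> 'v::comm_monoid_add \<Rightarrow> 'w::comm_monoid_add"
  where "hext H \<phi> x = (\<Sum>i | hcomp H x i \<noteq> 0. \<phi> i (hcomp H x i))"

definition graded_space :: "('k::field, 'v::ab_group_add, 'z) dgspace_scheme \<Rightarrow> bool" where
  "graded_space V \<longleftrightarrow>
     vector_space (smul V) \<and>
     (\<forall>n. module.subspace (smul V) (grd V n)) \<and>
     (\<forall>x \<in> total (grd V). \<exists>!c. gdecomp (grd V) x c)"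

definition shift :: "int \<Rightarrow> ('k, 'v::group_add, 'z) dgspace_scheme \<Rightarrow> ('k, 'v, 'z) dgspace_scheme" where
  "shift k V = V\<lparr>grd := (\<lambda>n. grd V (n + k)), dif := (\<lambda>v. ksg k (dif V v))\<rparr>"

text \<open>A (nonunitary) dg algebra; its underlying space is the whole type.\<close>

definition dg_algebra :: "('k::field, 'a::ab_group_add) dgalg \<Rightarrow> bool" where
  "dg_algebra A \<longleftrightarrow>
     graded_space A \<and> total (grd A) = UNIV \<and>
     Vector_Spaces.linear (smul A) (smul A) (dif A) \<and>
     (\<forall>i. \<forall>a \<in> grd A i. dif A a \<in> grd A (i + 1)) \<and>
     (\<forall>a. dif A (dif A a) = 0) \<and>
     (\<forall>a. Vector_Spaces.linear (smul A) (smul A) (\<lambda>b. mul A a b)) \<and>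
     (\<forall>b. Vector_Spaces.linear (smul A) (smul A) (\<lambda>a. mul A a b)) \<and>
     (\<forall>i j. \<forall>a \<in> grd A i. \<forall>b \<in> grd A j. mul A a b \<in> grd A (i + j)) \<and>
     (\<forall>a b c. mul A (mul A a b) c = mul A a (mul A b c)) \<and>
     (\<forall>i. \<forall>a \<in> grd A i. \<forall>b.
        dif A (mul A a b) = mul A (dif A a) b + ksg i (mul A a (dif A b)))"

section \<open>Tensor powers\<close>

text \<open>
  Over a field, the canonical map from $V^{\otimes n}$ to the $n$-linear forms on the full linear
  dual of $V$ is injective; $V^{\otimes n}$ is realised as its image, that is, as the set of
  finite sums of the forms \<open>ptens V [v\<^sub>1, \<dots>, v\<^sub>n]\<close>, which stand for $v_1 \otimes \dots \otimes v_n$.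
  The universal property is lemma \<open>tlift_eq\<close> below.
\<close>

type_synonym ('k, 'v) tens = "('v \<Rightarrow> 'k) list \<Rightarrow> 'k"

definition ptens :: "('k::field, 'v::ab_group_add, 'z) dgspace_scheme \<Rightarrow> 'v list \<Rightarrow> ('k, 'v) tens" where
  "ptens V vs = (\<lambda>fs.
     if length fs = length vs \<and> (\<forall>f \<in> set fs. Vector_Spaces.linear (smul V) (*) f)
     then (\<Prod>(f, v) \<leftarrow> zip fs vs. f v) else 0)"

text \<open>A homogeneous pure tensor is written as the list of its factors paired with their degrees.\<close>

definition hlist :: "('k, 'v, 'z) dgspace_scheme \<Rightarrow> (int \<times> 'v) list \<Rightarrow> bool" where
  "hlist V xs \<longleftrightarrow> (\<forall>(i, x) \<in> set xs. x \<in> grd V i)"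

definition trep ::
  "('k::field, 'v::ab_group_add, 'z) dgspace_scheme \<Rightarrow> nat \<Rightarrow> ('k, 'v) tens \<Rightarrow> (int \<times> 'v) list list \<Rightarrow> bool"
  where "trep V n T L \<longleftrightarrow>
     (\<forall>xs \<in> set L. length xs = n \<and> hlist V xs) \<and> T = (\<Sum>xs \<leftarrow> L. ptens V (map snd xs))"

definition tpow :: "('k::field, 'v::ab_group_add, 'z) dgspace_scheme \<Rightarrow> nat \<Rightarrow> ('k, 'v) tens set" where
  "tpow V n = {T. \<exists>L. trep V n T L}"

definition tpow_deg ::
  "('k::field, 'v::ab_group_add, 'z) dgspace_scheme \<Rightarrow> nat \<Rightarrow> int \<Rightarrow> ('k, 'v) tens set" where
  "tpow_deg V n e = {T. \<exists>L. trep V n T L \<and> (\<forall>xs \<in> set L. sum_list (map fst xs) = e)}"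

text \<open>The linear map on $V^{\otimes n}$ whose value on a homogeneous pure tensor \<open>xs\<close> is \<open>\<phi> xs\<close>.
  It is independent of the chosen representation as soon as \<open>\<phi>\<close> is multilinear.\<close>

definition tlift ::
  "('k::field, 'v::ab_group_add, 'z) dgspace_scheme \<Rightarrow> nat \<Rightarrow> ((int \<times> 'v) list \<Rightarrow> 'w) \<Rightarrow>
   ('k, 'v) tens \<Rightarrow> 'w::comm_monoid_add"
  where "tlift V n \<phi> T = (\<Sum>xs \<leftarrow> (SOME L. trep V n T L). \<phi> xs)"

definition gr_multilinear ::
  "('k::field, 'v::ab_group_add, 'z) dgspace_scheme \<Rightarrow> nat \<Rightarrow> ('k \<Rightarrow> 'w \<Rightarrow> 'w) \<Rightarrow>
   ((int \<times> 'v) list \<Rightarrow> 'w::ab_group_add) \<Rightarrow> bool"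
  where "gr_multilinear V n sc \<phi> \<longleftrightarrow>
    (\<forall>xs k u v c. length xs = n \<and> hlist V xs \<and> k < n \<and>
        u \<in> grd V (fst (xs ! k)) \<and> v \<in> grd V (fst (xs ! k)) \<longrightarrow>
      \<phi> (xs[k := (fst (xs ! k), u + v)]) =
        \<phi> (xs[k := (fst (xs ! k), u)]) + \<phi> (xs[k := (fst (xs ! k), v)]) \<and>
      \<phi> (xs[k := (fst (xs ! k), smul V c u)]) = sc c (\<phi> (xs[k := (fst (xs ! k), u)])))"

lemma gdecomp_add:
  assumes "vector_space (smul V)" "\<And>n. module.subspace (smul V) (grd V n)"
    and "gdecomp (grd V) x c" "gdecomp (grd V) y e"
  shows "gdecomp (grd V) (x + y) (\<lambda>i. c i + e i)"
proof -
  interpret vector_space "smul V" by fact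
  have fc: "finite {i. c i \<noteq> 0}" and fe: "finite {i. e i \<noteq> 0}"
    using assms(3,4) by (auto simp: gdecomp_def)
  let ?F = "{i. c i \<noteq> 0} \<union> {i. e i \<noteq> 0}"
  have "x = sum c ?F" "y = sum e ?F"
    using assms(3,4) fc fe by (auto simp: gdecomp_def intro!: sum.mono_neutral_left)
  then have "x + y = (\<Sum>i\<in>?F. c i + e i)" by (simp add: sum.distrib)
  also have "\<dots> = (\<Sum>i | c i + e i \<noteq> 0. c i + e i)"
    using fc fe by (intro sum.mono_neutral_right) auto
  finally have "x + y = (\<Sum>i | c i + e i \<noteq> 0. c i + e i)" .
  moreover have "finite {i. c i + e i \<noteq> 0}"
    by (rule finite_subset[of _ ?F]) (use fc fe in auto)
  moreover have "\<forall>i. c i + e i \<in> grd V i"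
    using assms(2-4) by (auto simp: gdecomp_def intro: subspace_add)
  ultimately show ?thesis by (auto simp: gdecomp_def)
qed

lemma gdecomp_scale:
  assumes "vector_space (smul V)" "\<And>n. module.subspace (smul V) (grd V n)"
    and "gdecomp (grd V) x c"
  shows "gdecomp (grd V) (smul V r x) (\<lambda>i. smul V r (c i))"
proof -
  interpret vector_space "smul V" by fact
  have fc: "finite {i. c i \<noteq> 0}" using assms(3) by (auto simp: gdecomp_def)
  have "smul V r x = (\<Sum>i | c i \<noteq> 0. smul V r (c i))"
    using assms(3) by (auto simp: gdecomp_def scale_sum_right)
  also have "\<dots> = (\<Sum>i | smul V r (c i) \<noteq> 0. smul V r (c i))"
    using fc by (intro sum.mono_neutral_right) auto
  finally have "smul V r x = (\<Sum>i | smul V r (c i) \<noteq> 0. smul V r (c i))" .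
  moreover have "finite {i. smul V r (c i) \<noteq> 0}"
    by (rule finite_subset[OF _ fc]) auto
  moreover have "\<forall>i. smul V r (c i) \<in> grd V i"
    using assms(2,3) by (auto simp: gdecomp_def intro: subspace_scale)
  ultimately show ?thesis by (auto simp: gdecomp_def)
qed

lemma hcomp_eqI:
  assumes "graded_space V" "gdecomp (grd V) x c"
  shows "hcomp (grd V) x = c"
  using assms unfolding hcomp_def graded_space_def total_def by (blast intro!: the1_equality)

lemma gdecomp_hcomp:
  assumes "graded_space V" "x \<in> total (grd V)"
  shows "gdecomp (grd V) x (hcomp (grd V) x)"
  using assms hcomp_eqI unfolding total_def by blast

lemma hcomp_homogeneous:
  assumes V: "graded_space V" and x: "x \<in> grd V i"
  shows "hcomp (grd V) x j = (if j = i then x else 0)"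
proof -
  interpret vector_space "smul V" using V by (simp add: graded_space_def)
  have "gdecomp (grd V) x (\<lambda>j. if j = i then x else 0)"
  proof (cases "x = 0")
    case True
    then show ?thesis
      using V by (auto simp: gdecomp_def graded_space_def intro: subspace_0)
  next
    case False
    then have "{j. (if j = i then x else 0) \<noteq> 0} = {i}" by auto
    then show ?thesis
      using V x by (auto simp: gdecomp_def graded_space_def intro: subspace_0)
  qed
  from hcomp_eqI[OF V this] show ?thesis by simp
qed

lemma tens_weighted_zero:
  assumes V: "graded_space V" "total (grd V) = UNIV" and sc: "vector_space sc"
    and "gr_multilinear V n sc \<phi>"
    and "\<forall>(c, xs) \<in> set L. length xs = n \<and> hlist V xs"
    and "\<And>fs. length fs = n \<Longrightarrow> \<forall>f \<in> set fs. Vector_Spaces.linear (smul V) (*) f \<Longrightarrow>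
          (\<Sum>(c, xs) \<leftarrow> L. c * (\<Prod>(f, v) \<leftarrow> zip fs (map snd xs). f v)) = 0"
  shows "(\<Sum>(c, xs) \<leftarrow> L. sc c (\<phi> xs)) = 0"
  using assms(4-6)
proof (induction n arbitrary: \<phi> L)
  case 0
  interpret W: vector_space sc by fact
  have "(\<Sum>(c, xs) \<leftarrow> L. sc c (\<phi> xs)) = (\<Sum>(c, xs) \<leftarrow> L. sc c (\<phi> []))"
    using 0(2) by (intro arg_cong[where f = sum_list] map_cong) auto
  also have "\<dots> = sc (\<Sum>(c, xs) \<leftarrow> L. c) (\<phi> [])"
    by (induction L) (auto simp: W.scale_left_distrib)
  also have "(\<Sum>(c, xs) \<leftarrow> L. c) = 0" using 0(3)[of "[]"] by simp
  finally show ?case by simp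
next
  case (Suc n)
  interpret U: vector_space "smul V" using V by (simp add: graded_space_def)
  interpret W: vector_space sc by fact
  have sub: "U.subspace (grd V i)" for i using V by (simp add: graded_space_def)
  obtain Bs where Bs: "\<And>i. Bs i \<subseteq> grd V i" "\<And>i. U.independent (Bs i)" "\<And>i. U.span (Bs i) = grd V i"
  proof -
    have "\<exists>B. B \<subseteq> grd V i \<and> U.independent B \<and> U.span B = grd V i" for i
    proof -
      obtain B where "B \<subseteq> grd V i" "U.independent B" "grd V i \<subseteq> U.span B"
        using U.maximal_independent_subset by blast
      then show ?thesis using U.span_minimal[OF _ sub[of i]] by blast
    qed
    then show ?thesis using that by metis
  qed
  define \<kappa> where "\<kappa> i b x = U.representation (Bs i) (hcomp (grd V) x i) b" for i b x
  have dec: "gdecomp (grd V) x (hcomp (grd V) x)" for x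
    using gdecomp_hcomp[OF V(1)] V(2) by simp
  have hc: "hcomp (grd V) x i \<in> U.span (Bs i)" for x i
    using dec[of x] Bs(3) by (auto simp: gdecomp_def)
  have vs: "vector_space (smul V)" by unfold_locales
  have lin: "Vector_Spaces.linear (smul V) (*) (\<kappa> i b)" for i b
  proof -
    have a: "hcomp (grd V) (x + y) = (\<lambda>j. hcomp (grd V) x j + hcomp (grd V) y j)" for x y
      by (rule hcomp_eqI[OF V(1)]) (intro gdecomp_add vs sub dec)
    have s: "hcomp (grd V) (smul V r x) = (\<lambda>j. smul V r (hcomp (grd V) x j))" for r x
      by (rule hcomp_eqI[OF V(1)]) (intro gdecomp_scale vs sub dec)
    have "vector_space ((*) :: 'a \<Rightarrow> 'a \<Rightarrow> 'a)"
      by unfold_locales (auto simp: algebra_simps)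
    then show ?thesis
      unfolding Vector_Spaces.linear_def module_hom_def module_hom_axioms_def \<kappa>_def
      using vs by (auto simp: module_iff_vector_space a s
        U.representation_add[OF Bs(2) hc hc] U.representation_scale[OF Bs(2) hc])
  qed
  let ?S = "set (map (\<lambda>(c, xs). hd xs) L)"
  define F where "F = (\<Union>(i, x) \<in> ?S. (\<lambda>b. (i, b)) ` {b. \<kappa> i b x \<noteq> 0})"
  have finF: "finite F"
    unfolding F_def \<kappa>_def by (auto intro!: finite_imageI U.finite_representation split: prod.split)
  have FB: "b \<in> Bs i" if "(i, b) \<in> F" for i b
    using that U.representation_ne_zero unfolding F_def \<kappa>_def by fastforce
  have exp: "\<phi> ((i, x) # ys) = (\<Sum>(j, b) \<in> F. sc (\<kappa> j b x) (\<phi> ((j, b) # ys)))"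
    if "(c, (i, x) # ys) \<in> set L" for c i x ys
  proof -
    have h: "length ys = n" "hlist V ((i, x) # ys)" using Suc.prems(2) that by auto
    then have x: "x \<in> grd V i" by (simp add: hlist_def)
    have add: "\<phi> ((i, u + v) # ys) = \<phi> ((i, u) # ys) + \<phi> ((i, v) # ys)"
      and scl: "\<phi> ((i, smul V c u) # ys) = sc c (\<phi> ((i, u) # ys))"
      if "u \<in> grd V i" "v \<in> grd V i" for u v c
      using Suc.prems(1)[unfolded gr_multilinear_def, rule_format, of "(i, x) # ys" 0 u v c] h that
      by auto
    have z: "\<phi> ((i, 0) # ys) = 0"
      using add[of 0 0] U.subspace_0[OF sub] by simp
    have sm: "\<phi> ((i, \<Sum>b\<in>G. smul V (r b) b) # ys) = (\<Sum>b\<in>G. sc (r b) (\<phi> ((i, b) # ys)))"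
      if "finite G" "G \<subseteq> Bs i" for G r
      using that
    proof (induction G)
      case empty
      then show ?case by (simp add: z)
    next
      case (insert b G)
      have b: "b \<in> grd V i" using insert Bs(1) by auto
      moreover have "(\<Sum>b\<in>G. smul V (r b) b) \<in> grd V i"
        using insert Bs(1) by (intro U.subspace_sum[OF sub] U.subspace_scale[OF sub]) auto
      ultimately show ?case
        using insert add[OF U.subspace_scale[OF sub b]] scl[OF b b] by simp
    qed
    have hx: "hcomp (grd V) x j = (if j = i then x else 0)" for j
      by (rule hcomp_homogeneous[OF V(1) x])
    let ?G = "{b. \<kappa> i b x \<noteq> 0}"
    have "\<phi> ((i, x) # ys) = \<phi> ((i, \<Sum>b\<in>?G. smul V (\<kappa> i b x) b) # ys)"
      using U.sum_nonzero_representation_eq[OF Bs(2), of x i] x Bs(3) by (simp add: \<kappa>_def hx)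
    also have "\<dots> = (\<Sum>b\<in>?G. sc (\<kappa> i b x) (\<phi> ((i, b) # ys)))"
      using U.representation_ne_zero by (intro sm) (auto simp: \<kappa>_def U.finite_representation)
    also have "\<dots> = (\<Sum>(j, b) \<in> (\<lambda>b. (i, b)) ` ?G. sc (\<kappa> j b x) (\<phi> ((j, b) # ys)))"
      by (subst sum.reindex) (auto simp: inj_on_def)
    also have "\<dots> = (\<Sum>(j, b) \<in> F. sc (\<kappa> j b x) (\<phi> ((j, b) # ys)))"
    proof (rule sum.mono_neutral_left[OF finF])
      have "(i, x) \<in> ?S" using that by force
      then show "(\<lambda>b. (i, b)) ` ?G \<subseteq> F" unfolding F_def by blast
      show "\<forall>jb \<in> F - (\<lambda>b. (i, b)) ` ?G. (case jb of (j, b) \<Rightarrow> sc (\<kappa> j b x) (\<phi> ((j, b) # ys))) = 0"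
        by (auto simp: \<kappa>_def hx U.representation_zero split: if_splits)
    qed
    finally show ?thesis .
  qed
  have nonempty: "\<exists>i x ys. xs = (i, x) # ys" if "(c, xs) \<in> set L" for c xs
    using Suc.prems(2) that by (cases xs) fastforce+
  have "(\<Sum>(c, xs) \<leftarrow> L. sc c (\<phi> xs)) =
      (\<Sum>(c, xs) \<leftarrow> L. \<Sum>(j, b) \<in> F. sc (c * \<kappa> j b (snd (hd xs))) (\<phi> ((j, b) # tl xs)))"
  proof (intro arg_cong[where f = sum_list] map_cong refl, clarify)
    fix c xs assume L: "(c, xs) \<in> set L"
    then obtain i x ys where xs: "xs = (i, x) # ys" using nonempty by blast
    show "sc c (\<phi> xs) = (\<Sum>(j, b) \<in> F. sc (c * \<kappa> j b (snd (hd xs))) (\<phi> ((j, b) # tl xs)))"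
      using exp[of c i x ys] L by (simp add: xs W.scale_sum_right split_def)
  qed
  also have "\<dots> = (\<Sum>(j, b) \<in> F. \<Sum>(c, xs) \<leftarrow> L. sc (c * \<kappa> j b (snd (hd xs))) (\<phi> ((j, b) # tl xs)))"
    by (induction L) (auto simp: sum.distrib split_def)
  also have "\<dots> = (\<Sum>(j, b) \<in> F. 0)"
  proof (intro sum.cong refl, clarify)
    fix j b assume jb: "(j, b) \<in> F"
    let ?L = "map (\<lambda>(c, xs). (c * \<kappa> j b (snd (hd xs)), tl xs)) L"
    have "(\<Sum>(c, ys) \<leftarrow> ?L. sc c (\<phi> ((j, b) # ys))) = 0"
    proof (rule Suc.IH)
      have b: "b \<in> grd V j" using FB[OF jb] Bs(1) by auto
      show "gr_multilinear V n sc (\<lambda>ys. \<phi> ((j, b) # ys))"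
        unfolding gr_multilinear_def
      proof (intro allI impI)
        fix xs k u v c
        assume *: "length xs = n \<and> hlist V xs \<and> k < n \<and> u \<in> grd V (fst (xs ! k)) \<and> v \<in> grd V (fst (xs ! k))"
        then have "hlist V ((j, b) # xs)" using b by (simp add: hlist_def)
        then show "\<phi> ((j, b) # xs[k := (fst (xs ! k), u + v)]) =
              \<phi> ((j, b) # xs[k := (fst (xs ! k), u)]) + \<phi> ((j, b) # xs[k := (fst (xs ! k), v)]) \<and>
            \<phi> ((j, b) # xs[k := (fst (xs ! k), smul V c u)]) = sc c (\<phi> ((j, b) # xs[k := (fst (xs ! k), u)]))"
          using Suc.prems(1)[unfolded gr_multilinear_def, rule_format, of "(j, b) # xs" "Suc k" u v c] *
          by auto
      qed
      show "\<forall>(c, xs) \<in> set ?L. length xs = n \<and> hlist V xs"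
        using Suc.prems(2) nonempty by (fastforce simp: hlist_def)
      fix fs :: "('b \<Rightarrow> 'a) list"
      assume fs: "length fs = n" "\<forall>f \<in> set fs. Vector_Spaces.linear (smul V) (*) f"
      have "(\<Sum>(c, xs) \<leftarrow> ?L. c * (\<Prod>(f, v) \<leftarrow> zip fs (map snd xs). f v)) =
          (\<Sum>(c, xs) \<leftarrow> L. c * (\<Prod>(f, v) \<leftarrow> zip (\<kappa> j b # fs) (map snd xs). f v))"
        unfolding map_map
      proof (intro arg_cong[where f = sum_list] map_cong refl)
        fix p assume p: "p \<in> set L"
        obtain c xs where [simp]: "p = (c, xs)" by (cases p)
        obtain i x ys where "xs = (i, x) # ys" using nonempty[of c xs] p by auto
        then show "((\<lambda>(c, xs). c * (\<Prod>(f, v) \<leftarrow> zip fs (map snd xs). f v)) \<circ>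
              (\<lambda>(c, xs). (c * \<kappa> j b (snd (hd xs)), tl xs))) p =
            (case p of (c, xs) \<Rightarrow> c * (\<Prod>(f, v) \<leftarrow> zip (\<kappa> j b # fs) (map snd xs). f v))"
          by (simp add: mult.assoc)
      qed
      also have "\<dots> = 0" by (rule Suc.prems(3)) (use fs lin in auto)
      finally show "(\<Sum>(c, xs) \<leftarrow> ?L. c * (\<Prod>(f, v) \<leftarrow> zip fs (map snd xs). f v)) = 0" .
    qed
    then show "(\<Sum>(c, xs) \<leftarrow> L. sc (c * \<kappa> j b (snd (hd xs))) (\<phi> ((j, b) # tl xs))) = 0"
      by (simp add: comp_def split_def)
  qed
  finally show ?case by simp
qed

lemma tlift_eq:
  assumes V: "graded_space V" "total (grd V) = UNIV" and sc: "vector_space sc"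
    and \<phi>: "gr_multilinear V n sc \<phi>" and L: "trep V n T L"
  shows "tlift V n \<phi> T = (\<Sum>xs \<leftarrow> L. \<phi> xs)"
proof -
  interpret W: vector_space sc by fact
  define L' where "L' = (SOME L. trep V n T L)"
  have L': "trep V n T L'" unfolding L'_def using L by (rule someI)
  let ?M = "map (Pair 1) L' @ map (Pair (- 1)) L"
  have "(\<Sum>(c, xs) \<leftarrow> ?M. sc c (\<phi> xs)) = 0"
  proof (rule tens_weighted_zero[OF V sc \<phi>])
    show "\<forall>(c, xs) \<in> set ?M. length xs = n \<and> hlist V xs"
      using L L' by (auto simp: trep_def)
    fix fs :: "('b \<Rightarrow> 'a) list"
    assume fs: "length fs = n" "\<forall>f \<in> set fs. Vector_Spaces.linear (smul V) (*) f"
    have ev: "T fs = (\<Sum>xs \<leftarrow> K. \<Prod>(f, v) \<leftarrow> zip fs (map snd xs). f v)" if K: "trep V n T K" for K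
    proof -
      have app: "(\<Sum>xs \<leftarrow> K. G xs) fs = (\<Sum>xs \<leftarrow> K. G xs fs)" for G :: "_ \<Rightarrow> ('a, 'b) tens"
        by (induction K) auto
      have "T fs = (\<Sum>xs \<leftarrow> K. ptens V (map snd xs) fs)" using K by (simp add: trep_def app)
      also have "\<dots> = (\<Sum>xs \<leftarrow> K. \<Prod>(f, v) \<leftarrow> zip fs (map snd xs). f v)"
        using K fs by (intro arg_cong[where f = sum_list] map_cong) (auto simp: trep_def ptens_def)
      finally show ?thesis .
    qed
    have neg: "(\<Sum>xs \<leftarrow> K. - g xs) = - (\<Sum>xs \<leftarrow> K. g xs)" for K and g :: "_ \<Rightarrow> 'a"
      by (induction K) auto
    show "(\<Sum>(c, xs) \<leftarrow> ?M. c * (\<Prod>(f, v) \<leftarrow> zip fs (map snd xs). f v)) = 0"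
      using ev[OF L] ev[OF L'] by (simp add: comp_def neg)
  qed
  moreover have "(\<Sum>xs \<leftarrow> K. - \<phi> xs) = - (\<Sum>xs \<leftarrow> K. \<phi> xs)" for K
    by (induction K) auto
  ultimately show ?thesis
    by (simp add: tlift_def L'_def[symmetric] comp_def)
qed

text \<open>The permutation action $\tau_{V,n}(\sigma)$; positions are counted from \<open>0\<close>.\<close>

definition perm_list :: "(nat \<Rightarrow> nat) \<Rightarrow> 'x list \<Rightarrow> 'x list" where
  "perm_list \<sigma> xs = map (\<lambda>i. xs ! inv \<sigma> i) [0..<length xs]"

definition perm_exp :: "(nat \<Rightarrow> nat) \<Rightarrow> int list \<Rightarrow> int" where
  "perm_exp \<sigma> ds =
     (\<Sum>(i, j) \<in> {(i, j). i < j \<and> j < length ds \<and> inv \<sigma> i > inv \<sigma> j}. ds ! inv \<sigma> i * ds ! inv \<sigma> j)"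

definition tau ::
  "('k::field, 'v::ab_group_add, 'z) dgspace_scheme \<Rightarrow> nat \<Rightarrow> (nat \<Rightarrow> nat) \<Rightarrow> ('k, 'v) tens \<Rightarrow> ('k, 'v) tens"
  where "tau V n \<sigma> =
     tlift V n (\<lambda>xs. ksg (perm_exp \<sigma> (map fst xs)) (ptens V (map snd (perm_list \<sigma> xs))))"

definition rot3 :: "nat \<Rightarrow> nat" where
  "rot3 i = (if i < 3 then (i + 1) mod 3 else i)"

definition C3 :: "(nat \<Rightarrow> nat) set" where
  "C3 = {id, rot3, rot3 \<circ> rot3}"

text \<open>$\tau_{V,V}$\<close>

definition flip :: "('k::field, 'v::ab_group_add, 'z) dgspace_scheme \<Rightarrow> ('k, 'v) tens \<Rightarrow> ('k, 'v) tens" where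
  "flip V = tlift V 2 (\<lambda>xs. let (i, v) = xs ! 0; (j, w) = xs ! 1 in ksg (i * j) (ptens V [w, v]))"

text \<open>$\partial \otimes \mathrm{id} + \mathrm{id} \otimes \partial$\<close>

definition dif2 :: "('k::field, 'v::ab_group_add, 'z) dgspace_scheme \<Rightarrow> ('k, 'v) tens \<Rightarrow> ('k, 'v) tens" where
  "dif2 V = tlift V 2 (\<lambda>xs. let (i, v) = xs ! 0; (j, w) = xs ! 1 in
     ptens V [dif V v, w] + ksg i (ptens V [v, dif V w]))"

text \<open>$f \otimes g$ as a functional on $V \otimes V$, where \<open>q\<close> is the degree of \<open>g\<close>\<close>

definition fun_tens ::
  "('k::field, 'v::ab_group_add, 'z) dgspace_scheme \<Rightarrow> ('v \<Rightarrow> 'k) \<Rightarrow> int \<Rightarrow> ('v \<Rightarrow> 'k) \<Rightarrow> ('k, 'v) tens \<Rightarrow> 'k"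
  where "fun_tens V f q g =
     tlift V 2 (\<lambda>xs. let (i, v) = xs ! 0; (j, w) = xs ! 1 in ksg (q * i) (f v * g w))"

section \<open>Double Poisson brackets\<close>

text \<open>
  A linear map on $A \otimes A$ is given as the corresponding bilinear map. Since \<open>shift\<close> does not
  change the underlying space and $s^d$ is the identity of it, a map $A[d] \otimes A[d] \to A
  \otimes A$ and its counterpart on $A \otimes A$ are the same function; only the degrees differ.
\<close>

definition bilinear_into_tens2 ::
  "('k::field, 'a::ab_group_add) dgalg \<Rightarrow> ('a \<Rightarrow> 'a \<Rightarrow> ('k, 'a) tens) \<Rightarrow> bool" where
  "bilinear_into_tens2 A br \<longleftrightarrow>
     (\<forall>a b. br a b \<in> tpow A 2) \<and>
     (\<forall>a. Vector_Spaces.linear (smul A) (\<lambda>c T fs. c * T fs) (\<lambda>b. br a b)) \<and>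
     (\<forall>b. Vector_Spaces.linear (smul A) (\<lambda>c T fs. c * T fs) (\<lambda>a. br a b))"

text \<open>
  $(\mathrm{br} \otimes \mathrm{id}) \circ (\mathrm{id} \otimes s^d \otimes \mathrm{id}) \circ
  (\mathrm{id} \otimes \mathrm{br})$ on a homogeneous pure tensor of $A[d]^{\otimes 3}$. With \<open>i\<close>
  the degree in $A[d]$ of the first factor, the Koszul signs are $(-1)^{di}$ for \<open>br\<close> (of degree
  $d$) and $(-1)^{-di}$ for $s^d$ (of degree $-d$).
\<close>

definition triple_L ::
  "int \<Rightarrow> ('k::field, 'a::ab_group_add) dgalg \<Rightarrow> ('a \<Rightarrow> 'a \<Rightarrow> ('k, 'a) tens) \<Rightarrow> (int \<times> 'a) list \<Rightarrow> ('k, 'a) tens"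
  where "triple_L d A br xs =
     (let (i, a) = xs ! 0; (j, b) = xs ! 1; (l, c) = xs ! 2 in
        ksg (d * i) (ksg (- d * i)
          (tlift A 2 (\<lambda>ys. let (p, y) = ys ! 0; (q, z) = ys ! 1 in
             tlift A 2 (\<lambda>us. ptens A (map snd us @ [z])) (br a y)) (br b c))))"

definition double_Poisson ::
  "int \<Rightarrow> ('k::field, 'a::ab_group_add) dgalg \<Rightarrow> ('a \<Rightarrow> 'a \<Rightarrow> ('k, 'a) tens) \<Rightarrow> bool" where
  "double_Poisson d A br \<longleftrightarrow>
     bilinear_into_tens2 A br \<and>
     (\<forall>i j. \<forall>a \<in> grd (shift d A) i. \<forall>b \<in> grd (shift d A) j. br a b \<in> tpow_deg A 2 (i + j + d)) \<and>
     (\<forall>i j. \<forall>a \<in> grd (shift d A) i. \<forall>b \<in> grd (shift d A) j.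
        dif2 A (br a b) =
          ksg d (br (dif (shift d A) a) b + ksg i (br a (dif (shift d A) b)))) \<and>
     (\<forall>i j. \<forall>a \<in> grd (shift d A) i. \<forall>b \<in> grd (shift d A) j.
        - ksg (i * j) (br b a) = flip A (br a b)) \<and>
     (\<forall>i j l. \<forall>a \<in> grd A i. \<forall>b \<in> grd A j. \<forall>c \<in> grd A l.
        br a (mul A b c) =
          tlift A 2 (\<lambda>xs. let (p, x) = xs ! 0; (q, y) = xs ! 1 in ptens A [x, mul A y c]) (br a b)
          + ksg ((i - d) * j)
              (tlift A 2 (\<lambda>xs. let (p, x) = xs ! 0; (q, y) = xs ! 1 in ptens A [mul A b x, y]) (br a c))) \<and>
     (\<forall>xs. length xs = 3 \<and> hlist (shift d A) xs \<longrightarrow>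
        (\<Sum>\<sigma> \<in> C3. ksg (perm_exp (inv \<sigma>) (map fst xs))
           (tau A 3 \<sigma> (triple_L d A br (perm_list (inv \<sigma>) xs)))) = 0)"

section \<open>Cyclic $A_\infty$-algebras\<close>

text \<open>
  An $n$-linear operation is a function on lists of length \<open>n\<close>. So that different structures are
  different functions, it is required to be \<open>undefined\<close> outside of its domain.
\<close>

definition op_dom :: "('k, 'v::ab_group_add, 'z) dgspace_scheme \<Rightarrow> nat \<Rightarrow> 'v list set" where
  "op_dom V n = {xs. length xs = n \<and> set xs \<subseteq> total (grd V)}"

definition multilinear_op ::
  "('k::field, 'v::ab_group_add, 'z) dgspace_scheme \<Rightarrow> nat \<Rightarrow> ('v list \<Rightarrow> 'v) \<Rightarrow> bool" where
  "multilinear_op V n f \<longleftrightarrow>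
     (\<forall>xs \<in> op_dom V n. f xs \<in> total (grd V)) \<and>
     (\<forall>xs \<in> op_dom V n. \<forall>k < n. \<forall>u \<in> total (grd V). \<forall>v \<in> total (grd V). \<forall>c.
        f (xs[k := u + v]) = f (xs[k := u]) + f (xs[k := v]) \<and>
        f (xs[k := smul V c u]) = smul V c (f (xs[k := u])))"

definition A_infinity ::
  "('k::field, 'v::ab_group_add, 'z) dgspace_scheme \<Rightarrow> (nat \<Rightarrow> 'v list \<Rightarrow> 'v) \<Rightarrow> bool" where
  "A_infinity V m \<longleftrightarrow>
     graded_space V \<and>
     (\<forall>n xs. \<not> (n \<ge> 1 \<and> xs \<in> op_dom V n) \<longrightarrow> m n xs = undefined) \<and>
     (\<forall>n \<ge> 1. multilinear_op V n (m n)) \<and>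
     (\<forall>n \<ge> 1. \<forall>xs. length xs = n \<and> hlist V xs \<longrightarrow>
        m n (map snd xs) \<in> grd V (sum_list (map fst xs) + 2 - int n)) \<and>
     (\<forall>n \<ge> 1. \<forall>xs. length xs = n \<and> hlist V xs \<longrightarrow>
        (\<Sum>(r, s, t) \<in> {(r, s, t). r + s + t = n \<and> s \<ge> 1}.
           ksg (int r + int s * int t + (2 - int s) * sum_list (map fst (take r xs)))
             (m (r + 1 + t)
                (map snd (take r xs) @ [m s (map snd (take s (drop r xs)))]
                 @ map snd (drop (r + s) xs)))) = 0)"

definition small :: "('k, 'v::ab_group_add, 'z) dgspace_scheme \<Rightarrow> (nat \<Rightarrow> 'v list \<Rightarrow> 'v) \<Rightarrow> bool" where
  "small V m \<longleftrightarrow> (\<forall>n \<ge> 4. \<forall>xs \<in> op_dom V n. m n xs = 0)"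

definition essentially_odd :: "('k, 'v::ab_group_add, 'z) dgspace_scheme \<Rightarrow> (nat \<Rightarrow> 'v list \<Rightarrow> 'v) \<Rightarrow> bool" where
  "essentially_odd V m \<longleftrightarrow> (\<forall>i > 1. \<forall>xs \<in> op_dom V (2 * i). m (2 * i) xs = 0)"

definition bilinear_form ::
  "('k::field, 'v::ab_group_add, 'z) dgspace_scheme \<Rightarrow> int \<Rightarrow> ('v \<Rightarrow> 'v \<Rightarrow> 'k) \<Rightarrow> bool" where
  "bilinear_form V e \<gamma> \<longleftrightarrow>
     (\<forall>x \<in> total (grd V). \<forall>y \<in> total (grd V). \<forall>z \<in> total (grd V). \<forall>c.
        \<gamma> (x + y) z = \<gamma> x z + \<gamma> y z \<and> \<gamma> z (x + y) = \<gamma> z x + \<gamma> z y \<and>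
        \<gamma> (smul V c x) z = c * \<gamma> x z \<and> \<gamma> z (smul V c x) = c * \<gamma> z x) \<and>
     (\<forall>i j. \<forall>x \<in> grd V i. \<forall>y \<in> grd V j. i + j + e \<noteq> 0 \<longrightarrow> \<gamma> x y = 0)"

definition nondegenerate ::
  "('k::field, 'v::ab_group_add, 'z) dgspace_scheme \<Rightarrow> ('v \<Rightarrow> 'v \<Rightarrow> 'k) \<Rightarrow> bool" where
  "nondegenerate V \<gamma> \<longleftrightarrow>
     (\<forall>x \<in> total (grd V). (\<forall>y \<in> total (grd V). \<gamma> x y = 0) \<longrightarrow> x = 0) \<and>
     (\<forall>y \<in> total (grd V). (\<forall>x \<in> total (grd V). \<gamma> x y = 0) \<longrightarrow> y = 0)"

text \<open>In the last clause \<open>xs\<close> is the list $a_1, \dots, a_n$, and \<open>(i, a)\<close> is $a_0$ with its degree.\<close>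

definition cyclic_A_infinity ::
  "('k::field, 'v::ab_group_add, 'z) dgspace_scheme \<Rightarrow> int \<Rightarrow> ('v \<Rightarrow> 'v \<Rightarrow> 'k) \<Rightarrow>
   (nat \<Rightarrow> 'v list \<Rightarrow> 'v) \<Rightarrow> bool"
  where "cyclic_A_infinity V e \<gamma> m \<longleftrightarrow>
     A_infinity V m \<and> bilinear_form V e \<gamma> \<and> nondegenerate V \<gamma> \<and>
     (\<forall>i j. \<forall>x \<in> grd V i. \<forall>y \<in> grd V j. ksg (i * j) (\<gamma> y x) = \<gamma> x y) \<and>
     (\<forall>n \<ge> 1. \<forall>xs i a. length xs = n \<and> hlist V xs \<and> a \<in> grd V i \<longrightarrow>
        \<gamma> (m n (map snd xs)) a =
          ksg (int n + i * sum_list (map fst xs)) (\<gamma> (m n (a # butlast (map snd xs))) (last (map snd xs))))"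

section \<open>The square-zero extension and pre-Calabi-Yau structures\<close>

definition dual :: "('k::field, 'a::ab_group_add, 'z) dgspace_scheme \<Rightarrow> ('k, 'a \<Rightarrow> 'k) dgspace" where
  "dual A =
     (let H = (\<lambda>n. {f. Vector_Spaces.linear (smul A) (*) f \<and> (\<forall>i. i \<noteq> - n \<longrightarrow> (\<forall>a \<in> grd A i. f a = 0))})
      in \<lparr>smul = (\<lambda>c f x. c * f x), grd = H, dif = hext H (\<lambda>n f. - ksg n (f \<circ> dif A))\<rparr>)"

text \<open>
  The actions $a \cdot f$ and $f \cdot b$ on $A^\#$ are the two one-sided cases of
  $(a \cdot f \cdot b)(c) = (-1)^{|a|(|f|+|b|+|c|)} f(bca)$. An element $s^k f$ of $A^\#[k]$ is
  represented by \<open>f\<close>, and \<open>lact_shift k\<close> is the left action on $A^\#[k]$. The right action is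
  not affected by the shift.
\<close>

definition lact :: "('k::field, 'a::ab_group_add) dgalg \<Rightarrow> 'a \<Rightarrow> ('a \<Rightarrow> 'k) \<Rightarrow> 'a \<Rightarrow> 'k" where
  "lact A a f = (\<lambda>c.
     hext (grd A) (\<lambda>i a'. hext (grd (dual A)) (\<lambda>n f'. hext (grd A) (\<lambda>l c'.
       ksg (i * (n + l)) (f' (mul A c' a'))) c) f) a)"

definition ract :: "('k::field, 'a::ab_group_add) dgalg \<Rightarrow> ('a \<Rightarrow> 'k) \<Rightarrow> 'a \<Rightarrow> 'a \<Rightarrow> 'k" where
  "ract A f b = (\<lambda>c. f (mul A b c))"

definition lact_shift :: "int \<Rightarrow> ('k::field, 'a::ab_group_add) dgalg \<Rightarrow> 'a \<Rightarrow> ('a \<Rightarrow> 'k) \<Rightarrow> 'a \<Rightarrow> 'k" where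
  "lact_shift k A a f = hext (grd A) (\<lambda>i a'. ksg (k * i) (lact A a' f)) a"

text \<open>$\partial_{d-1} A = A \oplus A^\#[d-1]$; a pair \<open>(a, f)\<close> stands for $a + tf$.\<close>

definition del_alg :: "int \<Rightarrow> ('k::field, 'a::ab_group_add) dgalg \<Rightarrow> ('k, 'a \<times> ('a \<Rightarrow> 'k)) dgalg" where
  "del_alg d A =
     \<lparr>smul = (\<lambda>c (a, f). (smul A c a, smul (shift (d - 1) (dual A)) c f)),
      grd = (\<lambda>n. grd A n \<times> grd (shift (d - 1) (dual A)) n),
      dif = (\<lambda>(a, f). (dif A a, dif (shift (d - 1) (dual A)) f)),
      mul = (\<lambda>(a, f) (a', f'). (mul A a a', ract A f a' + lact_shift (d - 1) A a f'))\<rparr>"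

text \<open>The natural form: \<open>nat_form d A (a, f) (a', f')\<close> is $\gamma_A(tf, a') + \gamma_A(a, tf')$.\<close>

definition nat_form ::
  "int \<Rightarrow> ('k::field, 'a::ab_group_add) dgalg \<Rightarrow> 'a \<times> ('a \<Rightarrow> 'k) \<Rightarrow> 'a \<times> ('a \<Rightarrow> 'k) \<Rightarrow> 'k" where
  "nat_form d A = (\<lambda>(a, f) (a', f').
     f a' + hext (grd A) (\<lambda>i b. hext (grd (shift (d - 1) (dual A))) (\<lambda>n g. ksg (i * n) (g b)) f') a)"

text \<open>The summands $B_0 = A$ (index \<open>False\<close>) and $B_1 = A^\#[d-1]$ (index \<open>True\<close>) of $\partial_{d-1} A$.\<close>

definition summand :: "('k::field, 'a::ab_group_add) dgalg \<Rightarrow> bool \<Rightarrow> ('a \<times> ('a \<Rightarrow> 'k)) set" where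
  "summand A i = (if i then {0} \<times> total (grd (dual A)) else total (grd A) \<times> {0})"

definition pre_CY ::
  "int \<Rightarrow> ('k::field, 'a::ab_group_add) dgalg \<Rightarrow>
   (nat \<Rightarrow> ('a \<times> ('a \<Rightarrow> 'k)) list \<Rightarrow> 'a \<times> ('a \<Rightarrow> 'k)) \<Rightarrow> bool"
  where "pre_CY d A m \<longleftrightarrow>
     cyclic_A_infinity (del_alg d A) (d - 1) (nat_form d A) m \<and>
     (\<forall>n \<ge> 1. \<forall>xs. length xs = n \<and> set xs \<subseteq> summand A False \<longrightarrow> m n xs \<in> summand A False)"

definition fully_manageable ::
  "int \<Rightarrow> ('k::field, 'a::ab_group_add) dgalg \<Rightarrow>
   (nat \<Rightarrow> ('a \<times> ('a \<Rightarrow> 'k)) list \<Rightarrow> 'a \<times> ('a \<Rightarrow> 'k)) \<Rightarrow> bool"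
  where "fully_manageable d A m \<longleftrightarrow>
     (\<forall>x \<in> total (grd (del_alg d A)). m 1 [x] = dif (del_alg d A) x) \<and>
     (\<forall>x \<in> total (grd (del_alg d A)). \<forall>y \<in> total (grd (del_alg d A)).
        m 2 [x, y] = mul (del_alg d A) x y)"

definition alternating :: "bool list \<Rightarrow> bool" where
  "alternating is \<longleftrightarrow> (\<forall>j. Suc j < length is \<longrightarrow> is ! j \<noteq> is ! Suc j)"

definition good_map ::
  "('k::field, 'a::ab_group_add) dgalg \<Rightarrow> nat \<Rightarrow>
   (('a \<times> ('a \<Rightarrow> 'k)) list \<Rightarrow> 'a \<times> ('a \<Rightarrow> 'k)) \<Rightarrow> bool"
  where "good_map A n f \<longleftrightarrow>
     (\<forall>is xs. length is = n \<and> length xs = n \<and> (\<forall>j < n. xs ! j \<in> summand A (is ! j)) \<longrightarrow>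
        (if alternating is then f xs \<in> summand A (is ! 0) else f xs = 0))"

definition good ::
  "int \<Rightarrow> ('k::field, 'a::ab_group_add) dgalg \<Rightarrow>
   (nat \<Rightarrow> ('a \<times> ('a \<Rightarrow> 'k)) list \<Rightarrow> 'a \<times> ('a \<Rightarrow> 'k)) \<Rightarrow> bool"
  where "good d A m \<longleftrightarrow> essentially_odd (del_alg d A) m \<and> (\<forall>n. odd n \<longrightarrow> good_map A n (m n))"

definition nice ::
  "int \<Rightarrow> ('k::field, 'a::ab_group_add) dgalg \<Rightarrow>
   (nat \<Rightarrow> ('a \<times> ('a \<Rightarrow> 'k)) list \<Rightarrow> 'a \<times> ('a \<Rightarrow> 'k)) \<Rightarrow> bool"
  where "nice d A m \<longleftrightarrow> good d A m \<and> small (del_alg d A) m"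

section \<open>The correspondence\<close>

definition fm_nice_pre_CY ::
  "int \<Rightarrow> ('k::field, 'a::ab_group_add) dgalg \<Rightarrow>
   (nat \<Rightarrow> ('a \<times> ('a \<Rightarrow> 'k)) list \<Rightarrow> 'a \<times> ('a \<Rightarrow> 'k)) set"
  where "fm_nice_pre_CY d A = {m. pre_CY d A m \<and> fully_manageable d A m \<and> nice d A m}"

text \<open>\<open>br\<close> is a map $A \otimes A \to A \otimes A$ with
  $(f \otimes g)(\mathrm{br}(a,b)) = (-1)^{|b|(|a|+|g|+1)} \gamma_A(m_3(b, tg, a), tf)$.\<close>

definition is_bracket_of ::
  "int \<Rightarrow> ('k::field, 'a::ab_group_add) dgalg \<Rightarrow>
   (nat \<Rightarrow> ('a \<times> ('a \<Rightarrow> 'k)) list \<Rightarrow> 'a \<times> ('a \<Rightarrow> 'k)) \<Rightarrow> ('a \<Rightarrow> 'a \<Rightarrow> ('k, 'a) tens) \<Rightarrow> bool"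
  where "is_bracket_of d A m br \<longleftrightarrow>
     bilinear_into_tens2 A br \<and>
     (\<forall>i j p q. \<forall>a \<in> grd A i. \<forall>b \<in> grd A j. \<forall>f \<in> grd (dual A) p. \<forall>g \<in> grd (dual A) q.
        fun_tens A f q g (br a b) =
          ksg (j * (i + q + 1)) (nat_form d A (m 3 [(b, 0), (0, g), (a, 0)]) (0, f)))"

definition bracket_of ::
  "int \<Rightarrow> ('k::field, 'a::ab_group_add) dgalg \<Rightarrow>
   (nat \<Rightarrow> ('a \<times> ('a \<Rightarrow> 'k)) list \<Rightarrow> 'a \<times> ('a \<Rightarrow> 'k)) \<Rightarrow> 'a \<Rightarrow> 'a \<Rightarrow> ('k, 'a) tens"
  where "bracket_of d A m = (THE br. is_bracket_of d A m br)"

text \<open>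
  The formula always determines an element of $\prod_{k,l} A^k \otimes A^l$, which need not lie in
  $A \otimes A$. For example, let all products and the differential vanish, let $a_0$ and infinitely
  many $e_n$, $e'_n$ be a basis of $A$ with $|e_n| + |e'_n| = 2|a_0| - d$ and pairwise distinct
  degrees, and let $m_3$ be the cyclic operation for which $m_3(a_0, tg, a_0)$ is the sum of the
  (finitely many nonzero) terms $g(e'_n) e_n$ and, up to sign, $g(e_n) e'_n$, while $m_3(b, tg, a)$
  vanishes if \<open>a\<close> or \<open>b\<close> is one of the $e_n$, $e'_n$. The bracket of $a_0$ with itself would be an
  infinite sum. The following condition excludes this.
\<close>

definition finite_type_m3 ::
  "('k::field, 'a::ab_group_add) dgalg \<Rightarrow>
   (nat \<Rightarrow> ('a \<times> ('a \<Rightarrow> 'k)) list \<Rightarrow> 'a \<times> ('a \<Rightarrow> 'k)) \<Rightarrow> bool"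
  where "finite_type_m3 A m \<longleftrightarrow>
     (\<forall>a b. finite {q. \<exists>g \<in> grd (dual A) q. m 3 [(b, 0), (0, g), (a, 0)] \<noteq> 0})"

text \<open>A condition on the support of the grading under which \<open>finite_type_m3\<close> is automatic. It
  holds for instance if the grading of \<open>A\<close> is bounded above or bounded below.\<close>

definition pairwise_finite_support :: "('k::field, 'a::ab_group_add) dgalg \<Rightarrow> bool" where
  "pairwise_finite_support A \<longleftrightarrow> (\<forall>n. finite {i. grd A i \<noteq> {0} \<and> grd A (n - i) \<noteq> {0}})"

end

theory Submission
  imports Defs
begin

text \<open>
  A good ternary operation on $A \oplus A^\#[d-1]$ consists of two maps
  $X : A \otimes A^\# \otimes A \to A$ and $Y : A^\# \otimes A \otimes A^\# \to A^\#$. Cyclicity expresses $Y$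
  through $X$ and amounts to $f(X(b,g,a)) = \pm g(X(a,f,b))$. Since $(f \otimes g)(\mathrm{br}(a,b))$ is
  $f(X(b,g,a))$ up to sign, this is the skew-symmetry of the bracket.

  Paired with the natural form, a Stasheff sum of $n$ arguments is invariant up to sign under cyclic
  rotation of the $n + 1$ arguments involved. On arguments from $A$ and $A^\#$ it vanishes unless they form
  a rotation of one word: $A, A^\#, A, A^\#$ for $n = 3$, $A, A, A^\#, A, A^\#$ for $n = 4$ and
  $A, A^\#, A, A^\#, A, A^\#$ for $n = 5$. On these words the sums are the compatibility with the
  differential, the Leibniz rule and the double Jacobi identity.

  That $X$ comes from a tensor is a finiteness statement: the maps $X(b, -, a)$ and $X(a, -, b)$ are
  adjoint up to sign, so in each degree their images are reflexive and hence finite-dimensional, while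
  finite type leaves only finitely many degrees.
\<close>

section \<open>Signs\<close>

text \<open>Signs are the obstacle, and one mechanism handles them. Homogeneous functionals separate
  the points of A and of its tensor powers, so identities are tested on them and become scalar
  identities. All terms vanish unless the degrees involved have one fixed sum; when they do, one
  degree is eliminated and only parities remain to be compared. The same principle makes signs
  depend on fewer degrees: where f(a) is nonzero, the sign of the natural form on (a, tf) depends on
  the degree of a alone. The form and the left action on A#[d-1] can therefore be written with a
  sign automorphism \<open>\<theta>\<close> of A and no other signs.

  For each bracket axiom that is not automatic, the difference of its two sides, evaluated on
  functionals, is a sign times a Stasheff form. These are equalities, so one computation serves both
  directions of the correspondence. For the inverse map, X is recovered by contracting the second
  factor of the bracket with g.\<close>

definition sg :: "int \<Rightarrow> 'k::field" where
  "sg e = (if even e then 1 else - 1)"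

lemma sg_0 [simp]: "sg 0 = 1"
  by (simp add: sg_def)

lemma sg_add: "sg (a + b) = sg a * sg b"
  by (simp add: sg_def)

lemma sg_nonzero [simp]: "sg e \<noteq> 0"
  by (simp add: sg_def)

lemma sg_sg [simp]: "sg a * sg a = 1" "sg a * (sg a * x) = x"
  by (simp_all add: sg_def)

lemma sg_eqI: "even a = even b \<Longrightarrow> sg a = sg b"
  by (simp add: sg_def)

text \<open>Rotations of arguments are chained with this rule. The exponent \<open>c\<close> is free
  up to parity, so a whole chain ends in a single comparison of parities.\<close>

lemma sg_trans: "x = sg a * y \<Longrightarrow> y = sg b * z \<Longrightarrow> even c = even (a + b) \<Longrightarrow> x = sg c * z"
  by (auto simp: sg_def)

lemma sg_mult_eq_iff: "sg a * x = y \<longleftrightarrow> x = sg a * y"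
  by (auto simp: sg_def)

lemma ksg_field: "ksg e (x :: 'k::field) = sg e * x"
  by (simp add: ksg_def sg_def)

lemma ksg_0_left [simp]: "ksg 0 x = x"
  by (simp add: ksg_def)

lemma ksg_0_right [simp]: "ksg e (0 :: 'v::group_add) = 0"
  by (simp add: ksg_def)

lemma ksg_ksg [simp]: "ksg a (ksg b x) = ksg (a + b) x"
  by (simp add: ksg_def)

lemma ksg_add: "ksg e (x + y :: 'v::ab_group_add) = ksg e x + ksg e y"
  by (simp add: ksg_def)

lemma ksg_fun_apply: "ksg e (F :: _ \<Rightarrow> 'v::group_add) x = ksg e (F x)"
  by (simp add: ksg_def)

lemma ksg_Pair: "ksg e (x :: 'v::group_add, y :: 'w::group_add) = (ksg e x, ksg e y)"
  by (simp add: ksg_def)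

lemma ksg_scale: "vector_space s \<Longrightarrow> ksg e x = s (sg e) x"
  for s :: "'k::field \<Rightarrow> 'v::ab_group_add \<Rightarrow> 'v"
  by (simp add: ksg_def sg_def module.scale_minus_left module.scale_one vector_space_def
      module_def)

lemma vector_space_times: "vector_space ((*) :: 'k::field \<Rightarrow> 'k \<Rightarrow> 'k)"
  by unfold_locales (auto simp: algebra_simps)

lemma vector_space_fun: "vector_space (\<lambda>c (f :: 'v \<Rightarrow> 'k::field) x. c * f x)"
  by unfold_locales (auto simp: algebra_simps fun_eq_iff)

lemma sum_fun_apply: "(\<Sum>i\<in>I. F i) x = (\<Sum>i\<in>I. F i x)"
  for F :: "_ \<Rightarrow> _ \<Rightarrow> 'v::ab_group_add"
  by (induction I rule: infinite_finite_induct) auto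

section \<open>Graded vector spaces\<close>

lemma gdecomp_sum_superset:
  assumes "gdecomp H x c" "finite F" "\<And>i. c i \<noteq> 0 \<Longrightarrow> i \<in> F"
  shows "x = sum c F"
  using assms by (auto simp: gdecomp_def intro!: sum.mono_neutral_left)

locale graded_vs =
  fixes V :: "('k::field, 'v::ab_group_add, 'z) dgspace_scheme" (structure)
  assumes graded: "graded_space V"
begin

sublocale vs: vector_space "smul V"
  using graded by (simp add: graded_space_def)

lemma subspace: "vs.subspace (grd V n)"
  using graded by (simp add: graded_space_def)

lemma grd_0 [simp]: "0 \<in> grd V n"
  using vs.subspace_0[OF subspace] .

lemma grd_add: "x \<in> grd V n \<Longrightarrow> y \<in> grd V n \<Longrightarrow> x + y \<in> grd V n"
  using vs.subspace_add[OF subspace] .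

lemma grd_scale: "x \<in> grd V n \<Longrightarrow> smul V c x \<in> grd V n"
  using vs.subspace_scale[OF subspace] .

lemma grd_minus: "x \<in> grd V n \<Longrightarrow> - x \<in> grd V n"
  using vs.subspace_neg[OF subspace] .

lemma grd_ksg: "x \<in> grd V n \<Longrightarrow> ksg e x \<in> grd V n"
  by (simp add: ksg_def grd_minus)

lemma vector_space: "vector_space (smul V)"
  by unfold_locales

lemma hcomp_grd: "x \<in> grd V i \<Longrightarrow> hcomp (grd V) x j = (if j = i then x else 0)"
  by (rule hcomp_homogeneous[OF graded])

lemma gdecomp_hom: "x \<in> grd V i \<Longrightarrow> gdecomp (grd V) x (\<lambda>j. if j = i then x else 0)"
  by (cases "x = 0") (auto simp: gdecomp_def sum.delta)

lemma total_grd: "x \<in> grd V i \<Longrightarrow> x \<in> total (grd V)"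
  using gdecomp_hom unfolding total_def by blast

lemma total_add: "x \<in> total (grd V) \<Longrightarrow> y \<in> total (grd V) \<Longrightarrow> x + y \<in> total (grd V)"
  unfolding total_def using gdecomp_add[OF vector_space subspace] by blast

lemma total_scale: "x \<in> total (grd V) \<Longrightarrow> smul V c x \<in> total (grd V)"
  unfolding total_def using gdecomp_scale[OF vector_space subspace] by blast

lemma total_0 [simp]: "0 \<in> total (grd V)"
  using total_grd grd_0 .

lemma total_minus: "x \<in> total (grd V) \<Longrightarrow> - x \<in> total (grd V)"
  using total_scale[of x "- 1"] by simp

lemma total_ksg: "x \<in> total (grd V) \<Longrightarrow> ksg e x \<in> total (grd V)"
  by (simp add: ksg_def total_minus)

lemma total_sum: "(\<And>i. i \<in> I \<Longrightarrow> f i \<in> total (grd V)) \<Longrightarrow> sum f I \<in> total (grd V)"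
  by (induction I rule: infinite_finite_induct) (auto intro: total_add)

lemma hcomp_decomp: "x \<in> total (grd V) \<Longrightarrow> gdecomp (grd V) x (hcomp (grd V) x)"
  by (rule gdecomp_hcomp[OF graded])

lemma hcomp_add:
  "x \<in> total (grd V) \<Longrightarrow> y \<in> total (grd V) \<Longrightarrow>
   hcomp (grd V) (x + y) i = hcomp (grd V) x i + hcomp (grd V) y i"
  by (rule fun_cong[OF hcomp_eqI[OF graded]]) (intro gdecomp_add vector_space subspace hcomp_decomp)

lemma hcomp_scale:
  "x \<in> total (grd V) \<Longrightarrow> hcomp (grd V) (smul V c x) i = smul V c (hcomp (grd V) x i)"
  by (rule fun_cong[OF hcomp_eqI[OF graded]]) (intro gdecomp_scale vector_space subspace hcomp_decomp)

lemma hcomp_in: "x \<in> total (grd V) \<Longrightarrow> hcomp (grd V) x i \<in> grd V i"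
  using hcomp_decomp by (auto simp: gdecomp_def)

lemma hcomp_finite: "x \<in> total (grd V) \<Longrightarrow> finite {i. hcomp (grd V) x i \<noteq> 0}"
  using hcomp_decomp by (auto simp: gdecomp_def)

lemma hcomp_sum: "x \<in> total (grd V) \<Longrightarrow> x = (\<Sum>i | hcomp (grd V) x i \<noteq> 0. hcomp (grd V) x i)"
  using hcomp_decomp by (auto simp: gdecomp_def)

text \<open>Signs are formulas in the degrees, so facts are proved for homogeneous elements first
  and carried to all elements by this rule. The additive case offers membership in the total space
  because many of the maps are additive only there.\<close>

lemma total_induct [consumes 1, case_names hom add]:
  assumes x: "x \<in> total (grd V)"
    and hom: "\<And>i x. x \<in> grd V i \<Longrightarrow> P x"
    and add: "\<And>x y. x \<in> total (grd V) \<Longrightarrow> y \<in> total (grd V) \<Longrightarrow> P x \<Longrightarrow> P y \<Longrightarrow> P (x + y)"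
  shows "P x"
proof -
  have "P (sum (hcomp (grd V) x) I) \<and> sum (hcomp (grd V) x) I \<in> total (grd V)" if "finite I" for I
    using that
  proof (induction I)
    case empty
    then show ?case using hom[OF grd_0] by simp
  next
    case (insert i I)
    then show ?case
      using hom[OF hcomp_in[OF x]] total_grd[OF hcomp_in[OF x]] by (auto intro!: add total_add)
  qed
  then show ?thesis using hcomp_sum[OF x] hcomp_finite[OF x] by metis
qed

lemma hext_cong:
  assumes "x \<in> total (grd V)" "\<And>i u. u \<in> grd V i \<Longrightarrow> \<phi> i u = \<psi> i u"
  shows "hext (grd V) \<phi> x = hext (grd V) \<psi> x"
  unfolding hext_def using assms hcomp_in by (intro sum.cong) auto

lemma hext_superset:
  assumes "finite F" "\<And>i. hcomp (grd V) x i \<noteq> 0 \<Longrightarrow> i \<in> F" "\<And>i. \<phi> i 0 = 0"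
  shows "hext (grd V) \<phi> x = (\<Sum>i\<in>F. \<phi> i (hcomp (grd V) x i))"
  unfolding hext_def using assms by (intro sum.mono_neutral_left) auto

lemma hext_hom: "x \<in> grd V i \<Longrightarrow> \<phi> i 0 = 0 \<Longrightarrow> hext (grd V) \<phi> x = \<phi> i x"
proof -
  assume x: "x \<in> grd V i" "\<phi> i 0 = 0"
  have "{j. hcomp (grd V) x j \<noteq> 0} = (if x = 0 then {} else {i})"
    using hcomp_grd[OF x(1)] by auto
  then show ?thesis using x hcomp_grd[OF x(1)] by (auto simp: hext_def)
qed

lemma hext_add:
  fixes \<phi> :: "int \<Rightarrow> 'v \<Rightarrow> 'w::ab_group_add"
  assumes "\<And>i u v. u \<in> grd V i \<Longrightarrow> v \<in> grd V i \<Longrightarrow> \<phi> i (u + v) = \<phi> i u + \<phi> i v"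
    and x: "x \<in> total (grd V)" and y: "y \<in> total (grd V)"
  shows "hext (grd V) \<phi> (x + y) = hext (grd V) \<phi> x + hext (grd V) \<phi> y"
proof -
  have z: "\<phi> i 0 = 0" for i using assms(1)[of 0 i 0] by simp
  \<comment> \<open>The supports of \<open>x\<close>, \<open>y\<close> and \<open>x + y\<close>
    differ, so all three sums are taken over one finite set that contains them.\<close>
  let ?F = "{i. hcomp (grd V) x i \<noteq> 0} \<union> {i. hcomp (grd V) y i \<noteq> 0}"
  have F: "finite ?F" using hcomp_finite x y by auto
  have "hext (grd V) \<phi> (x + y) = (\<Sum>i\<in>?F. \<phi> i (hcomp (grd V) (x + y) i))"
    by (rule hext_superset) (use F z x y in \<open>auto simp: hcomp_add\<close>)
  also have "\<dots> = (\<Sum>i\<in>?F. \<phi> i (hcomp (grd V) x i)) + (\<Sum>i\<in>?F. \<phi> i (hcomp (grd V) y i))"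
    by (simp add: hcomp_add x y assms(1) hcomp_in sum.distrib)
  also have "\<dots> = hext (grd V) \<phi> x + hext (grd V) \<phi> y"
    by (intro arg_cong2[where f = "(+)"] hext_superset[symmetric]) (use F z in auto)
  finally show ?thesis .
qed

lemma hext_scale:
  fixes \<phi> :: "int \<Rightarrow> 'v \<Rightarrow> 'w::ab_group_add"
  assumes "vector_space sc"
    and "\<And>i u. u \<in> grd V i \<Longrightarrow> \<phi> i (smul V c u) = sc c (\<phi> i u)" "\<And>i. \<phi> i 0 = 0"
    and x: "x \<in> total (grd V)"
  shows "hext (grd V) \<phi> (smul V c x) = sc c (hext (grd V) \<phi> x)"
proof -
  interpret W: Vector_Spaces.vector_space sc by fact
  let ?F = "{i. hcomp (grd V) x i \<noteq> 0}"
  have F: "finite ?F" using hcomp_finite x by auto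
  have "hext (grd V) \<phi> (smul V c x) = (\<Sum>i\<in>?F. \<phi> i (hcomp (grd V) (smul V c x) i))"
    by (rule hext_superset) (use F x assms in \<open>auto simp: hcomp_scale\<close>)
  also have "\<dots> = sc c (hext (grd V) \<phi> x)"
    by (simp add: hext_def hcomp_scale x assms hcomp_in W.scale_sum_right)
  finally show ?thesis .
qed

end

lemma hext_fun_add:
  fixes \<phi> \<psi> :: "int \<Rightarrow> 'v::comm_monoid_add \<Rightarrow> 'w::ab_group_add"
  shows "hext H (\<lambda>i x. \<phi> i x + \<psi> i x) x = hext H \<phi> x + hext H \<psi> x"
  by (simp add: hext_def sum.distrib)

lemma hext_fun_scale:
  fixes \<phi> :: "int \<Rightarrow> 'v::comm_monoid_add \<Rightarrow> 'w::ab_group_add"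
  assumes "vector_space sc"
  shows "hext H (\<lambda>i x. sc c (\<phi> i x)) x = sc c (hext H \<phi> x)"
proof -
  interpret W: Vector_Spaces.vector_space sc by fact
  show ?thesis by (simp add: hext_def W.scale_sum_right)
qed

section \<open>Linear functionals and the graded dual\<close>

lemma linear_functional_iff:
  fixes s :: "'k::field \<Rightarrow> 'v::ab_group_add \<Rightarrow> 'v"
  assumes "vector_space s"
  shows "Vector_Spaces.linear s (*) f \<longleftrightarrow> (\<forall>x y. f (x + y) = f x + f y) \<and> (\<forall>c x. f (s c x) = c * f x)"
  using assms vector_space_times by (auto simp: Vector_Spaces.linear_iff)

locale dga =
  fixes d :: int and A :: "('k::field, 'a::ab_group_add) dgalg"
  assumes dga: "dg_algebra A"
begin

sublocale A: graded_vs A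
  using dga by (simp add: graded_vs_def dg_algebra_def)

lemma total_A [simp]: "total (grd A) = UNIV"
  using dga by (simp add: dg_algebra_def)

abbreviation lin :: "('a \<Rightarrow> 'k) \<Rightarrow> bool" where
  "lin f \<equiv> Vector_Spaces.linear (smul A) (*) f"

abbreviation D :: "int \<Rightarrow> ('a \<Rightarrow> 'k) set" where
  "D n \<equiv> grd (dual A) n"

abbreviation TD :: "('a \<Rightarrow> 'k) set" where
  "TD \<equiv> total (grd (dual A))"

abbreviation pr :: "int \<Rightarrow> 'a \<Rightarrow> 'a" where
  "pr i x \<equiv> hcomp (grd A) x i"

lemma lin_iff: "lin f \<longleftrightarrow> (\<forall>x y. f (x + y) = f x + f y) \<and> (\<forall>c x. f (smul A c x) = c * f x)"
  by (rule linear_functional_iff[OF A.vector_space])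

lemma lin_add: "lin f \<Longrightarrow> f (x + y) = f x + f y"
  and lin_scale: "lin f \<Longrightarrow> f (smul A c x) = c * f x"
  by (auto simp: lin_iff)

lemma lin_0: "lin f \<Longrightarrow> f 0 = 0"
  using lin_scale[of f 0 0] by simp

lemma lin_minus: "lin f \<Longrightarrow> f (- x) = - f x"
  using lin_scale[of f "- 1" x] by simp

lemma lin_diff: "lin f \<Longrightarrow> f (x - y) = f x - f y"
  using lin_add[of f x "- y"] lin_minus[of f y] by simp

lemma lin_ksg: "lin f \<Longrightarrow> f (ksg e x) = sg e * f x"
  by (simp add: ksg_def sg_def lin_minus)

lemma lin_sum: "lin f \<Longrightarrow> f (sum h I) = (\<Sum>i\<in>I. f (h i))"
  by (induction I rule: infinite_finite_induct) (auto simp: lin_0 lin_add)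

lemma lin_sum_list: "lin f \<Longrightarrow> f (sum_list xs) = (\<Sum>x\<leftarrow>xs. f x)"
  by (induction xs) (auto simp: lin_0 lin_add)

lemma smul_dual [simp]: "smul (dual A) = (\<lambda>c f x. c * f x)"
  by (simp add: dual_def Let_def)

lemma D_iff: "f \<in> D n \<longleftrightarrow> lin f \<and> (\<forall>i. i \<noteq> - n \<longrightarrow> (\<forall>a \<in> grd A i. f a = 0))"
  by (simp add: dual_def Let_def)

lemma D_lin: "f \<in> D n \<Longrightarrow> lin f"
  by (simp add: D_iff)

lemma D_zero: "f \<in> D n \<Longrightarrow> a \<in> grd A i \<Longrightarrow> i + n \<noteq> 0 \<Longrightarrow> f a = 0"
proof -
  assume "f \<in> D n" "a \<in> grd A i" "i + n \<noteq> 0"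
  then show "f a = 0" by (cases "i = - n") (auto simp: D_iff)
qed

lemma lin_pr: "lin f \<Longrightarrow> lin (\<lambda>x. f (pr i x))"
  by (simp add: lin_iff A.hcomp_add A.hcomp_scale)

text \<open>Projecting first turns an arbitrary linear functional into a homogeneous one and keeps
  its values in the chosen degree.\<close>

lemma pr_D: "lin f \<Longrightarrow> (\<lambda>x. f (pr (- n) x)) \<in> D n"
  using lin_pr by (auto simp: D_iff A.hcomp_grd lin_0)

lemma D_eval: "f \<in> D n \<Longrightarrow> f x = f (pr (- n) x)"
proof -
  assume f: "f \<in> D n"
  have "f x = (\<Sum>i | pr i x \<noteq> 0. f (pr i x))"
    using arg_cong[OF A.hcomp_sum[of x], of f] lin_sum[OF D_lin[OF f]] by simp
  also have "\<dots> = (\<Sum>i | pr i x \<noteq> 0. if i = - n then f (pr (- n) x) else 0)"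
    using D_zero[OF f A.hcomp_in] by (intro sum.cong) auto
  also have "\<dots> = f (pr (- n) x)"
    using A.hcomp_finite[of x] lin_0[OF D_lin[OF f]] by (auto simp: sum.delta)
  finally show ?thesis .
qed

text \<open>A component of degree n sees only arguments of degree -n. In any decomposition of a
  functional it must therefore be that functional composed with the projection to degree -n, which
  forces uniqueness.\<close>

lemma graded_dual: "graded_space (dual A)"
  unfolding graded_space_def
proof (intro conjI allI ballI)
  show vs: "vector_space (smul (dual A))" using vector_space_fun by simp
  then interpret Vector_Spaces.vector_space "smul (dual A)" .
  show "subspace (D n)" for n
    unfolding subspace_def by (auto simp: D_iff lin_iff algebra_simps)
  fix f assume "f \<in> TD"
  then obtain c where c: "gdecomp (grd (dual A)) f c" by (auto simp: total_def)
  have u: "e = (\<lambda>n x. f (pr (- n) x))" if e: "gdecomp (grd (dual A)) f e" for e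
  proof (intro ext)
    fix n x
    have D: "e i \<in> D i" for i using e by (simp add: gdecomp_def)
    have "f (pr (- n) x) = (\<Sum>i | e i \<noteq> 0. e i (pr (- n) x))"
      using fun_cong[of f "\<Sum>i | e i \<noteq> 0. e i" "pr (- n) x"] e by (simp add: gdecomp_def sum_fun_apply)
    also have "\<dots> = (\<Sum>i | e i \<noteq> 0. if i = n then e n (pr (- n) x) else 0)"
      using D_zero[OF D A.hcomp_in] by (intro sum.cong) auto
    also have "\<dots> = e n (pr (- n) x)"
      using e by (auto simp: sum.delta gdecomp_def)
    finally show "e n x = f (pr (- n) x)" using D_eval[OF D] by simp
  qed
  show "\<exists>!c. gdecomp (grd (dual A)) f c"
    by (rule ex1I[of _ c]) (use c in simp, erule trans[OF u u[OF c, symmetric]])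
qed

sublocale D: graded_vs "dual A"
  using graded_dual by (simp add: graded_vs_def)

lemma TD_lin: "f \<in> TD \<Longrightarrow> lin f"
proof (induction rule: D.total_induct)
  case (hom i f)
  then show ?case by (rule D_lin)
next
  case (add f g)
  then show ?case by (simp add: lin_iff algebra_simps)
qed

lemma functional_exists:
  assumes "x \<noteq> 0" obtains f where "lin f" "f x = 1"
proof -
  interpret P: vector_space_pair "smul A" "(*) :: 'k \<Rightarrow> 'k \<Rightarrow> 'k"
    using A.vector_space vector_space_times by (simp add: vector_space_pair_def)
  have "A.vs.independent {x}" using assms by simp
  from P.linear_independent_extend[OF this, of "\<lambda>_. 1"]
  obtain f where "lin f" "f x = 1" by auto
  then show ?thesis by (rule that)
qed

text \<open>A nonzero element has a nonzero component. A functional with value 1 on that component,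
  precomposed with the projection, is homogeneous and still detects it.\<close>

lemma D_separates:
  assumes "\<And>n f. f \<in> D n \<Longrightarrow> f x = 0"
  shows "x = 0"
proof -
  have "pr i x = 0" for i
  proof (rule ccontr)
    assume "pr i x \<noteq> 0"
    then obtain f where f: "lin f" "f (pr i x) = 1" by (rule functional_exists)
    then show False using assms[OF pr_D[OF f(1), of "- i"]] by simp
  qed
  then show ?thesis using A.hcomp_sum[of x] by simp
qed

lemma D_separates_eq:
  assumes "\<And>n f. f \<in> D n \<Longrightarrow> f x = f y"
  shows "x = y"
  using D_separates[of "x - y"] assms by (simp add: lin_diff D_lin)

end

section \<open>Tensors\<close>

lemma gr_multilinear2I:
  assumes "\<And>i j u u' v. u \<in> grd V i \<Longrightarrow> u' \<in> grd V i \<Longrightarrow> v \<in> grd V j \<Longrightarrow>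
      \<phi> [(i, u + u'), (j, v)] = \<phi> [(i, u), (j, v)] + \<phi> [(i, u'), (j, v)]"
    and "\<And>i j u v v'. u \<in> grd V i \<Longrightarrow> v \<in> grd V j \<Longrightarrow> v' \<in> grd V j \<Longrightarrow>
      \<phi> [(i, u), (j, v + v')] = \<phi> [(i, u), (j, v)] + \<phi> [(i, u), (j, v')]"
    and "\<And>i j u v c. u \<in> grd V i \<Longrightarrow> v \<in> grd V j \<Longrightarrow>
      \<phi> [(i, smul V c u), (j, v)] = sc c (\<phi> [(i, u), (j, v)])"
    and "\<And>i j u v c. u \<in> grd V i \<Longrightarrow> v \<in> grd V j \<Longrightarrow>
      \<phi> [(i, u), (j, smul V c v)] = sc c (\<phi> [(i, u), (j, v)])"
  shows "gr_multilinear V 2 sc \<phi>"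
  unfolding gr_multilinear_def
proof (intro allI impI)
  fix xs k u v c
  assume *: "length xs = 2 \<and> hlist V xs \<and> k < 2 \<and> u \<in> grd V (fst (xs ! k)) \<and> v \<in> grd V (fst (xs ! k))"
  then obtain i x j y where xs: "xs = [(i, x), (j, y)]"
    by (auto simp: length_Suc_conv numeral_2_eq_2)
  have "k = 0 \<or> k = 1" using * by auto
  with * assms show "\<phi> (xs[k := (fst (xs ! k), u + v)]) =
        \<phi> (xs[k := (fst (xs ! k), u)]) + \<phi> (xs[k := (fst (xs ! k), v)]) \<and>
      \<phi> (xs[k := (fst (xs ! k), smul V c u)]) = sc c (\<phi> (xs[k := (fst (xs ! k), u)]))"
    unfolding xs hlist_def by auto
qed

lemma gr_multilinear3I:
  assumes "\<And>i j l u u' v w. u \<in> grd V i \<Longrightarrow> u' \<in> grd V i \<Longrightarrow> v \<in> grd V j \<Longrightarrow> w \<in> grd V l \<Longrightarrow>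
      \<phi> [(i, u + u'), (j, v), (l, w)] = \<phi> [(i, u), (j, v), (l, w)] + \<phi> [(i, u'), (j, v), (l, w)]"
    and "\<And>i j l u v v' w. u \<in> grd V i \<Longrightarrow> v \<in> grd V j \<Longrightarrow> v' \<in> grd V j \<Longrightarrow> w \<in> grd V l \<Longrightarrow>
      \<phi> [(i, u), (j, v + v'), (l, w)] = \<phi> [(i, u), (j, v), (l, w)] + \<phi> [(i, u), (j, v'), (l, w)]"
    and "\<And>i j l u v w w'. u \<in> grd V i \<Longrightarrow> v \<in> grd V j \<Longrightarrow> w \<in> grd V l \<Longrightarrow> w' \<in> grd V l \<Longrightarrow>
      \<phi> [(i, u), (j, v), (l, w + w')] = \<phi> [(i, u), (j, v), (l, w)] + \<phi> [(i, u), (j, v), (l, w')]"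
    and "\<And>i j l u v w c. u \<in> grd V i \<Longrightarrow> v \<in> grd V j \<Longrightarrow> w \<in> grd V l \<Longrightarrow>
      \<phi> [(i, smul V c u), (j, v), (l, w)] = sc c (\<phi> [(i, u), (j, v), (l, w)])"
    and "\<And>i j l u v w c. u \<in> grd V i \<Longrightarrow> v \<in> grd V j \<Longrightarrow> w \<in> grd V l \<Longrightarrow>
      \<phi> [(i, u), (j, smul V c v), (l, w)] = sc c (\<phi> [(i, u), (j, v), (l, w)])"
    and "\<And>i j l u v w c. u \<in> grd V i \<Longrightarrow> v \<in> grd V j \<Longrightarrow> w \<in> grd V l \<Longrightarrow>
      \<phi> [(i, u), (j, v), (l, smul V c w)] = sc c (\<phi> [(i, u), (j, v), (l, w)])"
  shows "gr_multilinear V 3 sc \<phi>"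
  unfolding gr_multilinear_def
proof (intro allI impI)
  fix xs k u v c
  assume *: "length xs = 3 \<and> hlist V xs \<and> k < 3 \<and> u \<in> grd V (fst (xs ! k)) \<and> v \<in> grd V (fst (xs ! k))"
  then obtain i x j y l z where xs: "xs = [(i, x), (j, y), (l, z)]"
    by (auto simp: length_Suc_conv numeral_3_eq_3)
  have "k = 0 \<or> k = 1 \<or> k = 2" using * by auto
  with * assms show "\<phi> (xs[k := (fst (xs ! k), u + v)]) =
        \<phi> (xs[k := (fst (xs ! k), u)]) + \<phi> (xs[k := (fst (xs ! k), v)]) \<and>
      \<phi> (xs[k := (fst (xs ! k), smul V c u)]) = sc c (\<phi> (xs[k := (fst (xs ! k), u)]))"
    unfolding xs hlist_def by (elim disjE) (auto simp: numeral_2_eq_2)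
qed

lemma sum_list_fun_apply: "(\<Sum>x\<leftarrow>xs. F x) y = (\<Sum>x\<leftarrow>xs. F x y)"
  for F :: "_ \<Rightarrow> _ \<Rightarrow> 'v::ab_group_add"
  by (induction xs) auto

context dga
begin

abbreviation tsc :: "'k \<Rightarrow> ('k, 'a) tens \<Rightarrow> ('k, 'a) tens" where
  "tsc c T \<equiv> (\<lambda>fs. c * T fs)"

lemma vector_space_tens: "vector_space tsc"
  by (rule vector_space_fun)

lemma ptens_add: "ptens A (us @ (x + y) # vs) = ptens A (us @ x # vs) + ptens A (us @ y # vs)"
proof
  fix fs :: "('a \<Rightarrow> 'k) list"
  show "ptens A (us @ (x + y) # vs) fs = (ptens A (us @ x # vs) + ptens A (us @ y # vs)) fs"
  proof (cases "length fs = Suc (length us + length vs) \<and> (\<forall>f\<in>set fs. lin f)")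
    case True
    then have "length us < length fs" by simp
    from id_take_nth_drop[OF this] obtain gs f hs where fs: "fs = gs @ f # hs" "length gs = length us"
      using \<open>length us < length fs\<close> by (metis length_take min.absorb4)
    then show ?thesis using True
      by (simp add: ptens_def lin_add algebra_simps)
  qed (auto simp: ptens_def)
qed

lemma ptens_scale: "ptens A (us @ smul A c x # vs) = tsc c (ptens A (us @ x # vs))"
proof
  fix fs :: "('a \<Rightarrow> 'k) list"
  show "ptens A (us @ smul A c x # vs) fs = c * ptens A (us @ x # vs) fs"
  proof (cases "length fs = Suc (length us + length vs) \<and> (\<forall>f\<in>set fs. lin f)")
    case True
    then have "length us < length fs" by simp
    from id_take_nth_drop[OF this] obtain gs f hs where fs: "fs = gs @ f # hs" "length gs = length us"
      using \<open>length us < length fs\<close> by (metis length_take min.absorb4)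
    then show ?thesis using True
      by (simp add: ptens_def lin_scale algebra_simps)
  qed (auto simp: ptens_def)
qed

lemmas ptens2_add [simp] = ptens_add[of "[]" _ _ "[v]" for v, simplified]
  ptens_add[of "[u]" _ _ "[]" for u, simplified]
lemmas ptens2_scale [simp] = ptens_scale[of "[]" _ _ "[v]" for v, simplified]
  ptens_scale[of "[u]" _ _ "[]" for u, simplified]
lemmas ptens3_add [simp] = ptens_add[of "[]" _ _ "[v, w]" for v w, simplified]
  ptens_add[of "[u]" _ _ "[w]" for u w, simplified] ptens_add[of "[u, v]" _ _ "[]" for u v, simplified]
lemmas ptens3_scale [simp] = ptens_scale[of "[]" _ _ "[v, w]" for v w, simplified]
  ptens_scale[of "[u]" _ _ "[w]" for u w, simplified] ptens_scale[of "[u, v]" _ _ "[]" for u v, simplified]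

lemma ptens2 [simp]: "lin f \<Longrightarrow> lin g \<Longrightarrow> ptens A [u, v] [f, g] = f u * g v"
  and ptens3 [simp]: "lin f \<Longrightarrow> lin g \<Longrightarrow> lin h \<Longrightarrow> ptens A [u, v, w] [f, g, h] = f u * g v * h w"
  by (simp_all add: ptens_def mult.assoc)

lemma tpow_0 [simp]: "0 \<in> tpow A n"
  by (auto simp: tpow_def trep_def intro!: exI[of _ "[]"])

lemma tpow_add: "S \<in> tpow A n \<Longrightarrow> T \<in> tpow A n \<Longrightarrow> S + T \<in> tpow A n"
proof -
  assume "S \<in> tpow A n" "T \<in> tpow A n"
  then obtain L M where "trep A n S L" "trep A n T M" by (auto simp: tpow_def)
  then have "trep A n (S + T) (L @ M)" by (auto simp: trep_def)
  then show ?thesis by (auto simp: tpow_def)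
qed

lemma tpow_ptens: "hlist A xs \<Longrightarrow> length xs = n \<Longrightarrow> ptens A (map snd xs) \<in> tpow A n"
  by (auto simp: tpow_def trep_def intro!: exI[of _ "[xs]"])

text \<open>Representing lists carry no coefficients, so the scalar is absorbed by the first factor.
  This is why the order is a successor.\<close>

lemma tpow_scale:
  assumes "T \<in> tpow A (Suc n)" shows "tsc c T \<in> tpow A (Suc n)"
proof -
  obtain L where L: "trep A (Suc n) T L" using assms by (auto simp: tpow_def)
  have "tsc c T = (\<Sum>xs\<leftarrow>L. tsc c (ptens A (map snd xs)))"
    using L by (auto simp: trep_def sum_list_fun_apply sum_list_const_mult)
  also have "\<dots> = (\<Sum>xs\<leftarrow>map (\<lambda>xs. (fst (hd xs), smul A c (snd (hd xs))) # tl xs) L. ptens A (map snd xs))"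
    unfolding map_map
  proof (intro arg_cong[where f = sum_list] map_cong refl)
    fix xs assume "xs \<in> set L"
    then have "length xs = Suc n" using L by (auto simp: trep_def)
    then obtain x ys where "xs = x # ys" by (cases xs) auto
    then show "tsc c (ptens A (map snd xs)) =
        ((\<lambda>xs. ptens A (map snd xs)) \<circ> (\<lambda>xs. (fst (hd xs), smul A c (snd (hd xs))) # tl xs)) xs"
      using ptens_scale[of "[]" c "snd x" "map snd ys"] by simp
  qed
  finally have "trep A (Suc n) (tsc c T) (map (\<lambda>xs. (fst (hd xs), smul A c (snd (hd xs))) # tl xs) L)"
    using L unfolding trep_def
  proof (intro conjI ballI)
    fix ys assume "ys \<in> set (map (\<lambda>xs. (fst (hd xs), smul A c (snd (hd xs))) # tl xs) L)"
    then obtain xs where xs: "xs \<in> set L" "ys = (fst (hd xs), smul A c (snd (hd xs))) # tl xs" by auto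
    then have "length xs = Suc n" using L by (auto simp: trep_def)
    then obtain x zs where "xs = x # zs" by (cases xs) auto
    with xs L show "length ys = Suc n" "hlist A ys"
      by (auto simp: trep_def hlist_def split_def intro: A.grd_scale)
  qed simp
  then show ?thesis by (auto simp: tpow_def)
qed

lemma tpow_minus:
  assumes "T \<in> tpow A (Suc n)" shows "- T \<in> tpow A (Suc n)"
proof -
  have "- T = tsc (- 1) T" by auto
  then show ?thesis using tpow_scale[OF assms, of "- 1"] by simp
qed

lemma tpow_ksg: "T \<in> tpow A (Suc n) \<Longrightarrow> ksg e T \<in> tpow A (Suc n)"
  by (simp add: ksg_def tpow_minus)

lemma tpow2_ksg: "T \<in> tpow A 2 \<Longrightarrow> ksg e T \<in> tpow A 2"
  using tpow_ksg[of T 1 e] by (simp add: numeral_2_eq_2)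

lemma tpow3_ksg: "T \<in> tpow A 3 \<Longrightarrow> ksg e T \<in> tpow A 3"
  using tpow_ksg[of T 2 e] by (simp add: numeral_3_eq_3 numeral_2_eq_2)

lemma tpow_sum: "(\<And>i. i \<in> I \<Longrightarrow> F i \<in> tpow A n) \<Longrightarrow> sum F I \<in> tpow A n"
  by (induction I rule: infinite_finite_induct) (auto intro: tpow_add)

lemma tpow_sum_list: "(\<And>x. x \<in> set xs \<Longrightarrow> F x \<in> tpow A n) \<Longrightarrow> (\<Sum>x\<leftarrow>xs. F x) \<in> tpow A n"
  by (induction xs) (auto intro: tpow_add)

lemma tpow_apply_0: "T \<in> tpow A n \<Longrightarrow> \<not> (length fs = n \<and> (\<forall>f\<in>set fs. lin f)) \<Longrightarrow> T fs = 0"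
proof -
  assume T: "T \<in> tpow A n" and fs: "\<not> (length fs = n \<and> (\<forall>f\<in>set fs. lin f))"
  from T obtain L where L: "trep A n T L" by (auto simp: tpow_def)
  have "T fs = (\<Sum>xs\<leftarrow>L. ptens A (map snd xs) fs)" using L by (simp add: trep_def sum_list_fun_apply)
  also have "\<dots> = (\<Sum>xs\<leftarrow>L. 0)"
    using L fs by (intro arg_cong[where f = sum_list] map_cong) (auto simp: trep_def ptens_def)
  finally show ?thesis by simp
qed

text \<open>A representation involves only finitely many degrees, so in any one slot a linear
  functional acts as the finite sum of its homogeneous parts in those degrees.\<close>

lemma trep_slot:
  assumes L: "trep A n T L" and n: "length gs + Suc (length hs) = n"
    and lin: "\<forall>f\<in>set gs. lin f" "lin f" "\<forall>f\<in>set hs. lin f"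
    and K: "finite K" "\<And>xs i. xs \<in> set L \<Longrightarrow> i \<in> fst ` set xs \<Longrightarrow> i \<in> K"
  shows "T (gs @ f # hs) = (\<Sum>k\<in>K. T (gs @ (\<lambda>x. f (pr k x)) # hs))"
proof -
  have T: "T fs = (\<Sum>xs\<leftarrow>L. ptens A (map snd xs) fs)" for fs
    using L by (simp add: trep_def sum_list_fun_apply)
  have "ptens A (map snd xs) (gs @ f # hs) = (\<Sum>k\<in>K. ptens A (map snd xs) (gs @ (\<lambda>x. f (pr k x)) # hs))"
    if xs: "xs \<in> set L" for xs
  proof -
    have len: "length xs = n" and h: "hlist A xs" using L xs by (auto simp: trep_def)
    have lt: "length gs < length xs" using len n by simp
    let ?x = "xs ! length gs"
    have mem: "?x \<in> set xs" using lt by simp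
    have hom: "snd ?x \<in> grd A (fst ?x)" using h mem by (auto simp: hlist_def split_def)
    have dr: "drop (length gs) (map snd xs) = snd ?x # drop (Suc (length gs)) (map snd xs)"
      using lt by (metis Cons_nth_drop_Suc drop_map list.simps(9))
    have split: "(\<Prod>(f, v)\<leftarrow>zip (gs @ f # hs) (map snd xs). f v) =
        (\<Prod>(f, v)\<leftarrow>zip gs (take (length gs) (map snd xs)). f v) *
        (f (snd ?x) * (\<Prod>(f, v)\<leftarrow>zip hs (drop (Suc (length gs)) (map snd xs)). f v))" for f :: "'a \<Rightarrow> 'k"
      unfolding zip_append1 dr by simp
    have f: "f (snd ?x) = (\<Sum>k\<in>K. f (pr k (snd ?x)))"
    proof -
      have "(\<Sum>k\<in>K. f (pr k (snd ?x))) = (\<Sum>k\<in>K. if k = fst ?x then f (snd ?x) else 0)"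
        by (intro sum.cong refl) (simp add: A.hcomp_grd[OF hom] lin_0[OF lin(2)])
      also have "\<dots> = f (snd ?x)" using K(1) K(2)[OF xs] mem by (simp add: sum.delta)
      finally show ?thesis by simp
    qed
    show ?thesis
      using len n lin lin_pr[OF lin(2)]
      unfolding ptens_def split by (subst f) (simp add: sum_distrib_left sum_distrib_right ball_Un)
  qed
  then have "T (gs @ f # hs) = (\<Sum>xs\<leftarrow>L. \<Sum>k\<in>K. ptens A (map snd xs) (gs @ (\<lambda>x. f (pr k x)) # hs))"
    unfolding T by (intro arg_cong[where f = sum_list] map_cong) auto
  also have "\<dots> = (\<Sum>k\<in>K. \<Sum>xs\<leftarrow>L. ptens A (map snd xs) (gs @ (\<lambda>x. f (pr k x)) # hs))"
    by (induction L) (auto simp: sum.distrib)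
  finally show ?thesis unfolding T .
qed

text \<open>Tensors are functions of arbitrary linear functionals, yet homogeneous ones determine
  them. The slots are made homogeneous one at a time from the right, over a finite set of degrees
  that serves both tensors; in the induction \<open>hs\<close> holds the slots already
  treated.\<close>

lemma tens_ext:
  assumes S: "S \<in> tpow A n" and T: "T \<in> tpow A n"
    and eq: "\<And>fs. length fs = n \<Longrightarrow> \<forall>f\<in>set fs. \<exists>q. f \<in> D q \<Longrightarrow> S fs = T fs"
  shows "S = T"
proof -
  obtain L M where L: "trep A n S L" and M: "trep A n T M" using S T by (auto simp: tpow_def)
  define K where "K = (\<Union>xs\<in>set (L @ M). fst ` set xs)"
  have K: "finite K" by (simp add: K_def)
  have KL: "\<And>xs i. xs \<in> set L \<Longrightarrow> i \<in> fst ` set xs \<Longrightarrow> i \<in> K"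
    and KM: "\<And>xs i. xs \<in> set M \<Longrightarrow> i \<in> fst ` set xs \<Longrightarrow> i \<in> K"
    by (auto simp: K_def)
  have *: "S (gs @ hs) = T (gs @ hs)"
    if "length gs + length hs = n" "\<forall>f\<in>set gs. lin f" "\<forall>f\<in>set hs. \<exists>q. f \<in> D q" for gs hs
    using that
  proof (induction gs arbitrary: hs rule: rev_induct)
    case Nil
    then show ?case using eq by simp
  next
    case (snoc f gs)
    have hs: "\<forall>f\<in>set hs. lin f" using snoc.prems(3) D_lin by blast
    have "S (gs @ f # hs) = (\<Sum>k\<in>K. S (gs @ (\<lambda>x. f (pr k x)) # hs))"
      by (rule trep_slot[OF L _ _ _ _ K KL]) (use snoc.prems hs in auto)
    also have "\<dots> = (\<Sum>k\<in>K. T (gs @ (\<lambda>x. f (pr k x)) # hs))"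
    proof (intro sum.cong refl snoc.IH)
      fix k
      have "(\<lambda>x. f (pr k x)) \<in> D (- k)" using pr_D[of f "- k"] snoc.prems by simp
      then show "\<forall>f\<in>set ((\<lambda>x. f (pr k x)) # hs). \<exists>q. f \<in> D q"
        using snoc.prems by auto
    qed (use snoc.prems in auto)
    also have "\<dots> = T (gs @ f # hs)"
      by (rule trep_slot[OF M _ _ _ _ K KM, symmetric]) (use snoc.prems hs in auto)
    finally show ?case by simp
  qed
  show ?thesis
  proof
    fix fs
    show "S fs = T fs"
      using *[of fs "[]"] tpow_apply_0[OF S, of fs] tpow_apply_0[OF T, of fs] by (metis append_Nil2
        add_0_right empty_iff list.set(1) list.size(3))
  qed
qed

lemma tens2_ext:
  assumes "S \<in> tpow A 2" "T \<in> tpow A 2"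
    and "\<And>p q f g. f \<in> D p \<Longrightarrow> g \<in> D q \<Longrightarrow> S [f, g] = T [f, g]"
  shows "S = T"
proof (rule tens_ext[OF assms(1,2)])
  fix fs assume "length fs = 2" "\<forall>f\<in>set fs. \<exists>q. f \<in> D q"
  then show "S fs = T fs" using assms(3) by (auto simp: length_Suc_conv numeral_2_eq_2)
qed

lemma tens3_ext:
  assumes "S \<in> tpow A 3" "T \<in> tpow A 3"
    and "\<And>p q r f g h. f \<in> D p \<Longrightarrow> g \<in> D q \<Longrightarrow> h \<in> D r \<Longrightarrow> S [f, g, h] = T [f, g, h]"
  shows "S = T"
proof (rule tens_ext[OF assms(1,2)])
  fix fs assume "length fs = 3" "\<forall>f\<in>set fs. \<exists>q. f \<in> D q"
  then show "S fs = T fs" using assms(3) by (auto simp: length_Suc_conv numeral_3_eq_3)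
qed

text \<open>Degrees and factors of the summands as quadruples, so that evaluating a lifted map needs
  no case distinction on lists of length two.\<close>

definition quads :: "(int \<times> 'a \<times> int \<times> 'a) list \<Rightarrow> ('k, 'a) tens \<Rightarrow> bool" where
  "quads Q T \<longleftrightarrow> (\<forall>(i, u, j, v) \<in> set Q. u \<in> grd A i \<and> v \<in> grd A j) \<and>
     T = (\<Sum>(i, u, j, v) \<leftarrow> Q. ptens A [u, v])"

lemma quadsE:
  assumes "T \<in> tpow A 2" obtains Q where "quads Q T"
proof -
  obtain L where L: "trep A 2 T L" using assms by (auto simp: tpow_def)
  let ?q = "\<lambda>xs. (fst (xs ! 0), snd (xs ! 0), fst (xs ! 1), snd (xs ! 1)) :: int \<times> 'a \<times> int \<times> 'a"
  have two: "\<exists>i u j v. xs = [(i, u), (j, v)] \<and> u \<in> grd A i \<and> v \<in> grd A j" if "xs \<in> set L" for xs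
  proof -
    have "length xs = 2" "hlist A xs" using L that by (auto simp: trep_def)
    then show ?thesis by (auto simp: length_Suc_conv numeral_2_eq_2 hlist_def)
  qed
  have "quads (map ?q L) T"
    unfolding quads_def
  proof (intro conjI ballI)
    fix x assume "x \<in> set (map ?q L)"
    then show "case x of (i, u, j, v) \<Rightarrow> u \<in> grd A i \<and> v \<in> grd A j" using two by fastforce
  next
    have "T = (\<Sum>xs\<leftarrow>L. ptens A (map snd xs))" using L by (simp add: trep_def)
    also have "\<dots> = (\<Sum>xs\<leftarrow>L. ptens A [snd (xs ! 0), snd (xs ! 1)])"
      using two by (intro arg_cong[where f = sum_list] map_cong) fastforce+
    finally show "T = (\<Sum>(i, u, j, v)\<leftarrow>map ?q L. ptens A [u, v])"
      by (simp add: comp_def split_def)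
  qed
  then show ?thesis by (rule that)
qed

lemma quads_in: "quads Q T \<Longrightarrow> (i, u, j, v) \<in> set Q \<Longrightarrow> u \<in> grd A i"
  "quads Q T \<Longrightarrow> (i, u, j, v) \<in> set Q \<Longrightarrow> v \<in> grd A j"
  by (auto simp: quads_def)

lemma tpow_ptens2: "u \<in> grd A i \<Longrightarrow> v \<in> grd A j \<Longrightarrow> ptens A [u, v] \<in> tpow A 2"
  using tpow_ptens[of "[(i, u), (j, v)]" 2] by (auto simp: hlist_def)

lemma tpow_ptens3: "u \<in> grd A i \<Longrightarrow> v \<in> grd A j \<Longrightarrow> w \<in> grd A l \<Longrightarrow> ptens A [u, v, w] \<in> tpow A 3"
  using tpow_ptens[of "[(i, u), (j, v), (l, w)]" 3] by (auto simp: hlist_def)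

lemma quads_tpow: "quads Q T \<Longrightarrow> T \<in> tpow A 2"
  unfolding quads_def by (auto intro!: tpow_sum_list tpow_ptens2)

lemma quads_tlift:
  assumes Q: "quads Q T" and \<phi>: "gr_multilinear A 2 sc \<phi>" and sc: "vector_space sc"
  shows "tlift A 2 \<phi> T = (\<Sum>(i, u, j, v)\<leftarrow>Q. \<phi> [(i, u), (j, v)])"
proof -
  have "trep A 2 T (map (\<lambda>(i, u, j, v). [(i, u), (j, v)]) Q)"
    using Q by (force simp: trep_def quads_def hlist_def comp_def split_def)
  from tlift_eq[OF A.graded total_A sc \<phi> this] show ?thesis by (simp add: comp_def split_def)
qed

lemma quads_apply:
  assumes "quads Q T" "lin f" "lin g"
  shows "T [f, g] = (\<Sum>(i, u, j, v)\<leftarrow>Q. f u * g v)"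
  using assms by (simp add: quads_def sum_list_fun_apply split_def)

lemma sum_list_split_cong:
  assumes "\<And>i u j v. (i, u, j, v) \<in> set Q \<Longrightarrow> F i u j v = G i u j v"
  shows "(\<Sum>(i, u, j, v)\<leftarrow>Q. F i u j v) = (\<Sum>(i, u, j, v)\<leftarrow>Q. G i u j v)"
  using assms by (intro arg_cong[where f = sum_list] map_cong) auto

text \<open>One evaluation rule for the tensor-valued maps on A \<otimes> A. It allows two terms
  because of \<open>dif2\<close>; the other applications set the second coefficient to zero.\<close>

lemma tlift2_tens:
  assumes T: "T \<in> tpow A 2" and \<phi>: "gr_multilinear A 2 tsc \<phi>"
  shows "(\<And>i u j v. u \<in> grd A i \<Longrightarrow> v \<in> grd A j \<Longrightarrow> \<phi> [(i, u), (j, v)] \<in> tpow A n) \<Longrightarrow> tlift A 2 \<phi> T \<in> tpow A n"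
    and "(\<And>i u j v. u \<in> grd A i \<Longrightarrow> v \<in> grd A j \<Longrightarrow> \<phi> [(i, u), (j, v)] fs = c * (f u * g v) + c' * (f' u * g' v)) \<Longrightarrow>
      lin f \<Longrightarrow> lin g \<Longrightarrow> lin f' \<Longrightarrow> lin g' \<Longrightarrow> tlift A 2 \<phi> T fs = c * T [f, g] + c' * T [f', g']"
proof -
  obtain Q where Q: "quads Q T" using quadsE[OF T] .
  note eq = quads_tlift[OF Q \<phi> vector_space_tens]
  show "tlift A 2 \<phi> T \<in> tpow A n"
    if "\<And>i u j v. u \<in> grd A i \<Longrightarrow> v \<in> grd A j \<Longrightarrow> \<phi> [(i, u), (j, v)] \<in> tpow A n"
    unfolding eq using that quads_in[OF Q] by (intro tpow_sum_list) (clarify, blast)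
  show "tlift A 2 \<phi> T fs = c * T [f, g] + c' * T [f', g']"
    if h: "\<And>i u j v. u \<in> grd A i \<Longrightarrow> v \<in> grd A j \<Longrightarrow> \<phi> [(i, u), (j, v)] fs = c * (f u * g v) + c' * (f' u * g' v)"
      and lin: "lin f" "lin g" "lin f'" "lin g'"
  proof -
    have "tlift A 2 \<phi> T fs = (\<Sum>(i, u, j, v)\<leftarrow>Q. \<phi> [(i, u), (j, v)] fs)"
      by (simp add: eq sum_list_fun_apply split_def)
    also have "\<dots> = (\<Sum>(i, u, j, v)\<leftarrow>Q. c * (f u * g v) + c' * (f' u * g' v))"
      by (rule sum_list_split_cong) (use h quads_in[OF Q] in blast)
    also have "\<dots> = c * T [f, g] + c' * T [f', g']"
      by (simp add: quads_apply[OF Q] lin sum_list_const_mult[symmetric] sum_list_addf[symmetric] split_def)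
    finally show ?thesis .
  qed
qed

section \<open>Operations on tensors of order two\<close>

text \<open>A summand contributes only if its first factor has degree -p. There the Koszul sign is
  the same for all summands and can be taken out of the sum. The operations below are evaluated by
  the same argument.\<close>

lemma fun_tens_apply:
  assumes T: "T \<in> tpow A 2" and f: "f \<in> D p" and g: "lin g"
  shows "fun_tens A f q g T = sg (p * q) * T [f, g]"
proof -
  obtain Q where Q: "quads Q T" using quadsE[OF T] .
  let ?\<phi> = "\<lambda>xs :: (int \<times> 'a) list. let (i, v) = xs ! 0; (j, w) = xs ! 1 in ksg (q * i) (f v * g w)"
  have "gr_multilinear A 2 (*) ?\<phi>"
    by (rule gr_multilinear2I)
      (simp_all add: lin_add[OF D_lin[OF f]] lin_add[OF g] lin_scale[OF D_lin[OF f]] lin_scale[OF g]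
        ksg_field algebra_simps)
  then have "fun_tens A f q g T = (\<Sum>(i, u, j, v)\<leftarrow>Q. ?\<phi> [(i, u), (j, v)])"
    unfolding fun_tens_def by (rule quads_tlift[OF Q _ vector_space_times])
  also have "\<dots> = (\<Sum>(i, u, j, v)\<leftarrow>Q. sg (p * q) * (f u * g v))"
  proof (rule sum_list_split_cong)
    fix i u j v assume "(i, u, j, v) \<in> set Q"
    then have u: "u \<in> grd A i" using quads_in[OF Q] by blast
    show "?\<phi> [(i, u), (j, v)] = sg (p * q) * (f u * g v)"
    proof (cases "i + p = 0")
      case True
      then have "i = - p" by simp
      then show ?thesis by (simp add: ksg_field sg_def)
    qed (simp add: D_zero[OF f u] ksg_field)
  qed
  also have "\<dots> = sg (p * q) * T [f, g]"
    by (simp add: quads_apply[OF Q D_lin[OF f] g] sum_list_const_mult[symmetric] split_def)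
  finally show ?thesis .
qed

lemma flip_multilinear:
  "gr_multilinear A 2 tsc (\<lambda>xs. let (i, v) = xs ! 0; (j, w) = xs ! 1 in ksg (i * j) (ptens A [w, v]))"
  by (rule gr_multilinear2I) (auto simp: ksg_add ksg_def fun_eq_iff)

lemma flip_tpow: "T \<in> tpow A 2 \<Longrightarrow> flip A T \<in> tpow A 2"
  unfolding flip_def by (rule tlift2_tens(1)[OF _ flip_multilinear]) (auto intro: tpow2_ksg tpow_ptens2)

lemma flip_apply:
  assumes T: "T \<in> tpow A 2" and f: "f \<in> D p" and g: "g \<in> D q"
  shows "flip A T [f, g] = sg (p * q) * T [g, f]"
proof -
  have "flip A T [f, g] = sg (p * q) * T [g, f] + 0 * T [g, f]"
    unfolding flip_def
  proof (rule tlift2_tens(2)[OF T flip_multilinear])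
    fix i u j v assume uv: "u \<in> grd A i" "v \<in> grd A j"
    have "sg (i * j) * (f v * g u) = sg (p * q) * (g u * f v)"
    proof (cases "i + q = 0 \<and> j + p = 0")
      case True
      then have "i = - q" "j = - p" by auto
      then show ?thesis by (simp add: mult.commute)
    qed (use D_zero[OF f uv(2)] D_zero[OF g uv(1)] in auto)
    then show "(let (a, x) = [(i, u), (j, v)] ! 0; (b, y) = [(i, u), (j, v)] ! 1 in ksg (a * b) (ptens A [y, x])) [f, g] =
        sg (p * q) * (g u * f v) + 0 * (g u * f v)"
      by (simp add: ksg_fun_apply ksg_field D_lin[OF f] D_lin[OF g])
  qed (rule D_lin[OF g] D_lin[OF f])+
  then show ?thesis by simp
qed

lemma dif_A_lin: "Vector_Spaces.linear (smul A) (smul A) (dif A)"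
  using dga by (simp add: dg_algebra_def)

lemma dif_A_add [simp]: "dif A (x + y) = dif A x + dif A y"
  and dif_A_scale [simp]: "dif A (smul A c x) = smul A c (dif A x)"
  using dif_A_lin by (auto simp: Vector_Spaces.linear_iff)

lemma dif_A_0 [simp]: "dif A 0 = 0"
  using dif_A_scale[of 0 0] by simp

lemma dif_A_grd: "x \<in> grd A i \<Longrightarrow> dif A x \<in> grd A (i + 1)"
  using dga by (auto simp: dg_algebra_def)

lemma dif_A_dif_A [simp]: "dif A (dif A x) = 0"
  using dga by (auto simp: dg_algebra_def)

lemma mul_A_add [simp]: "mul A (x + y) z = mul A x z + mul A y z" "mul A z (x + y) = mul A z x + mul A z y"
  and mul_A_scale [simp]: "mul A (smul A c x) z = smul A c (mul A x z)" "mul A z (smul A c x) = smul A c (mul A z x)"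
  using dga by (auto simp: dg_algebra_def Vector_Spaces.linear_iff)

lemma mul_A_0 [simp]: "mul A 0 z = 0" "mul A z 0 = 0"
  using mul_A_scale(1)[of 0 0] mul_A_scale(2)[of _ 0 0] by simp_all

lemma mul_A_grd: "x \<in> grd A i \<Longrightarrow> y \<in> grd A j \<Longrightarrow> mul A x y \<in> grd A (i + j)"
  using dga by (auto simp: dg_algebra_def)

lemma mul_A_assoc: "mul A (mul A x y) z = mul A x (mul A y z)"
  using dga by (auto simp: dg_algebra_def)

lemma dif_mul_A: "x \<in> grd A i \<Longrightarrow> dif A (mul A x y) = mul A (dif A x) y + ksg i (mul A x (dif A y))"
  using dga by (auto simp: dg_algebra_def)

lemma lin_dif: "lin f \<Longrightarrow> lin (\<lambda>x. f (dif A x))"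
  by (simp add: lin_iff)

lemma lin_lmul: "lin f \<Longrightarrow> lin (\<lambda>x. f (mul A b x))"
  by (simp add: lin_iff)

lemma lin_rmul: "lin f \<Longrightarrow> lin (\<lambda>x. f (mul A x c))"
  by (simp add: lin_iff)

lemma D_dif: "f \<in> D p \<Longrightarrow> (\<lambda>x. f (dif A x)) \<in> D (p + 1)"
  using D_zero[of f p _ _, OF _ dif_A_grd] by (auto simp: D_iff lin_dif)

lemma D_lmul: "f \<in> D p \<Longrightarrow> b \<in> grd A j \<Longrightarrow> (\<lambda>x. f (mul A b x)) \<in> D (p + j)"
  using D_zero[of f p _ _, OF _ mul_A_grd] by (auto simp: D_iff lin_lmul)

lemma D_rmul: "f \<in> D p \<Longrightarrow> b \<in> grd A j \<Longrightarrow> (\<lambda>x. f (mul A x b)) \<in> D (p + j)"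
  using D_zero[of f p _ _, OF _ mul_A_grd] by (auto simp: D_iff lin_rmul)

lemma dif2_multilinear:
  "gr_multilinear A 2 tsc (\<lambda>xs. let (i, v) = xs ! 0; (j, w) = xs ! 1 in
      ptens A [dif A v, w] + ksg i (ptens A [v, dif A w]))"
  by (rule gr_multilinear2I) (auto simp: ksg_add ksg_def fun_eq_iff algebra_simps)

lemma dif2_tpow: "T \<in> tpow A 2 \<Longrightarrow> dif2 A T \<in> tpow A 2"
  unfolding dif2_def
  by (rule tlift2_tens(1)[OF _ dif2_multilinear]) (auto intro!: tpow_add tpow2_ksg intro: tpow_ptens2 dif_A_grd)

lemma dif2_apply:
  assumes T: "T \<in> tpow A 2" and f: "f \<in> D p" and g: "g \<in> D q"
  shows "dif2 A T [f, g] = T [\<lambda>x. f (dif A x), g] + sg p * T [f, \<lambda>x. g (dif A x)]"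
proof -
  note lin = D_lin[OF f] D_lin[OF g] lin_dif[OF D_lin[OF f]] lin_dif[OF D_lin[OF g]]
  have "dif2 A T [f, g] = 1 * T [\<lambda>x. f (dif A x), g] + sg p * T [f, \<lambda>x. g (dif A x)]"
    unfolding dif2_def
  proof (rule tlift2_tens(2)[OF T dif2_multilinear])
    fix i u j v assume u: "u \<in> grd A i"
    have "sg i * (f u * g (dif A v)) = sg p * (f u * g (dif A v))"
    proof (cases "i + p = 0")
      case True
      then have "i = - p" by simp
      then show ?thesis by (simp add: sg_def)
    qed (simp add: D_zero[OF f u])
    then show "(let (a, x) = [(i, u), (j, v)] ! 0; (b, y) = [(i, u), (j, v)] ! 1 in
        ptens A [dif A x, y] + ksg a (ptens A [x, dif A y])) [f, g] =
        1 * (f (dif A u) * g v) + sg p * (f u * g (dif A v))"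
      by (simp add: ksg_fun_apply ksg_field lin)
  qed (rule lin)+
  then show ?thesis by simp
qed

lemma rmul2:
  fixes c
  assumes T: "T \<in> tpow A 2" and c: "c \<in> grd A l"
  defines "S \<equiv> tlift A 2 (\<lambda>xs. let (p, x) = xs ! 0; (q, y) = xs ! 1 in ptens A [x, mul A y c]) T"
  shows "S \<in> tpow A 2" "lin f \<Longrightarrow> lin g \<Longrightarrow> S [f, g] = T [f, \<lambda>y. g (mul A y c)]"
proof -
  have ml: "gr_multilinear A 2 tsc (\<lambda>xs. let (p, x) = xs ! 0; (q, y) = xs ! 1 in ptens A [x, mul A y c])"
    by (rule gr_multilinear2I) (auto simp: fun_eq_iff algebra_simps)
  show "S \<in> tpow A 2"
    unfolding S_def by (rule tlift2_tens(1)[OF T ml]) (auto intro: tpow_ptens2 mul_A_grd[OF _ c])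
  show "S [f, g] = T [f, \<lambda>y. g (mul A y c)]" if "lin f" "lin g"
    using tlift2_tens(2)[OF T ml, of "[f, g]" 1 f "\<lambda>y. g (mul A y c)" 0 f g] that
    by (simp add: S_def lin_rmul)
qed

lemma lmul2:
  fixes b
  assumes T: "T \<in> tpow A 2" and b: "b \<in> grd A l"
  defines "S \<equiv> tlift A 2 (\<lambda>xs. let (p, x) = xs ! 0; (q, y) = xs ! 1 in ptens A [mul A b x, y]) T"
  shows "S \<in> tpow A 2" "lin f \<Longrightarrow> lin g \<Longrightarrow> S [f, g] = T [\<lambda>y. f (mul A b y), g]"
proof -
  have ml: "gr_multilinear A 2 tsc (\<lambda>xs. let (p, x) = xs ! 0; (q, y) = xs ! 1 in ptens A [mul A b x, y])"
    by (rule gr_multilinear2I) (auto simp: fun_eq_iff algebra_simps)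
  show "S \<in> tpow A 2"
    unfolding S_def by (rule tlift2_tens(1)[OF T ml]) (auto intro: tpow_ptens2 mul_A_grd[OF b])
  show "S [f, g] = T [\<lambda>y. f (mul A b y), g]" if "lin f" "lin g"
    using tlift2_tens(2)[OF T ml, of "[f, g]" 1 "\<lambda>y. f (mul A b y)" g 0 f g] that
    by (simp add: S_def lin_lmul)
qed

text \<open>The contraction of the second factor with \<open>g\<close>, taken without a Koszul sign.
  It is the means of passing from a bracket back to a ternary operation.\<close>

definition ctr :: "('a \<Rightarrow> 'k) \<Rightarrow> ('k, 'a) tens \<Rightarrow> 'a" where
  "ctr g = tlift A 2 (\<lambda>xs. smul A (g (snd (xs ! 1))) (snd (xs ! 0)))"

lemma ctr_eq:
  assumes Q: "quads Q T" and g: "lin g"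
  shows "ctr g T = (\<Sum>(i, u, j, v)\<leftarrow>Q. smul A (g v) u)"
proof -
  let ?\<phi> = "\<lambda>xs :: (int \<times> 'a) list. smul A (g (snd (xs ! 1))) (snd (xs ! 0))"
  have "gr_multilinear A 2 (smul A) ?\<phi>"
    by (rule gr_multilinear2I)
      (auto simp: lin_add[OF g] lin_scale[OF g] A.vs.scale_right_distrib A.vs.scale_left_distrib mult.commute)
  from quads_tlift[OF Q this A.vector_space] show ?thesis by (simp add: ctr_def)
qed

lemma ctr_apply:
  assumes T: "T \<in> tpow A 2" and f: "lin f" and g: "lin g"
  shows "f (ctr g T) = T [f, g]"
proof -
  obtain Q where Q: "quads Q T" using quadsE[OF T] .
  show ?thesis
    by (simp add: ctr_eq[OF Q g] lin_sum_list[OF f] quads_apply[OF Q f g] lin_scale[OF f] split_def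
        comp_def mult.commute)
qed

lemma tens2_linear_right:
  assumes T: "T \<in> tpow A 2" and "lin f" "lin g" "lin h"
  shows "T [f, \<lambda>x. g x + h x] = T [f, g] + T [f, h]" "T [f, \<lambda>x. c * g x] = c * T [f, g]"
proof -
  obtain Q where Q: "quads Q T" using quadsE[OF T] .
  have "lin (\<lambda>x. g x + h x)" "lin (\<lambda>x. c * g x)" using assms by (auto simp: lin_iff algebra_simps)
  then show "T [f, \<lambda>x. g x + h x] = T [f, g] + T [f, h]" "T [f, \<lambda>x. c * g x] = c * T [f, g]"
    using assms
    by (simp_all add: quads_apply[OF Q] sum_list_const_mult[symmetric] sum_list_addf[symmetric] split_def
        algebra_simps)
qed

section \<open>Operations on tensors of order three\<close>

lemma triple_inner_multilinear: "gr_multilinear A 2 tsc (\<lambda>us. ptens A (map snd us @ [z]))"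
  by (rule gr_multilinear2I) auto

lemma triple_inner_tpow:
  assumes T: "T \<in> tpow A 2" and z: "z \<in> grd A j"
  shows "tlift A 2 (\<lambda>us. ptens A (map snd us @ [z])) T \<in> tpow A 3"
  by (rule tlift2_tens(1)[OF T triple_inner_multilinear]) (auto intro: tpow_ptens3 z)

text \<open>The formula covers every list of functionals, also those of wrong length or with
  nonlinear entries, so that linearity in \<open>T\<close> and in \<open>z\<close> can be read off
  pointwise.\<close>

lemma triple_inner:
  assumes T: "T \<in> tpow A 2"
  shows "tlift A 2 (\<lambda>us. ptens A (map snd us @ [z])) T =
    (\<lambda>fs. if length fs = 3 \<and> (\<forall>f\<in>set fs. lin f) then T [fs ! 0, fs ! 1] * (fs ! 2) z else 0)"
proof
  fix fs
  note ev = tlift2_tens(2)[OF T triple_inner_multilinear, of z fs]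
  show "tlift A 2 (\<lambda>us. ptens A (map snd us @ [z])) T fs =
      (if length fs = 3 \<and> (\<forall>f\<in>set fs. lin f) then T [fs ! 0, fs ! 1] * (fs ! 2) z else 0)"
  proof (cases "length fs = 3 \<and> (\<forall>f\<in>set fs. lin f)")
    case True
    then obtain f g h where fs: "fs = [f, g, h]" "lin f" "lin g" "lin h"
      by (auto simp: length_Suc_conv numeral_3_eq_3)
    then show ?thesis using ev[of "h z" f g 0 f g] by (simp add: mult.commute)
  next
    case False
    \<comment> \<open>All summands vanish on such a list, so the evaluation rule is applied with
      zero functionals as placeholders.\<close>
    have l: "lin (\<lambda>_. 0)" by (simp add: lin_iff)
    have "ptens A [u, v, z] fs = 0" for u v using False by (auto simp: ptens_def)
    then show ?thesis unfolding if_not_P[OF False] using ev[of 0 "\<lambda>_. 0" "\<lambda>_. 0" 0 "\<lambda>_. 0" "\<lambda>_. 0"] l by simp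
  qed
qed

lemma bilinear_tens:
  assumes "bilinear_into_tens2 A br"
  shows "br a b \<in> tpow A 2"
    "br (a + a') b = br a b + br a' b" "br (smul A c a) b = tsc c (br a b)"
    "br a (b + b') = br a b + br a b'" "br a (smul A c b) = tsc c (br a b)"
  using assms by (auto simp: bilinear_into_tens2_def Vector_Spaces.linear_iff)

text \<open>Pairing the last slot with \<open>h\<close> contracts the inner bracket to an element of
  A, to which the outer bracket is then applied. The two Koszul signs in the definition
  cancel.\<close>

lemma triple_L:
  fixes a b c :: 'a and i j l :: int
  assumes br: "bilinear_into_tens2 A br"
  defines "S \<equiv> triple_L d A br [(i, a), (j, b), (l, c)]"
  shows "S \<in> tpow A 3"
    "lin f \<Longrightarrow> lin g \<Longrightarrow> lin h \<Longrightarrow> S [f, g, h] = br a (ctr h (br b c)) [f, g]"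
proof -
  note br = bilinear_tens[OF br]
  obtain Q where Q: "quads Q (br b c)" using quadsE[OF br(1)] .
  let ?\<phi> = "\<lambda>ys :: (int \<times> 'a) list. let (p, y) = ys ! 0; (q, z) = ys ! 1 in
      tlift A 2 (\<lambda>us. ptens A (map snd us @ [z])) (br a y)"
  have "gr_multilinear A 2 tsc ?\<phi>"
    by (rule gr_multilinear2I)
      (auto simp: triple_inner br fun_eq_iff lin_add lin_scale algebra_simps)
  from quads_tlift[OF Q this vector_space_tens]
  have S: "S = (\<Sum>(p, y, q, z)\<leftarrow>Q. tlift A 2 (\<lambda>us. ptens A (map snd us @ [z])) (br a y))"
    by (simp add: S_def triple_L_def ksg_def)
  show "S \<in> tpow A 3" unfolding S
  proof (rule tpow_sum_list, clarify)
    fix p y q z assume "(p, y, q, z) \<in> set Q"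
    then show "tlift A 2 (\<lambda>us. ptens A (map snd us @ [z])) (br a y) \<in> tpow A 3"
      using quads_in[OF Q] triple_inner_tpow[OF br(1)] by blast
  qed
  assume lin: "lin f" "lin g" "lin h"
  have brs: "br a (\<Sum>x\<leftarrow>Q'. F x) [f, g] = (\<Sum>x\<leftarrow>Q'. br a (F x) [f, g])"
    for Q' :: "(int \<times> 'a \<times> int \<times> 'a) list" and F
  proof (induction Q')
    case Nil
    show ?case using br(5)[of a 0 0] by simp
  qed (simp add: br(4))
  have "S [f, g, h] = (\<Sum>(p, y, q, z)\<leftarrow>Q. br a y [f, g] * h z)"
    by (simp add: S sum_list_fun_apply triple_inner[OF br(1)] lin split_def)
  also have "\<dots> = br a (ctr h (br b c)) [f, g]"
    by (simp add: ctr_eq[OF Q lin(3)] split_def brs br(5) mult.commute)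
  finally show "S [f, g, h] = br a (ctr h (br b c)) [f, g]" .
qed

lemma inv_rot3: "inv rot3 = rot3 \<circ> rot3"
  by (rule inv_equality) (auto simp: rot3_def mod_Suc split: if_splits)

lemma inv_rot3_rot3: "inv (rot3 \<circ> rot3) = rot3"
  by (rule inv_equality) (auto simp: rot3_def mod_Suc split: if_splits)

lemma upt3: "[0..<3] = [0, 1, 2 :: nat]"
  by (simp add: upt_rec)

lemma perm_list_3:
  "perm_list id [x, y, z] = [x, y, z]"
  "perm_list rot3 [x, y, z] = [z, x, y]"
  "perm_list (rot3 \<circ> rot3) [x, y, z] = [y, z, x]"
  by (simp_all add: perm_list_def upt3 inv_rot3 inv_rot3_rot3 rot3_def)

lemma perm_exp_3:
  "perm_exp id [x, y, z] = 0"
  "perm_exp rot3 [x, y, z] = z * x + z * y"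
  "perm_exp (rot3 \<circ> rot3) [x, y, z] = y * x + z * x"
proof -
  have e: "perm_exp \<sigma> [x, y, z] =
      (\<Sum>(i, j) \<in> {(i, j) \<in> {(0, 1), (0, 2), (1, 2)}. inv \<sigma> i > inv \<sigma> j}.
        [x, y, z] ! inv \<sigma> i * [x, y, z] ! inv \<sigma> j)" for \<sigma>
    unfolding perm_exp_def by (rule sum.cong) (auto; presburger)+
  have s: "{(i, j) \<in> {(0, 1), (0, 2), (1, 2 :: nat)}. inv rot3 i > inv rot3 j} = {(0, 1), (0, 2)}"
      "{(i, j) \<in> {(0, 1), (0, 2), (1, 2 :: nat)}. inv (rot3 \<circ> rot3) i > inv (rot3 \<circ> rot3) j} = {(0, 2), (1, 2)}"
    by (auto simp: inv_rot3 inv_rot3_rot3 rot3_def)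
  show "perm_exp id [x, y, z] = 0" by (auto simp: e intro!: sum.neutral)
  show "perm_exp rot3 [x, y, z] = z * x + z * y" "perm_exp (rot3 \<circ> rot3) [x, y, z] = y * x + z * x"
    unfolding e s by (simp_all add: inv_rot3 inv_rot3_rot3 rot3_def)
qed

text \<open>A summand contributes only if the degrees of its factors are opposite to those of the
  functionals evaluated on them, so the sign of the permutation can be expressed by
  \<open>p\<close>, \<open>q\<close> and \<open>r\<close> and leaves the sum.\<close>

lemma tau3:
  assumes T: "T \<in> tpow A 3" and \<sigma>: "\<sigma> \<in> C3"
  shows "tau A 3 \<sigma> T \<in> tpow A 3"
    "f \<in> D p \<Longrightarrow> g \<in> D q \<Longrightarrow> h \<in> D r \<Longrightarrow>
     tau A 3 \<sigma> T [f, g, h] = (if \<sigma> = id then T [f, g, h]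
       else if \<sigma> = rot3 then sg (p * (q + r)) * T [g, h, f] else sg (r * (p + q)) * T [h, f, g])"
proof -
  obtain L where L: "trep A 3 T L" using T by (auto simp: tpow_def)
  let ?\<phi> = "\<lambda>xs. ksg (perm_exp \<sigma> (map fst xs)) (ptens A (map snd (perm_list \<sigma> xs)))"
  have c: "\<sigma> = id \<or> \<sigma> = rot3 \<or> \<sigma> = rot3 \<circ> rot3" using \<sigma> by (auto simp: C3_def)
  then have "gr_multilinear A 3 tsc ?\<phi>"
    by (elim disjE; hypsubst; intro gr_multilinear3I)
      (auto simp: perm_exp_3 perm_list_3 ksg_def fun_eq_iff algebra_simps)
  from tlift_eq[OF A.graded total_A vector_space_tens this L]
  have eq: "tau A 3 \<sigma> T = (\<Sum>xs\<leftarrow>L. ?\<phi> xs)" by (simp add: tau_def)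
  have L3: "\<exists>i u j v l w. xs = [(i, u), (j, v), (l, w)] \<and> u \<in> grd A i \<and> v \<in> grd A j \<and> w \<in> grd A l"
    if "xs \<in> set L" for xs
  proof -
    have "length xs = 3" "hlist A xs" using L that by (auto simp: trep_def)
    then show ?thesis by (auto simp: length_Suc_conv numeral_3_eq_3 hlist_def)
  qed
  show "tau A 3 \<sigma> T \<in> tpow A 3" unfolding eq
  proof (rule tpow_sum_list)
    fix xs assume "xs \<in> set L"
    then obtain i u j v l w where xs: "xs = [(i, u), (j, v), (l, w)]"
      and uvw: "u \<in> grd A i" "v \<in> grd A j" "w \<in> grd A l" using L3 by blast
    from c show "?\<phi> xs \<in> tpow A 3"
      unfolding xs using uvw by (auto simp: perm_list_3 intro!: tpow3_ksg tpow_ptens3)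
  qed
  assume f: "f \<in> D p" and g: "g \<in> D q" and h: "h \<in> D r"
  note lin = D_lin[OF f] D_lin[OF g] D_lin[OF h]
  have ev: "T [f', g', h'] = (\<Sum>xs\<leftarrow>L. f' (snd (xs ! 0)) * g' (snd (xs ! 1)) * h' (snd (xs ! 2)))"
    if "lin f'" "lin g'" "lin h'" for f' g' h'
  proof -
    have "T [f', g', h'] = (\<Sum>xs\<leftarrow>L. ptens A (map snd xs) [f', g', h'])"
      using L by (simp add: trep_def sum_list_fun_apply)
    also have "\<dots> = (\<Sum>xs\<leftarrow>L. f' (snd (xs ! 0)) * g' (snd (xs ! 1)) * h' (snd (xs ! 2)))"
      using that by (intro arg_cong[where f = sum_list] map_cong refl) (auto dest!: L3)
    finally show ?thesis .
  qed
  have r: "rot3 \<noteq> id" "rot3 \<circ> rot3 \<noteq> id" "rot3 \<circ> rot3 \<noteq> rot3"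
    by (auto simp: rot3_def fun_eq_iff intro!: exI[of _ 0])
  have "tau A 3 \<sigma> T [f, g, h] = (\<Sum>xs\<leftarrow>L. ?\<phi> xs [f, g, h])" by (simp add: eq sum_list_fun_apply)
  also from c have "\<dots> = (if \<sigma> = id then T [f, g, h]
       else if \<sigma> = rot3 then sg (p * (q + r)) * T [g, h, f] else sg (r * (p + q)) * T [h, f, g])"
  proof (elim disjE)
    assume \<sigma>: "\<sigma> = id"
    show ?thesis unfolding \<sigma> if_True simp_thms ev[OF lin]
      by (intro arg_cong[where f = sum_list] map_cong refl)
        (auto dest!: L3 simp: perm_exp_3 perm_list_3 lin)
  next
    assume \<sigma>: "\<sigma> = rot3"
    show ?thesis unfolding \<sigma> if_not_P[OF r(1)] if_P[OF refl] ev[OF lin(2,3,1)] sum_list_const_mult[symmetric]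
    proof (intro arg_cong[where f = sum_list] map_cong refl)
      fix xs assume "xs \<in> set L"
      then obtain i u j v l w where xs: "xs = [(i, u), (j, v), (l, w)]"
        and uvw: "u \<in> grd A i" "v \<in> grd A j" "w \<in> grd A l" using L3 by blast
      show "ksg (perm_exp rot3 (map fst xs)) (ptens A (map snd (perm_list rot3 xs))) [f, g, h] =
          sg (p * (q + r)) * (g (snd (xs ! 0)) * h (snd (xs ! 1)) * f (snd (xs ! 2)))"
      proof (cases "l + p = 0 \<and> i + q = 0 \<and> j + r = 0")
        case True
        then have "l = - p" "i = - q" "j = - r" by auto
        then show ?thesis
          by (simp add: xs perm_exp_3 perm_list_3 lin ksg_fun_apply ksg_field algebra_simps)
      next
        case False
        then show ?thesis
          using D_zero[OF f uvw(3)] D_zero[OF g uvw(1)] D_zero[OF h uvw(2)]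
          by (auto simp: xs perm_exp_3 perm_list_3 lin ksg_fun_apply ksg_field)
      qed
    qed
  next
    assume \<sigma>: "\<sigma> = rot3 \<circ> rot3"
    show ?thesis unfolding \<sigma> if_not_P[OF r(2)] if_not_P[OF r(3)] ev[OF lin(3,1,2)] sum_list_const_mult[symmetric]
    proof (intro arg_cong[where f = sum_list] map_cong refl)
      fix xs assume "xs \<in> set L"
      then obtain i u j v l w where xs: "xs = [(i, u), (j, v), (l, w)]"
        and uvw: "u \<in> grd A i" "v \<in> grd A j" "w \<in> grd A l" using L3 by blast
      show "ksg (perm_exp (rot3 \<circ> rot3) (map fst xs)) (ptens A (map snd (perm_list (rot3 \<circ> rot3) xs))) [f, g, h] =
          sg (r * (p + q)) * (h (snd (xs ! 0)) * f (snd (xs ! 1)) * g (snd (xs ! 2)))"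
      proof (cases "j + p = 0 \<and> l + q = 0 \<and> i + r = 0")
        case True
        then have "j = - p" "l = - q" "i = - r" by auto
        then show ?thesis
          by (simp add: xs perm_exp_3 perm_list_3 lin ksg_fun_apply ksg_field algebra_simps)
      next
        case False
        then show ?thesis
          using D_zero[OF f uvw(2)] D_zero[OF g uvw(3)] D_zero[OF h uvw(1)]
          by (auto simp: xs perm_exp_3 perm_list_3 lin ksg_fun_apply ksg_field)
      qed
    qed
  qed
  finally show "tau A 3 \<sigma> T [f, g, h] = (if \<sigma> = id then T [f, g, h]
       else if \<sigma> = rot3 then sg (p * (q + r)) * T [g, h, f] else sg (r * (p + q)) * T [h, f, g])" .
qed

end

section \<open>The square-zero extension\<close>

lemma sum_shift:
  fixes c :: "int \<Rightarrow> 'v::comm_monoid_add"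
  shows "(\<Sum>i | c (i + k) \<noteq> 0. c (i + k)) = (\<Sum>i | c i \<noteq> 0. c i)"
  by (rule sum.reindex_bij_witness[of _ "\<lambda>i. i - k" "\<lambda>i. i + k"]) auto

lemma finite_shift: "finite {i. P (i + k)} \<longleftrightarrow> finite {i :: int. P i}"
proof -
  have "{i. P i} = (\<lambda>i. i + k) ` {i. P (i + k)}"
    by (auto simp: image_iff intro!: exI[of _ "_ - k"])
  moreover have "{i. P (i + k)} = (\<lambda>i. i - k) ` {i. P i}"
    by (auto simp: image_iff intro!: exI[of _ "_ + k"])
  ultimately show ?thesis by (metis finite_imageI)
qed

lemma gdecomp_shift: "gdecomp (\<lambda>n. H (n + k)) x (\<lambda>n. c (n + k)) \<longleftrightarrow> gdecomp H x c"
proof -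
  have "(\<forall>i. c (i + k) \<in> H (i + k)) \<longleftrightarrow> (\<forall>i. c i \<in> H i)" by (metis diff_add_cancel)
  then show ?thesis unfolding gdecomp_def sum_shift finite_shift[of "\<lambda>i. c i \<noteq> 0"] by simp
qed

lemma gdecomp_shift': "gdecomp (\<lambda>n. H (n + k)) x e \<longleftrightarrow> gdecomp H x (\<lambda>n. e (n - k))"
  using gdecomp_shift[of H k x "\<lambda>n. e (n - k)"] by simp

lemma total_shift: "total (\<lambda>n. H (n + k)) = total H"
  unfolding total_def gdecomp_shift' using gdecomp_shift[of H k] gdecomp_shift'[of H k] by blast

lemma graded_shift:
  assumes "graded_space V" shows "graded_space (shift k V)"
proof -
  interpret graded_vs V by (simp add: graded_vs_def assms)
  have "\<exists>!c. gdecomp (\<lambda>n. grd V (n + k)) x c" if "x \<in> total (grd V)" for x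
  proof (rule ex1I)
    show "gdecomp (\<lambda>n. grd V (n + k)) x (\<lambda>n. hcomp (grd V) x (n + k))"
      unfolding gdecomp_shift by (rule hcomp_decomp[OF that])
    fix e assume "gdecomp (\<lambda>n. grd V (n + k)) x e"
    then have "hcomp (grd V) x = (\<lambda>n. e (n - k))"
      unfolding gdecomp_shift' by (rule hcomp_eqI[OF assms])
    then show "e = (\<lambda>n. hcomp (grd V) x (n + k))" by simp
  qed
  then show ?thesis
    using assms by (simp add: graded_space_def shift_def total_shift)
qed

lemma hcomp_shift:
  assumes "graded_space V" "x \<in> total (grd V)"
  shows "hcomp (grd (shift k V)) x n = hcomp (grd V) x (n + k)"
  by (rule fun_cong[OF hcomp_eqI[OF graded_shift[OF assms(1)]]])
    (simp add: shift_def gdecomp_shift gdecomp_hcomp[OF assms])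

context dga
begin

lemma lin_hom_ext:
  assumes "lin f" "lin g" "\<And>i x. x \<in> grd A i \<Longrightarrow> f x = g x"
  shows "f = g"
proof
  fix x
  have "x \<in> total (grd A)" by simp
  then show "f x = g x"
    by (induction rule: A.total_induct) (auto simp: assms lin_add)
qed

abbreviation B :: "('k, 'a \<times> ('a \<Rightarrow> 'k)) dgalg" where "B \<equiv> del_alg d A"
abbreviation TB :: "('a \<times> ('a \<Rightarrow> 'k)) set" where "TB \<equiv> total (grd (del_alg d A))"
abbreviation G :: "int \<Rightarrow> ('a \<times> ('a \<Rightarrow> 'k)) set" where "G n \<equiv> grd (del_alg d A) n"
abbreviation \<gamma> :: "'a \<times> ('a \<Rightarrow> 'k) \<Rightarrow> 'a \<times> ('a \<Rightarrow> 'k) \<Rightarrow> 'k" where "\<gamma> \<equiv> nat_form d A"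
abbreviation m1 where "m1 \<equiv> dif (del_alg d A)"
abbreviation m2 where "m2 \<equiv> mul (del_alg d A)"
abbreviation la where "la \<equiv> lact_shift (d - 1) A"
abbreviation ra where "ra \<equiv> ract A"

text \<open>The sign of the natural form as an operator on A: if f(a) is nonzero, then tf has degree
  1 - d - |a|, and the product of |a| with this number has the parity of d|a|.\<close>

definition \<theta> :: "'a \<Rightarrow> 'a" where
  "\<theta> = hext (grd A) (\<lambda>i a. ksg (d * i) a)"

lemma \<theta>_hom: "a \<in> grd A i \<Longrightarrow> \<theta> a = ksg (d * i) a"
  unfolding \<theta>_def by (rule A.hext_hom) auto

lemma \<theta>_add: "\<theta> (x + y) = \<theta> x + \<theta> y"
  unfolding \<theta>_def by (rule A.hext_add) (auto simp: ksg_add)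

lemma \<theta>_scale: "\<theta> (smul A c x) = smul A c (\<theta> x)"
  unfolding \<theta>_def by (rule A.hext_scale[OF A.vector_space]) (auto simp: ksg_def)

lemma \<theta>_0 [simp]: "\<theta> 0 = 0"
  using \<theta>_scale[of 0 0] by simp

lemma A_hom_induct [case_names hom add]:
  assumes "\<And>i x. x \<in> grd A i \<Longrightarrow> P x" "\<And>x y. P x \<Longrightarrow> P y \<Longrightarrow> P (x + y)"
  shows "P x"
proof -
  have "x \<in> total (grd A)" by simp
  then show ?thesis by (induction rule: A.total_induct) (auto intro: assms)
qed

lemma mul_A_ksg: "mul A (ksg e x) y = ksg e (mul A x y)" "mul A x (ksg e y) = ksg e (mul A x y)"
  by (simp_all add: ksg_scale[OF A.vector_space])

lemma dif_A_ksg: "dif A (ksg e x) = ksg e (dif A x)"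
  by (simp add: ksg_scale[OF A.vector_space])

text \<open>The exponent is additive in the degree, so twisting by the sign respects
  products.\<close>

lemma \<theta>_mul: "\<theta> (mul A x y) = mul A (\<theta> x) (\<theta> y)"
proof (induction x rule: A_hom_induct)
  case (hom i x)
  show ?case
  proof (induction y rule: A_hom_induct)
    case (hom j y)
    then show ?case using \<open>x \<in> grd A i\<close>
      by (simp add: \<theta>_hom[OF mul_A_grd] \<theta>_hom mul_A_ksg algebra_simps)
  qed (simp add: \<theta>_add)
qed (simp add: \<theta>_add)

lemma hcomp_dual_0: "f \<in> TD \<Longrightarrow> hcomp (grd (dual A)) f n 0 = 0"
  using lin_0[OF D_lin[OF D.hcomp_in]] .

text \<open>Where f(ca) is nonzero, the degrees of f and c add up to -i. The Koszul sign is then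
  that of i squared, hence of i, and depends neither on f nor on c.\<close>

lemma lact_eq:
  assumes f: "f \<in> TD" and a: "a \<in> grd A i"
  shows "lact A a f = (\<lambda>c. ksg i (f (mul A c a)))"
proof
  fix c
  have "hext (grd A) (\<lambda>l c'. ksg (i * (n + l)) (f' (mul A c' a))) c = ksg i (f' (mul A c a))"
    if f': "f' \<in> D n" for f' n
  proof (induction c rule: A_hom_induct)
    case (hom l c)
    then have "hext (grd A) (\<lambda>l c'. ksg (i * (n + l)) (f' (mul A c' a))) c = ksg (i * (n + l)) (f' (mul A c a))"
      by (rule A.hext_hom) (simp add: lin_0[OF D_lin[OF f']])
    also have "\<dots> = ksg i (f' (mul A c a))"
    proof (cases "l + i + n = 0")
      case True
      then have "n + l = - i" by simp
      then show ?thesis by (simp add: ksg_field sg_def)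
    next
      case False
      then show ?thesis using D_zero[OF f' mul_A_grd[OF hom a]] by simp
    qed
    finally show ?case .
  next
    case (add c e)
    then show ?case
      by (subst A.hext_add) (auto simp: ksg_add lin_add[OF D_lin[OF f']])
  qed
  note inner = this
  have z: "hcomp (grd (dual A)) f n 0 = 0" for n
    by (rule hcomp_dual_0[OF f])
  have "lact A a f c = hext (grd (dual A)) (\<lambda>n f'. hext (grd A) (\<lambda>l c'.
      ksg (i * (n + l)) (f' (mul A c' a))) c) f"
    unfolding lact_def by (rule A.hext_hom[OF a]) (simp add: hext_def z)
  also have "\<dots> = hext (grd (dual A)) (\<lambda>n f'. ksg i (f' (mul A c a))) f"
    unfolding hext_def[of "grd (dual A)"] by (intro sum.cong refl inner D.hcomp_in[OF f])
  also have "\<dots> = (\<Sum>n | hcomp (grd (dual A)) f n \<noteq> 0. ksg i (hcomp (grd (dual A)) f n (mul A c a)))"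
    by (simp add: hext_def)
  also have "\<dots> = ksg i (f (mul A c a))"
    using D.hcomp_sum[OF f] by (simp add: ksg_field sum_distrib_left[symmetric] sum_fun_apply[symmetric])
  finally show "lact A a f c = ksg i (f (mul A c a))" .
qed

text \<open>The sign of i from the unshifted action and that of (d - 1)i from the shift combine to
  the sign of di, which is the one in \<open>\<theta>\<close>.\<close>

lemma la_eq: "f \<in> TD \<Longrightarrow> la a f = (\<lambda>c. f (mul A c (\<theta> a)))"
proof -
  assume f: "f \<in> TD"
  have lin: "lin f" using TD_lin[OF f] .
  have "la a f = hext (grd A) (\<lambda>i a' c. ksg (d * i) (f (mul A c a'))) a"
    unfolding lact_shift_def hext_def
    by (intro sum.cong refl, subst lact_eq[OF f A.hcomp_in])
      (auto simp: fun_eq_iff ksg_fun_apply ksg_field sg_def)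
  also have "\<dots> = (\<lambda>c. f (mul A c (\<theta> a)))"
  proof (induction a rule: A_hom_induct)
    case (hom i a)
    then show ?case
      by (subst A.hext_hom[OF hom]) (auto simp: lin_0[OF lin] \<theta>_hom mul_A_ksg lin_ksg[OF lin] ksg_field fun_eq_iff)
  next
    case (add x y)
    then show ?case
      by (subst A.hext_add) (auto simp: ksg_add lin_add[OF lin] \<theta>_add fun_eq_iff)
  qed
  finally show ?thesis .
qed

lemma ra_eq: "ra f b = (\<lambda>c. f (mul A b c))"
  by (simp add: ract_def)

interpretation DS: graded_vs "shift (d - 1) (dual A)"
  using graded_shift[OF graded_dual] by (simp add: graded_vs_def)

lemma grd_DS: "grd (shift (d - 1) (dual A)) n = D (n + (d - 1))"
  by (simp add: shift_def)

lemma nat_form_eq: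
  assumes f': "f' \<in> TD"
  shows "\<gamma> (a, f) (a', f') = f a' + f' (\<theta> a)"
proof -
  let ?S = "shift (d - 1) (dual A)"
  have tot: "f' \<in> total (grd ?S)" using f' by (simp add: shift_def total_shift)
  have lin: "lin f'" using TD_lin[OF f'] .
  have "hext (grd A) (\<lambda>i b. hext (grd ?S) (\<lambda>n g. ksg (i * n) (g b)) f') a = f' (\<theta> a)"
  proof (induction a rule: A_hom_induct)
    case (hom i a)
    have "hext (grd A) (\<lambda>i b. hext (grd ?S) (\<lambda>n g. ksg (i * n) (g b)) f') a =
        hext (grd ?S) (\<lambda>n g. ksg (i * n) (g a)) f'"
      by (rule A.hext_hom[OF hom]) (simp add: hext_def hcomp_shift[OF D.graded f'] hcomp_dual_0[OF f'])
    also have "\<dots> = (\<Sum>n | hcomp (grd ?S) f' n \<noteq> 0. ksg (i * n) (hcomp (grd ?S) f' n a))"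
      by (simp add: hext_def)
    \<comment> \<open>Only the component with n = 1 - d - i can be nonzero at \<open>a\<close>, and
      for this n the exponents i * n and d * i have the same parity.\<close>
    also have "\<dots> = (\<Sum>n | hcomp (grd ?S) f' n \<noteq> 0. sg (d * i) * hcomp (grd ?S) f' n a)"
    proof (intro sum.cong refl)
      fix n
      have h: "hcomp (grd ?S) f' n \<in> D (n + (d - 1))" using DS.hcomp_in[OF tot] grd_DS by blast
      show "ksg (i * n) (hcomp (grd ?S) f' n a) = sg (d * i) * hcomp (grd ?S) f' n a"
      proof (cases "i + (n + (d - 1)) = 0")
        case True
        then have "n = 1 - d - i" by simp
        then show ?thesis by (auto simp: ksg_field sg_def)
      qed (simp add: D_zero[OF h hom])
    qed
    also have "\<dots> = sg (d * i) * f' a"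
      using DS.hcomp_sum[OF tot] by (simp add: sum_distrib_left[symmetric] sum_fun_apply[symmetric])
    finally show ?case by (simp add: \<theta>_hom[OF hom] lin_ksg[OF lin])
  next
    case (add x y)
    have z: "hcomp (grd ?S) f' n (u + v) = hcomp (grd ?S) f' n u + hcomp (grd ?S) f' n v" for n u v
      using DS.hcomp_in[OF tot, of n] lin_add[OF D_lin] unfolding grd_DS by blast
    have "hext (grd ?S) (\<lambda>n g. ksg (i * n) (g (u + v))) f' =
        hext (grd ?S) (\<lambda>n g. ksg (i * n) (g u)) f' + hext (grd ?S) (\<lambda>n g. ksg (i * n) (g v)) f'" for i u v
      by (simp add: hext_def z ksg_add sum.distrib)
    then show ?case
      by (subst A.hext_add) (simp_all add: add \<theta>_add lin_add[OF lin])
  qed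
  then show ?thesis by (simp add: nat_form_def)
qed

lemma dif_dual_hom: "f \<in> D p \<Longrightarrow> dif (dual A) f = (\<lambda>x. - sg p * f (dif A x))"
proof -
  assume f: "f \<in> D p"
  have "dif (dual A) f = hext (grd (dual A)) (\<lambda>n f. - ksg n (f \<circ> dif A)) f"
    by (simp add: dual_def Let_def)
  also have "\<dots> = - ksg p (f \<circ> dif A)"
    by (rule D.hext_hom[OF f]) (auto simp: fun_eq_iff ksg_def)
  finally show ?thesis by (auto simp: fun_eq_iff ksg_fun_apply ksg_field)
qed

lemma dif_dual_add: "f \<in> TD \<Longrightarrow> g \<in> TD \<Longrightarrow> dif (dual A) (f + g) = dif (dual A) f + dif (dual A) g"
proof -
  assume "f \<in> TD" "g \<in> TD"
  moreover have "dif (dual A) = hext (grd (dual A)) (\<lambda>n f. - ksg n (f \<circ> dif A))"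
    by (simp add: dual_def Let_def)
  ultimately show ?thesis
    by simp (intro D.hext_add, auto simp: ksg_def fun_eq_iff)
qed

lemma dif_dual_scale: "f \<in> TD \<Longrightarrow> dif (dual A) (\<lambda>x. c * f x) = (\<lambda>x. c * dif (dual A) f x)"
proof -
  assume "f \<in> TD"
  moreover have "dif (dual A) = hext (grd (dual A)) (\<lambda>n f. - ksg n (f \<circ> dif A))"
    by (simp add: dual_def Let_def)
  ultimately show ?thesis
    using D.hext_scale[OF vector_space_fun, of "\<lambda>n f. - ksg n (f \<circ> dif A)" c f]
    by (auto simp: ksg_def fun_eq_iff)
qed

lemma dif_dual_D: "f \<in> D p \<Longrightarrow> dif (dual A) f \<in> D (p + 1)"
  using D.grd_scale[OF D_dif, of f p "- sg p"] by (simp add: dif_dual_hom)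

lemma dif_dual_TD: "f \<in> TD \<Longrightarrow> dif (dual A) f \<in> TD"
proof (induction rule: D.total_induct)
  case (hom i f)
  then show ?case using D.total_grd dif_dual_D by blast
next
  case (add f g)
  then show ?case unfolding dif_dual_add[OF add(1,2)] by (intro D.total_add)
qed

lemma smul_B: "smul B c (a, f) = (smul A c a, \<lambda>x. c * f x)"
  by (simp add: del_alg_def shift_def)

lemma grd_B: "G n = grd A n \<times> D (n + d - 1)"
  by (simp add: del_alg_def shift_def add_diff_eq)

lemma m1_B: "m1 (a, f) = (dif A a, ksg (d - 1) (dif (dual A) f))"
  by (simp add: del_alg_def shift_def)

lemma m2_B: "m2 (a, f) (b, g) = (mul A a b, ra f b + la a g)"
  by (simp add: del_alg_def)

lemma G_hcomp: "gdecomp (grd B) (a, f) (\<lambda>n. (pr n a, hcomp (grd (dual A)) f (n + (d - 1))))" if f: "f \<in> TD"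
proof -
  let ?c = "\<lambda>n. (pr n a, hcomp (grd (dual A)) f (n + (d - 1)))"
  have a: "gdecomp (grd A) a (hcomp (grd A) a)" by (rule A.hcomp_decomp) simp
  have f: "gdecomp (\<lambda>n. D (n + (d - 1))) f (\<lambda>n. hcomp (grd (dual A)) f (n + (d - 1)))"
    unfolding gdecomp_shift by (rule D.hcomp_decomp[OF f])
  have "{n. ?c n \<noteq> 0} = {n. pr n a \<noteq> 0} \<union> {n. hcomp (grd (dual A)) f (n + (d - 1)) \<noteq> 0}"
    by (auto simp: zero_prod_def)
  then have fin: "finite {n. ?c n \<noteq> 0}" using a f by (simp add: gdecomp_def)
  have "a = (\<Sum>n | ?c n \<noteq> 0. pr n a)"
    by (rule gdecomp_sum_superset[OF a fin]) (simp add: zero_prod_def)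
  moreover have "f = (\<Sum>n | ?c n \<noteq> 0. hcomp (grd (dual A)) f (n + (d - 1)))"
    by (rule gdecomp_sum_superset[OF f fin]) (simp add: zero_prod_def)
  moreover have "(\<Sum>n | ?c n \<noteq> 0. ?c n) =
      ((\<Sum>n | ?c n \<noteq> 0. pr n a), (\<Sum>n | ?c n \<noteq> 0. hcomp (grd (dual A)) f (n + (d - 1))))"
    by (rule sum_prod)
  ultimately have "(a, f) = (\<Sum>n | ?c n \<noteq> 0. ?c n)" by simp
  with fin a f show ?thesis by (simp add: gdecomp_def grd_B add_diff_eq)
qed

text \<open>Serves the uniqueness of decompositions in the direct sum: a decomposition of a pair
  projects to decompositions of its two entries, which are unique.\<close>

lemma gdecomp_fst: "gdecomp (grd B) x c \<Longrightarrow> gdecomp (grd A) (fst x) (\<lambda>n. fst (c n))"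
  and gdecomp_snd: "gdecomp (grd B) x c \<Longrightarrow> gdecomp (grd (dual A)) (snd x) (\<lambda>n. snd (c (n - (d - 1))))"
proof -
  assume c: "gdecomp (grd B) x c"
  then have fin: "finite {n. c n \<noteq> 0}" and x: "x = (\<Sum>n | c n \<noteq> 0. c n)" by (simp_all add: gdecomp_def)
  have "fst x = (\<Sum>n | c n \<noteq> 0. fst (c n))" "snd x = (\<Sum>n | c n \<noteq> 0. snd (c n))"
    unfolding x by (induction rule: finite_induct[OF fin]) simp_all
  moreover have "(\<Sum>n | c n \<noteq> 0. fst (c n)) = (\<Sum>n | fst (c n) \<noteq> 0. fst (c n))"
    "(\<Sum>n | c n \<noteq> 0. snd (c n)) = (\<Sum>n | snd (c n) \<noteq> 0. snd (c n))"
    using fin by (auto intro!: sum.mono_neutral_right)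
  moreover have "finite {n. fst (c n) \<noteq> 0}" "finite {n. snd (c n) \<noteq> 0}"
    by (auto intro: finite_subset[OF _ fin])
  ultimately have "gdecomp (grd A) (fst x) (\<lambda>n. fst (c n))"
    and "gdecomp (\<lambda>n. D (n + (d - 1))) (snd x) (\<lambda>n. snd (c n))"
    using c by (auto simp: gdecomp_def grd_B add_diff_eq mem_Times_iff)
  then show "gdecomp (grd A) (fst x) (\<lambda>n. fst (c n))"
    and "gdecomp (grd (dual A)) (snd x) (\<lambda>n. snd (c (n - (d - 1))))"
    unfolding gdecomp_shift' by simp_all
qed

lemma total_B: "TB = UNIV \<times> TD"
proof
  show "TB \<subseteq> UNIV \<times> TD"
    using gdecomp_snd by (fastforce simp: total_def)
  show "UNIV \<times> TD \<subseteq> TB"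
    using G_hcomp by (fastforce simp: total_def)
qed

lemma vector_space_B: "vector_space (smul B)"
  by unfold_locales (auto simp: smul_B algebra_simps A.vs.scale_right_distrib A.vs.scale_left_distrib
      plus_prod_def fun_eq_iff)

lemma graded_B: "graded_space B"
  unfolding graded_space_def
proof (intro conjI allI ballI vector_space_B)
  interpret Bv: Vector_Spaces.vector_space "smul B" by (rule vector_space_B)
  show "Bv.subspace (G n)" for n
    using A.grd_scale D.grd_scale[unfolded smul_dual]
    by (auto simp: Bv.subspace_def grd_B smul_B zero_prod_def A.grd_add D.grd_add)
  fix x assume "x \<in> TB"
  then obtain a f where x: "x = (a, f)" "f \<in> TD" by (auto simp: total_B)
  show "\<exists>!c. gdecomp (grd B) x c"
  proof (rule ex1I)
    show "gdecomp (grd B) x (\<lambda>n. (pr n a, hcomp (grd (dual A)) f (n + (d - 1))))"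
      unfolding x(1) by (rule G_hcomp[OF x(2)])
    fix c assume c: "gdecomp (grd B) x c"
    have "hcomp (grd A) a = (\<lambda>n. fst (c n))"
      using hcomp_eqI[OF A.graded gdecomp_fst[OF c]] x by simp
    moreover have "hcomp (grd (dual A)) f = (\<lambda>n. snd (c (n - (d - 1))))"
      using hcomp_eqI[OF D.graded gdecomp_snd[OF c]] x by simp
    ultimately show "c = (\<lambda>n. (pr n a, hcomp (grd (dual A)) f (n + (d - 1))))" by simp
  qed
qed

sublocale B: graded_vs "del_alg d A"
  using graded_B by (simp add: graded_vs_def)

end

context dga
begin

section \<open>The natural form\<close>

lemma \<gamma>_simps [simp]:
  "\<gamma> (a, f) (b, 0) = f b"
  "g \<in> TD \<Longrightarrow> \<gamma> (a, 0) (b, g) = g (\<theta> a)"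
  by (simp_all add: nat_form_eq)

lemma \<gamma>_add_left: "x \<in> TB \<Longrightarrow> x' \<in> TB \<Longrightarrow> y \<in> TB \<Longrightarrow> \<gamma> (x + x') y = \<gamma> x y + \<gamma> x' y"
  and \<gamma>_add_right: "x \<in> TB \<Longrightarrow> x' \<in> TB \<Longrightarrow> y \<in> TB \<Longrightarrow> \<gamma> y (x + x') = \<gamma> y x + \<gamma> y x'"
  and \<gamma>_scale_left: "x \<in> TB \<Longrightarrow> y \<in> TB \<Longrightarrow> \<gamma> (smul B c x) y = c * \<gamma> x y"
  and \<gamma>_scale_right: "x \<in> TB \<Longrightarrow> y \<in> TB \<Longrightarrow> \<gamma> y (smul B c x) = c * \<gamma> y x"
  using D.total_scale[unfolded smul_dual]
  by (auto simp: total_B nat_form_eq plus_prod_def D.total_add lin_add TD_lin \<theta>_add smul_B lin_scale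
      \<theta>_scale algebra_simps)

lemma \<gamma>_degree:
  assumes "x \<in> G i" "y \<in> G j" "i + j + (d - 1) \<noteq> 0" shows "\<gamma> x y = 0"
proof -
  obtain a f b g where xy: "x = (a, f)" "y = (b, g)" "a \<in> grd A i" "b \<in> grd A j"
    "f \<in> D (i + d - 1)" "g \<in> D (j + d - 1)"
    using assms by (auto simp: grd_B)
  have "f b = 0" using D_zero[OF xy(5,4)] assms by auto
  moreover have "g a = 0" using D_zero[OF xy(6,3)] assms by auto
  ultimately show ?thesis
    using D.total_grd[OF xy(6)] by (simp add: xy nat_form_eq \<theta>_hom[OF xy(3)] lin_ksg[OF D_lin[OF xy(6)]])
qed

lemma \<gamma>_sym:
  assumes "x \<in> G i" "y \<in> G j" shows "\<gamma> x y = sg (i * j) * \<gamma> y x"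
proof (cases "i + j + (d - 1) = 0")
  case True
  then have j: "j = 1 - d - i" by simp
  obtain a f b g where xy: "x = (a, f)" "y = (b, g)" "a \<in> grd A i" "b \<in> grd A j"
    "f \<in> D (i + d - 1)" "g \<in> D (j + d - 1)"
    using assms by (auto simp: grd_B)
  have s: "sg (i * j) = (sg (d * i) :: 'k)" "sg (i * j) * sg (d * j) = (1 :: 'k)"
    unfolding j by (auto simp: sg_def)
  show ?thesis
    using D.total_grd[OF xy(6)] D.total_grd[OF xy(5)] s
    by (simp add: xy nat_form_eq \<theta>_hom[OF xy(3)] \<theta>_hom[OF xy(4)] lin_ksg[OF D_lin[OF xy(6)]]
        lin_ksg[OF D_lin[OF xy(5)]] algebra_simps)
next
  case False
  then show ?thesis using \<gamma>_degree assms by (simp add: add.commute)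
qed

lemma bilinear_form_\<gamma>: "bilinear_form B (d - 1) \<gamma>"
  unfolding bilinear_form_def
  by (auto simp: \<gamma>_add_left \<gamma>_add_right \<gamma>_scale_left \<gamma>_scale_right \<gamma>_degree)

lemma \<theta>_\<theta>: "\<theta> (\<theta> a) = a"
  by (induction a rule: A_hom_induct, simp_all add: \<theta>_add \<theta>_hom \<theta>_hom[OF A.grd_ksg])
    (simp add: ksg_def)

text \<open>Pairing with A reads off the functional component. Pairing with functionals reads off
  the component in A up to \<open>\<theta>\<close>, which is an involution.\<close>

lemma \<gamma>_separates:
  assumes x: "x \<in> TB" and "\<And>a i. a \<in> grd A i \<Longrightarrow> \<gamma> x (a, 0) = 0"
    "\<And>f p. f \<in> D p \<Longrightarrow> \<gamma> x (0, f) = 0"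
  shows "x = 0"
proof -
  obtain a f where af: "x = (a, f)" "f \<in> TD" using x by (auto simp: total_B)
  have "f = (\<lambda>_. 0)"
    using assms(2) by (intro lin_hom_ext TD_lin[OF af(2)]) (auto simp: af lin_iff)
  then have f0: "f = 0" by (simp add: fun_eq_iff)
  have "\<theta> a = 0"
    using assms(3) D.total_grd by (intro D_separates) (auto simp: af f0)
  then have "a = 0" by (metis \<theta>_\<theta> \<theta>_0)
  with f0 af show ?thesis by (simp add: zero_prod_def)
qed

lemma nondegenerate_\<gamma>: "nondegenerate B \<gamma>"
proof -
  have *: "x = 0" if x: "x \<in> TB" "\<And>y. y \<in> TB \<Longrightarrow> \<gamma> x y = 0" for x
    by (rule \<gamma>_separates[OF x(1)]) (use x(2) D.total_grd in \<open>auto simp: total_B\<close>)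
  have "y = 0" if y: "y \<in> TB" "\<And>x. x \<in> TB \<Longrightarrow> \<gamma> x y = 0" for y
  proof -
    obtain b g where bg: "y = (b, g)" "g \<in> TD" using y by (auto simp: total_B)
    have "g a = 0" for a
      using y(2)[of "(\<theta> a, 0)"] bg by (simp add: total_B \<theta>_\<theta>)
    then have g0: "g = 0" by (simp add: fun_eq_iff)
    have "b = 0"
      using y(2)[of "(0, f)" for f] D.total_grd by (intro D_separates) (auto simp: bg g0 total_B)
    with g0 bg show ?thesis by (simp add: zero_prod_def)
  qed
  with * show ?thesis by (simp add: nondegenerate_def)
qed

section \<open>The dg algebra structure and its cyclicity\<close>

lemma ra_D: "f \<in> D p \<Longrightarrow> b \<in> grd A j \<Longrightarrow> ra f b \<in> D (p + j)"
  by (simp add: ra_eq D_lmul)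

lemma \<theta>_grd: "a \<in> grd A i \<Longrightarrow> \<theta> a \<in> grd A i"
  by (simp add: \<theta>_hom A.grd_ksg)

lemma la_D: "f \<in> D p \<Longrightarrow> a \<in> grd A i \<Longrightarrow> la a f \<in> D (p + i)"
  using D_rmul[OF _ \<theta>_grd] by (simp add: la_eq D.total_grd)

lemma ra_add: "ra (f + g) b = ra f b + ra g b" "lin f \<Longrightarrow> ra f (b + c) = ra f b + ra f c"
  by (simp_all add: ra_eq fun_eq_iff lin_add)

lemma la_add: "f \<in> TD \<Longrightarrow> g \<in> TD \<Longrightarrow> la a (f + g) = la a f + la a g"
  "f \<in> TD \<Longrightarrow> la (a + b) f = la a f + la b f"
  by (simp_all add: la_eq D.total_add fun_eq_iff lin_add[OF TD_lin] \<theta>_add)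

lemma ra_scale: "ra (\<lambda>x. c * f x) b = (\<lambda>x. c * ra f b x)" "lin f \<Longrightarrow> ra f (smul A c b) = (\<lambda>x. c * ra f b x)"
  by (simp_all add: ra_eq fun_eq_iff lin_scale)

lemma la_scale: "f \<in> TD \<Longrightarrow> la a (\<lambda>x. c * f x) = (\<lambda>x. c * la a f x)"
  "f \<in> TD \<Longrightarrow> la (smul A c a) f = (\<lambda>x. c * la a f x)"
  using D.total_scale[of f c]
  by (simp_all add: la_eq fun_eq_iff lin_scale[OF TD_lin] \<theta>_scale)

lemma ra_TD: "f \<in> TD \<Longrightarrow> ra f b \<in> TD"
proof (induction b rule: A_hom_induct)
  case (hom j b)
  from hom(2) show ?case
  proof (induction rule: D.total_induct)
    case (hom p f)
    then show ?case using ra_D[OF hom \<open>b \<in> grd A j\<close>] D.total_grd by blast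
  next
    case (add f g)
    then show ?case unfolding ra_add by (intro D.total_add)
  qed
next
  case (add b c)
  then show ?case unfolding ra_add(2)[OF TD_lin[OF add(3)]] by (intro D.total_add) auto
qed

lemma la_TD: "f \<in> TD \<Longrightarrow> la a f \<in> TD"
proof (induction a rule: A_hom_induct)
  case (hom j b)
  from hom(2) show ?case
  proof (induction rule: D.total_induct)
    case (hom p f)
    then show ?case using la_D[OF hom \<open>b \<in> grd A j\<close>] D.total_grd by blast
  next
    case (add f g)
    then show ?case unfolding la_add(1)[OF add(1,2)] by (intro D.total_add)
  qed
next
  case (add b c)
  then show ?case unfolding la_add(2)[OF add(3)] by (intro D.total_add) auto
qed

lemma la_0 [simp]: "la a 0 = 0" "f \<in> TD \<Longrightarrow> la 0 f = 0"
  and ra_0 [simp]: "ra 0 b = 0" "lin f \<Longrightarrow> ra f 0 = 0"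
  by (simp_all add: la_eq ra_eq fun_eq_iff lin_0 TD_lin)

lemma dif_dual_0 [simp]: "dif (dual A) 0 = 0"
  using dif_dual_hom[OF D.grd_0] by (simp add: fun_eq_iff)

text \<open>The sign of d - 1 caused by the shift cancels the summand d - 1 in the degree of f; what
  is left depends on i alone.\<close>

lemma m1_hom: "f \<in> D (i + d - 1) \<Longrightarrow> m1 (a, f) = (dif A a, \<lambda>x. - sg i * f (dif A x))"
  by (simp add: m1_B dif_dual_hom) (auto simp: sg_def ksg_def fun_eq_iff)

lemma GE:
  assumes "x \<in> G i"
  obtains a f where "x = (a, f)" "a \<in> grd A i" "f \<in> D (i + d - 1)" "f \<in> TD" "lin f"
  using assms D.total_grd D_lin unfolding grd_B by blast

lemma m1_G: "x \<in> G i \<Longrightarrow> m1 x \<in> G (i + 1)"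
proof -
  assume "x \<in> G i"
  then obtain a f where x: "x = (a, f)" "a \<in> grd A i" "f \<in> D (i + d - 1)" by (rule GE)
  then show ?thesis
    using dif_A_grd[OF x(2)] D.grd_ksg[OF dif_dual_D[OF x(3)]] by (simp add: m1_B grd_B algebra_simps)
qed

lemma m1_total: "x \<in> TB \<Longrightarrow> m1 x \<in> TB"
  by (auto simp: total_B m1_B dif_dual_TD D.total_ksg)

lemma m1_add: "x \<in> TB \<Longrightarrow> y \<in> TB \<Longrightarrow> m1 (x + y) = m1 x + m1 y"
  by (auto simp: total_B m1_B plus_prod_def dif_dual_add ksg_add)

lemma m1_scale: "x \<in> TB \<Longrightarrow> m1 (smul B c x) = smul B c (m1 x)"
  by (auto simp: total_B m1_B smul_B dif_dual_scale ksg_def fun_eq_iff)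

lemma m2_G: "x \<in> G i \<Longrightarrow> y \<in> G j \<Longrightarrow> m2 x y \<in> G (i + j)"
proof -
  assume "x \<in> G i" "y \<in> G j"
  then obtain a f b g where x: "x = (a, f)" "a \<in> grd A i" "f \<in> D (i + d - 1)"
    and y: "y = (b, g)" "b \<in> grd A j" "g \<in> D (j + d - 1)" by (metis GE)
  have "ra f b \<in> D (i + j + d - 1)" "la a g \<in> D (i + j + d - 1)"
    using ra_D[OF x(3) y(2)] la_D[OF y(3) x(2)] by (simp_all add: algebra_simps)
  then show ?thesis using mul_A_grd[OF x(2) y(2)] D.grd_add by (simp add: x y m2_B grd_B)
qed

lemma m2_total: "x \<in> TB \<Longrightarrow> y \<in> TB \<Longrightarrow> m2 x y \<in> TB"
  by (auto simp: total_B m2_B ra_TD la_TD D.total_add)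

lemma m2_add:
  "x \<in> TB \<Longrightarrow> x' \<in> TB \<Longrightarrow> y \<in> TB \<Longrightarrow> m2 (x + x') y = m2 x y + m2 x' y"
  "x \<in> TB \<Longrightarrow> x' \<in> TB \<Longrightarrow> y \<in> TB \<Longrightarrow> m2 y (x + x') = m2 y x + m2 y x'"
  by (auto simp: total_B m2_B plus_prod_def ra_add la_add TD_lin fun_eq_iff)

lemma m2_scale:
  "x \<in> TB \<Longrightarrow> y \<in> TB \<Longrightarrow> m2 (smul B c x) y = smul B c (m2 x y)"
  "x \<in> TB \<Longrightarrow> y \<in> TB \<Longrightarrow> m2 y (smul B c x) = smul B c (m2 y x)"
  by (auto simp: total_B m2_B smul_B ra_scale la_scale TD_lin fun_eq_iff algebra_simps)

lemma m1_m1: "x \<in> TB \<Longrightarrow> m1 (m1 x) = 0"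
proof (induction rule: B.total_induct)
  case (hom i x)
  then obtain a f where x: "x = (a, f)" "f \<in> D (i + d - 1)" "lin f" by (rule GE)
  have "m1 x = (dif A a, \<lambda>x. - sg i * f (dif A x))" using m1_hom x by simp
  moreover have "(\<lambda>x. - sg i * f (dif A x)) \<in> D (i + 1 + d - 1)"
    using D.grd_scale[OF D_dif[OF x(2)], of "- sg i"] by (simp add: algebra_simps)
  from m1_hom[OF this] have "m1 (dif A a, \<lambda>x. - sg i * f (dif A x)) = 0"
    by (simp add: zero_prod_def zero_fun_def lin_0[OF x(3)])
  ultimately show ?case by simp
next
  case (add x y)
  then show ?case by (simp add: m1_add m1_total)
qed

lemma lin_scale_dif: "lin f \<Longrightarrow> lin (\<lambda>x. c * f (dif A x))"
  by (simp add: lin_iff algebra_simps)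

text \<open>In the component in A this is the Leibniz rule of A. The functional components are
  compared on homogeneous \<open>c\<close> only, since the differential of a product ca is expanded
  with the degree of c.\<close>

lemma m1_m2:
  assumes "x \<in> G i" "y \<in> G j"
  shows "m1 (m2 x y) = m2 (m1 x) y + ksg i (m2 x (m1 y))"
proof -
  obtain a f b g where x: "x = (a, f)" "a \<in> grd A i" "f \<in> D (i + d - 1)" "f \<in> TD" "lin f"
    and y: "y = (b, g)" "b \<in> grd A j" "g \<in> D (j + d - 1)" "g \<in> TD" "lin g" by (metis GE assms)
  have D1: "ra f b + la a g \<in> D (i + j + d - 1)"
    using m2_G[OF assms] by (simp add: x y m2_B grd_B)
  have f': "(\<lambda>x. - sg i * f (dif A x)) \<in> TD"
    using D.total_scale[OF D.total_grd[OF D_dif[OF x(3)]], of "- sg i"] by simp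
  have g': "(\<lambda>x. - sg j * g (dif A x)) \<in> TD"
    using D.total_scale[OF D.total_grd[OF D_dif[OF y(3)]], of "- sg j"] by simp
  have "(\<lambda>c. - sg (i + j) * (ra f b + la a g) (dif A c)) =
      (\<lambda>c. (ra (\<lambda>x. - sg i * f (dif A x)) b + la (dif A a) g) c +
        sg i * (ra f (dif A b) + la a (\<lambda>x. - sg j * g (dif A x))) c)"
  proof (rule lin_hom_ext)
    show "lin (\<lambda>c. - sg (i + j) * (ra f b + la a g) (dif A c))"
      by (rule lin_scale_dif[OF D_lin[OF D1]])
    have l: "lin (ra (\<lambda>x. - sg i * f (dif A x)) b)" "lin (la (dif A a) g)" "lin (ra f (dif A b))"
      "lin (la a (\<lambda>x. - sg j * g (dif A x)))"
      by (rule TD_lin, intro ra_TD la_TD f' g' x(4) y(4))+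
    show "lin (\<lambda>c. (ra (\<lambda>x. - sg i * f (dif A x)) b + la (dif A a) g) c +
        sg i * (ra f (dif A b) + la a (\<lambda>x. - sg j * g (dif A x))) c)"
      using l by (auto simp: lin_iff algebra_simps)
    fix l c assume c: "c \<in> grd A l"
    have 1: "f (dif A (mul A b c)) = f (mul A (dif A b) c) + sg j * f (mul A b (dif A c))"
      by (simp add: dif_mul_A[OF y(2)] lin_add[OF x(5)] lin_ksg[OF x(5)])
    have 2: "g (dif A (mul A c a)) = g (mul A (dif A c) a) + sg l * g (mul A c (dif A a))"
      by (simp add: dif_mul_A[OF c] lin_add[OF y(5)] lin_ksg[OF y(5)])
    \<comment> \<open>The two signs differ in general. They agree in the one degree of
      \<open>c\<close> in which the value is nonzero.\<close>
    have 3: "sg (d * (i + 1)) * g (mul A c (dif A a)) = sg (i + j + d * i + l) * g (mul A c (dif A a))"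
    proof (cases "l + (i + 1) + (j + d - 1) = 0")
      case True
      then have "l = - (i + j + d)" by simp
      then have "sg (d * (i + 1)) = (sg (i + j + d * i + l) :: 'k)" by (intro sg_eqI) auto
      then show ?thesis by simp
    qed (use D_zero[OF y(3) mul_A_grd[OF c dif_A_grd[OF x(2)]]] in simp)
    show "- sg (i + j) * (ra f b + la a g) (dif A c) =
        (ra (\<lambda>x. - sg i * f (dif A x)) b + la (dif A a) g) c +
        sg i * (ra f (dif A b) + la a (\<lambda>x. - sg j * g (dif A x))) c"
      using 3 g' y(4)
      by (simp add: ra_eq la_eq \<theta>_hom[OF x(2)] \<theta>_hom[OF dif_A_grd[OF x(2)]] mul_A_ksg dif_A_ksg lin_ksg[OF y(5)]
        1 2 sg_add algebra_simps) (elim disjE; simp)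
  qed
  then show ?thesis
    by (simp add: x y m2_B m1_hom[OF D1] m1_hom[OF x(3)] m1_hom[OF y(3)] plus_prod_def ksg_Pair
      dif_mul_A[OF x(2)] fun_eq_iff ksg_fun_apply ksg_field)
qed

text \<open>Written with \<open>\<theta>\<close>, both actions are free of signs, and the claim
  follows from associativity in A and multiplicativity of \<open>\<theta>\<close>.\<close>

lemma m2_assoc:
  assumes "x \<in> TB" "y \<in> TB" "z \<in> TB"
  shows "m2 (m2 x y) z = m2 x (m2 y z)"
proof -
  obtain a f b g c h where xyz: "x = (a, f)" "y = (b, g)" "z = (c, h)" "f \<in> TD" "g \<in> TD" "h \<in> TD"
    using assms by (auto simp: total_B)
  have "ra g c + la b h \<in> TD" by (intro D.total_add ra_TD la_TD xyz)
  then show ?thesis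
    using xyz by (simp add: m2_B mul_A_assoc la_eq \<theta>_mul) (simp add: ra_eq fun_eq_iff mul_A_assoc)
qed

lemma m1_cyclic:
  assumes "x \<in> G i" "y \<in> G j"
  shows "\<gamma> (m1 x) y = sg (1 + j * i) * \<gamma> (m1 y) x"
proof -
  obtain a f b g where x: "x = (a, f)" "a \<in> grd A i" "f \<in> D (i + d - 1)" "f \<in> TD" "lin f"
    and y: "y = (b, g)" "b \<in> grd A j" "g \<in> D (j + d - 1)" "g \<in> TD" "lin g" by (metis GE assms)
  show ?thesis
  proof (cases "i + j + d = 0")
    case True
    then have d: "d = - i - j" by simp
    have s: "sg (d * (i + 1)) = (sg (1 + j * i) * - sg j :: 'k)" "- sg i = (sg (1 + j * i) * sg (d * (j + 1)) :: 'k)"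
      unfolding d by (auto simp: sg_def)
    have "\<gamma> (m1 x) y = - sg i * f (dif A b) + sg (d * (i + 1)) * g (dif A a)"
      using m1_hom[OF x(3)] y(4)
      by (simp add: x y nat_form_eq \<theta>_hom[OF dif_A_grd[OF x(2)]] lin_ksg[OF y(5)])
    moreover have "\<gamma> (m1 y) x = - sg j * g (dif A a) + sg (d * (j + 1)) * f (dif A b)"
      using m1_hom[OF y(3)] x(4)
      by (simp add: x y nat_form_eq \<theta>_hom[OF dif_A_grd[OF y(2)]] lin_ksg[OF x(5)])
    ultimately show ?thesis using s by algebra
  next
    case False
    then show ?thesis using \<gamma>_degree[OF m1_G[OF assms(1)] assms(2)] \<gamma>_degree[OF m1_G[OF assms(2)] assms(1)]
      by (simp add: algebra_simps)
  qed
qed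

text \<open>Both sides are signed sums of the same three values f(bc), g(ca) and h(ab). Once d is
  eliminated through the degrees, the signs match.\<close>

lemma m2_cyclic:
  assumes "x \<in> G i" "y \<in> G j" "z \<in> G k"
  shows "\<gamma> (m2 x y) z = sg (k * (i + j)) * \<gamma> (m2 z x) y"
proof -
  obtain a f b g c h where x: "x = (a, f)" "a \<in> grd A i" "f \<in> D (i + d - 1)" "f \<in> TD" "lin f"
    and y: "y = (b, g)" "b \<in> grd A j" "g \<in> D (j + d - 1)" "g \<in> TD" "lin g"
    and z: "z = (c, h)" "c \<in> grd A k" "h \<in> D (k + d - 1)" "h \<in> TD" "lin h" by (metis GE assms)
  show ?thesis
  proof (cases "i + j + k + (d - 1) = 0")
    case True
    then have d: "d = 1 - i - j - k" by simp
    have s: "sg (k * (i + j)) * sg (d * k) = (1 :: 'k)" "sg (d * i) = (sg (k * (i + j)) * sg (d * (k + i)) :: 'k)"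
      "sg (d * (i + j)) = (sg (k * (i + j)) :: 'k)"
      unfolding d by (auto simp: sg_def)
    have "\<gamma> (m2 x y) z = f (mul A b c) + sg (d * i) * g (mul A c a) + sg (d * (i + j)) * h (mul A a b)"
      using y(4) z(4)
      by (simp add: x y z m2_B nat_form_eq \<theta>_hom[OF mul_A_grd[OF x(2) y(2)]] lin_ksg[OF y(5)] lin_ksg[OF z(5)]
        ra_eq la_eq \<theta>_hom[OF x(2)] mul_A_ksg)
    moreover have "\<gamma> (m2 z x) y = h (mul A a b) + sg (d * k) * f (mul A b c) + sg (d * (k + i)) * g (mul A c a)"
      using x(4) y(4)
      by (simp add: x y z m2_B nat_form_eq \<theta>_hom[OF mul_A_grd[OF z(2) x(2)]] lin_ksg[OF x(5)] lin_ksg[OF y(5)]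
        ra_eq la_eq \<theta>_hom[OF z(2)] mul_A_ksg)
    ultimately show ?thesis using s(1) unfolding s(2,3) by (simp add: algebra_simps)
  next
    case False
    then show ?thesis
      using \<gamma>_degree[OF m2_G[OF assms(1,2)] assms(3)] \<gamma>_degree[OF m2_G[OF assms(3,1)] assms(2)]
      by (simp add: algebra_simps)
  qed
qed

end

section \<open>Ternary operations and cyclic rotation of their Stasheff sums\<close>

locale m3_operation = dga d A for d :: int and A :: "('k::field, 'a::ab_group_add) dgalg" +
  fixes X :: "'a \<Rightarrow> ('a \<Rightarrow> 'k) \<Rightarrow> 'a \<Rightarrow> 'a"
    and Y :: "('a \<Rightarrow> 'k) \<Rightarrow> 'a \<Rightarrow> ('a \<Rightarrow> 'k) \<Rightarrow> ('a \<Rightarrow> 'k)"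
  assumes X_add: "g \<in> TD \<Longrightarrow> X (b + b') g a = X b g a + X b' g a"
      "g \<in> TD \<Longrightarrow> g' \<in> TD \<Longrightarrow> X b (g + g') a = X b g a + X b g' a"
      "g \<in> TD \<Longrightarrow> X b g (a + a') = X b g a + X b g a'"
    and X_scale: "g \<in> TD \<Longrightarrow> X (smul A c b) g a = smul A c (X b g a)"
      "g \<in> TD \<Longrightarrow> X b (\<lambda>x. c * g x) a = smul A c (X b g a)"
      "g \<in> TD \<Longrightarrow> X b g (smul A c a) = smul A c (X b g a)"
    and X_grd: "b \<in> grd A j \<Longrightarrow> g \<in> D q \<Longrightarrow> a \<in> grd A i \<Longrightarrow> X b g a \<in> grd A (i + j + q - d)"
    and Y_TD: "f \<in> TD \<Longrightarrow> g \<in> TD \<Longrightarrow> Y f b g \<in> TD"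
    and Y_add: "f \<in> TD \<Longrightarrow> f' \<in> TD \<Longrightarrow> g \<in> TD \<Longrightarrow> Y (f + f') b g = Y f b g + Y f' b g"
      "f \<in> TD \<Longrightarrow> g \<in> TD \<Longrightarrow> Y f (b + b') g = Y f b g + Y f b' g"
      "f \<in> TD \<Longrightarrow> g \<in> TD \<Longrightarrow> g' \<in> TD \<Longrightarrow> Y f b (g + g') = Y f b g + Y f b g'"
    and Y_scale: "f \<in> TD \<Longrightarrow> g \<in> TD \<Longrightarrow> Y (\<lambda>x. c * f x) b g = (\<lambda>x. c * Y f b g x)"
      "f \<in> TD \<Longrightarrow> g \<in> TD \<Longrightarrow> Y f (smul A c b) g = (\<lambda>x. c * Y f b g x)"
      "f \<in> TD \<Longrightarrow> g \<in> TD \<Longrightarrow> Y f b (\<lambda>x. c * g x) = (\<lambda>x. c * Y f b g x)"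
    and Y_D: "f \<in> D p \<Longrightarrow> b \<in> grd A j \<Longrightarrow> g \<in> D q \<Longrightarrow> Y f b g \<in> D (p + q + j - d)"
    and cyc1: "a1 \<in> grd A i \<Longrightarrow> f2 \<in> D (j + d - 1) \<Longrightarrow> a3 \<in> grd A k \<Longrightarrow> f0 \<in> D (l + d - 1) \<Longrightarrow>
      f0 (\<theta> (X a1 f2 a3)) = sg (1 + l * (i + j + k)) * Y f0 a1 f2 a3"
    and cyc2: "f1 \<in> D (i + d - 1) \<Longrightarrow> a2 \<in> grd A j \<Longrightarrow> f3 \<in> D (k + d - 1) \<Longrightarrow> a0 \<in> grd A l \<Longrightarrow>
      Y f1 a2 f3 a0 = sg (1 + l * (i + j + k)) * f3 (\<theta> (X a0 f1 a2))"
begin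

definition M :: "'a \<times> ('a \<Rightarrow> 'k) \<Rightarrow> 'a \<times> ('a \<Rightarrow> 'k) \<Rightarrow> 'a \<times> ('a \<Rightarrow> 'k) \<Rightarrow> 'a \<times> ('a \<Rightarrow> 'k)" where
  "M x y z = (X (fst x) (snd y) (fst z), Y (snd x) (fst y) (snd z))"

lemma M_eq [simp]: "M (a1, f1) (a2, f2) (a3, f3) = (X a1 f2 a3, Y f1 a2 f3)"
  by (simp add: M_def)

lemma X_0 [simp]: "g \<in> TD \<Longrightarrow> X 0 g a = 0" "X b 0 a = 0" "g \<in> TD \<Longrightarrow> X b g 0 = 0"
  using X_add(1)[of g 0 0 a] X_add(2)[of 0 0 b a] X_add(3)[of g b 0 0] by auto

lemma Y_0 [simp]: "g \<in> TD \<Longrightarrow> Y 0 b g = 0" "f \<in> TD \<Longrightarrow> g \<in> TD \<Longrightarrow> Y f 0 g = 0" "f \<in> TD \<Longrightarrow> Y f b 0 = 0"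
  using Y_add(1)[of 0 0 g b] Y_add(2)[of f g 0 0] Y_add(3)[of f 0 0 b] by auto

lemma M_G: "x \<in> G i \<Longrightarrow> y \<in> G j \<Longrightarrow> z \<in> G k \<Longrightarrow> M x y z \<in> G (i + j + k - 1)"
proof -
  assume "x \<in> G i" "y \<in> G j" "z \<in> G k"
  then obtain a f b g c h where x: "x = (a, f)" "a \<in> grd A i" "f \<in> D (i + d - 1)"
    and y: "y = (b, g)" "b \<in> grd A j" "g \<in> D (j + d - 1)"
    and z: "z = (c, h)" "c \<in> grd A k" "h \<in> D (k + d - 1)" by (metis GE)
  show ?thesis
    using X_grd[OF x(2) y(3) z(2)] Y_D[OF x(3) y(2) z(3)] by (simp add: x y z grd_B algebra_simps)
qed

lemma M_total: "x \<in> TB \<Longrightarrow> y \<in> TB \<Longrightarrow> z \<in> TB \<Longrightarrow> M x y z \<in> TB"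
  by (auto simp: total_B Y_TD)

text \<open>Each side has two contributions, one from each alternating word. On these words the
  claim is \<open>cyc1\<close> and \<open>cyc2\<close>.\<close>

lemma M_cyclic:
  assumes "x \<in> G i" "y \<in> G j" "z \<in> G k" "w \<in> G l"
  shows "\<gamma> (M x y z) w = sg (1 + l * (i + j + k)) * \<gamma> (M w x y) z"
proof -
  obtain a f b g c h e u where x: "x = (a, f)" "a \<in> grd A i" "f \<in> D (i + d - 1)"
    and y: "y = (b, g)" "b \<in> grd A j" "g \<in> D (j + d - 1)"
    and z: "z = (c, h)" "c \<in> grd A k" "h \<in> D (k + d - 1)"
    and w: "w = (e, u)" "e \<in> grd A l" "u \<in> D (l + d - 1)" by (metis GE assms)
  show ?thesis
    using cyc1[OF x(2) y(3) z(2) w(3)] cyc2[OF x(3) y(2) z(3) w(2)]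
    by (simp add: x y z w nat_form_eq D.total_grd[OF w(3)] D.total_grd[OF z(3)] algebra_simps)
qed

text \<open>
  The Stasheff sums of three, four and five arguments paired with \<open>w\<close>. For three arguments the two
  terms $m_2(m_2 \otimes \mathrm{id})$ and $m_2(\mathrm{id} \otimes m_2)$ are left out, since they cancel.
\<close>

definition stasheff_form3 where
  "stasheff_form3 i j x y z w = \<gamma> (m1 (M x y z)) w + \<gamma> (M (m1 x) y z) w + sg i * \<gamma> (M x (m1 y) z) w
     + sg (i + j) * \<gamma> (M x y (m1 z)) w"

definition stasheff_form4 where
  "stasheff_form4 i x y z u w = - \<gamma> (m2 (M x y z) u) w + sg (1 + i) * \<gamma> (m2 x (M y z u)) w
     + \<gamma> (M (m2 x y) z u) w - \<gamma> (M x (m2 y z) u) w + \<gamma> (M x y (m2 z u)) w"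

definition stasheff_form5 where
  "stasheff_form5 i j x y z u v w = \<gamma> (M (M x y z) u v) w + sg i * \<gamma> (M x (M y z u) v) w
     + sg (i + j) * \<gamma> (M x y (M z u v)) w"

lemma stasheff_form3_rotate:
  assumes x: "x \<in> G i" and y: "y \<in> G j" and z: "z \<in> G k" and w: "w \<in> G l"
  shows "stasheff_form3 i j x y z w = sg (1 + l * (i + j + k)) * stasheff_form3 l i w x y z"
proof -
  note m1 = m1_G and M = M_G
  \<comment> \<open>Here the inner and the outer operation trade places: cyclicity of the outer one,
    symmetry of the form, and cyclicity of the one that used to be inner.\<close>
  have 1: "\<gamma> (m1 (M x y z)) w = sg (1 + l * (i + j + k)) * \<gamma> (M (m1 w) x y) z"
    by (rule sg_trans[OF m1_cyclic[OF M[OF x y z] w] sg_trans[OF \<gamma>_sym[OF m1[OF w] M[OF x y z]]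
      M_cyclic[OF x y z m1[OF w]] refl]]) auto
  have 2: "\<gamma> (M (m1 x) y z) w = sg (1 + l * (i + j + k) + l) * \<gamma> (M w (m1 x) y) z"
    unfolding M_cyclic[OF m1[OF x] y z w] by (rule arg_cong2[where f = "(*)"], rule sg_eqI) auto
  have 3: "\<gamma> (M x (m1 y) z) w = sg (1 + l * (i + j + k) + l) * \<gamma> (M w x (m1 y)) z"
    unfolding M_cyclic[OF x m1[OF y] z w] by (rule arg_cong2[where f = "(*)"], rule sg_eqI) auto
  have 4: "\<gamma> (M x y (m1 z)) w = sg (1 + l * (i + j + k) + i + j) * \<gamma> (m1 (M w x y)) z"
    by (rule sg_trans[OF M_cyclic[OF x y m1[OF z] w] sg_trans[OF \<gamma>_sym[OF M[OF w x y] m1[OF z]]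
      m1_cyclic[OF z M[OF w x y]] refl]]) auto
  show ?thesis
    unfolding stasheff_form3_def 1 2 3 4 by (auto simp: sg_def)
qed

lemma stasheff_form4_rotate:
  assumes x: "x \<in> G i" and y: "y \<in> G j" and z: "z \<in> G k" and u: "u \<in> G n" and w: "w \<in> G l"
  shows "stasheff_form4 i x y z u w = sg (l * (i + j + k + n)) * stasheff_form4 l w x y z u"
proof -
  note m2 = m2_G and M = M_G
  let ?e = "l * (i + j + k + n)"
  have 1: "\<gamma> (m2 (M x y z) u) w = sg (?e + l) * \<gamma> (m2 w (M x y z)) u"
    unfolding m2_cyclic[OF M[OF x y z] u w] by (rule arg_cong2[where f = "(*)"], rule sg_eqI) auto
  have 2: "\<gamma> (m2 x (M y z u)) w = sg (?e + i + 1) * \<gamma> (M (m2 w x) y z) u"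
    by (rule sg_trans[OF m2_cyclic[OF x M[OF y z u] w] sg_trans[OF \<gamma>_sym[OF m2[OF w x] M[OF y z u]]
      M_cyclic[OF y z u m2[OF w x]] refl]]) auto
  have 3: "\<gamma> (M (m2 x y) z u) w = sg (?e + 1) * \<gamma> (M w (m2 x y) z) u"
    unfolding M_cyclic[OF m2[OF x y] z u w] by (rule arg_cong2[where f = "(*)"], rule sg_eqI) auto
  have 4: "\<gamma> (M x (m2 y z) u) w = sg (?e + 1) * \<gamma> (M w x (m2 y z)) u"
    unfolding M_cyclic[OF x m2[OF y z] u w] by (rule arg_cong2[where f = "(*)"], rule sg_eqI) auto
  have 5: "\<gamma> (M x y (m2 z u)) w = sg (?e + 1) * \<gamma> (m2 (M w x y) z) u"
    by (rule sg_trans[OF M_cyclic[OF x y m2[OF z u] w] sg_trans[OF \<gamma>_sym[OF M[OF w x y] m2[OF z u]]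
      m2_cyclic[OF z u M[OF w x y]] refl]]) auto
  show ?thesis
    unfolding stasheff_form4_def 1 2 3 4 5 by (auto simp: sg_def)
qed

lemma stasheff_form5_rotate:
  assumes x: "x \<in> G i" and y: "y \<in> G j" and z: "z \<in> G k" and u: "u \<in> G n" and v: "v \<in> G r" and w: "w \<in> G l"
  shows "stasheff_form5 i j x y z u v w = sg (1 + l * (i + j + k + n + r)) * stasheff_form5 l i w x y z u v"
proof -
  note M = M_G
  let ?e = "l * (i + j + k + n + r)"
  have 1: "\<gamma> (M (M x y z) u v) w = sg (1 + ?e + l) * \<gamma> (M w (M x y z) u) v"
    unfolding M_cyclic[OF M[OF x y z] u v w] by (rule arg_cong2[where f = "(*)"], rule sg_eqI) auto
  have 2: "\<gamma> (M x (M y z u) v) w = sg (1 + ?e + l) * \<gamma> (M w x (M y z u)) v"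
    unfolding M_cyclic[OF x M[OF y z u] v w] by (rule arg_cong2[where f = "(*)"], rule sg_eqI) auto
  have 3: "\<gamma> (M x y (M z u v)) w = sg (1 + ?e + i + j) * \<gamma> (M (M w x y) z u) v"
    by (rule sg_trans[OF M_cyclic[OF x y M[OF z u v] w] sg_trans[OF \<gamma>_sym[OF M[OF w x y] M[OF z u v]]
      M_cyclic[OF z u v M[OF w x y]] refl]]) auto
  show ?thesis
    unfolding stasheff_form5_def 1 2 3 by (auto simp: sg_def)
qed

end

context dga
begin

lemma \<gamma>_ksg_left: "x \<in> TB \<Longrightarrow> y \<in> TB \<Longrightarrow> \<gamma> (ksg e x) y = sg e * \<gamma> x y"
  by (simp add: ksg_scale[OF B.vector_space] \<gamma>_scale_left)

lemma \<gamma>_minus_left: "x \<in> TB \<Longrightarrow> y \<in> TB \<Longrightarrow> \<gamma> (- x) y = - \<gamma> x y"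
  using \<gamma>_ksg_left[of x y 1] by (simp add: ksg_def sg_def)

lemma B_total_diff: "x \<in> TB \<Longrightarrow> y \<in> TB \<Longrightarrow> x - y \<in> TB"
  using B.total_add[OF _ B.total_minus, of x y] by simp

lemma \<gamma>_diff_left:
  "x \<in> TB \<Longrightarrow> y \<in> TB \<Longrightarrow> z \<in> TB \<Longrightarrow> \<gamma> (x - y) z = \<gamma> x z - \<gamma> y z"
  using \<gamma>_add_left[of x "- y" z] B.total_minus[of y] by (simp add: \<gamma>_minus_left)

lemma \<gamma>_hom_separates:
  assumes "x \<in> TB" "\<And>j y. y \<in> G j \<Longrightarrow> \<gamma> x y = 0"
  shows "x = 0"
proof (rule \<gamma>_separates[OF assms(1)])
  show "\<gamma> x (a, 0) = 0" if "a \<in> grd A i" for a i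
    by (rule assms(2)[of _ i]) (simp add: grd_B that)
  show "\<gamma> x (0, f) = 0" if "f \<in> D p" for f p
    by (rule assms(2)[of _ "p - d + 1"]) (simp add: grd_B that)
qed

end

context m3_operation
begin

section \<open>Reduction of the Stasheff identities to one cyclic word each\<close>

abbreviation \<delta> :: "('a \<Rightarrow> 'k) \<Rightarrow> ('a \<Rightarrow> 'k)" where
  "\<delta> f \<equiv> ksg (d - 1) (dif (dual A) f)"

lemma \<delta>_TD: "f \<in> TD \<Longrightarrow> \<delta> f \<in> TD"
  by (intro D.total_ksg dif_dual_TD)

text \<open>For g of degree q in A#, the degree of tg is q - d + 1; the form needs it for its
  signs.\<close>

definition stasheff_word3 where
  "stasheff_word3 \<longleftrightarrow> (\<forall>j q i p. \<forall>b \<in> grd A j. \<forall>g \<in> D q. \<forall>a \<in> grd A i. \<forall>f \<in> D p.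
     stasheff_form3 j (q - d + 1) (b, 0) (0, g) (a, 0) (0, f) = 0)"

definition stasheff_word4 where
  "stasheff_word4 \<longleftrightarrow> (\<forall>j l q i p. \<forall>b \<in> grd A j. \<forall>c \<in> grd A l. \<forall>g \<in> D q. \<forall>a \<in> grd A i. \<forall>f \<in> D p.
     stasheff_form4 j (b, 0) (c, 0) (0, g) (a, 0) (0, f) = 0)"

definition stasheff_word5 where
  "stasheff_word5 \<longleftrightarrow> (\<forall>l r j q i p. \<forall>c \<in> grd A l. \<forall>h \<in> D r. \<forall>b \<in> grd A j. \<forall>g \<in> D q. \<forall>a \<in> grd A i. \<forall>f \<in> D p.
     stasheff_form5 l (r - d + 1) (c, 0) (0, h) (b, 0) (0, g) (a, 0) (0, f) = 0)"

text \<open>\<open>M\<close> is nonzero only on alternating words, and the form pairs A with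
  functionals. Of the sixteen words in four arguments two survive, and they are rotations of each
  other.\<close>

lemma stasheff_form3_words:
  assumes "f1 \<in> TD" "f2 \<in> TD" "f3 \<in> TD" "f0 \<in> TD"
  shows "stasheff_form3 i j (a1, f1) (a2, f2) (a3, f3) (a0, f0) =
    stasheff_form3 i j (a1, 0) (0, f2) (a3, 0) (0, f0) + stasheff_form3 i j (0, f1) (a2, 0) (0, f3) (a0, 0)"
  using assms by (simp add: stasheff_form3_def m1_B nat_form_eq \<delta>_TD Y_TD algebra_simps)

text \<open>Of the thirty-two words in five arguments, the survivors are the five rotations of the
  word with two adjacent elements of A followed by a functional, an element and a
  functional.\<close>

lemma stasheff_form4_words:
  assumes "f1 \<in> TD" "f2 \<in> TD" "f3 \<in> TD" "f4 \<in> TD" "f0 \<in> TD"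
  shows "stasheff_form4 i (a1, f1) (a2, f2) (a3, f3) (a4, f4) (a0, f0) =
    stasheff_form4 i (a1, 0) (a2, 0) (0, f3) (a4, 0) (0, f0) + stasheff_form4 i (a1, 0) (0, f2) (a3, 0) (a4, 0) (0, f0)
    + stasheff_form4 i (a1, 0) (0, f2) (a3, 0) (0, f4) (a0, 0) + stasheff_form4 i (0, f1) (a2, 0) (0, f3) (a4, 0) (a0, 0)
    + stasheff_form4 i (0, f1) (a2, 0) (a3, 0) (0, f4) (a0, 0)"
  using assms
  by (simp add: stasheff_form4_def m2_B nat_form_eq ra_TD la_TD Y_TD D.total_add X_add Y_add TD_lin ra_add la_add \<theta>_add
      lin_add lin_0[OF TD_lin] algebra_simps)

lemma stasheff_form5_words:
  assumes "f1 \<in> TD" "f2 \<in> TD" "f3 \<in> TD" "f4 \<in> TD" "f5 \<in> TD" "f0 \<in> TD"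
  shows "stasheff_form5 i j (a1, f1) (a2, f2) (a3, f3) (a4, f4) (a5, f5) (a0, f0) =
    stasheff_form5 i j (a1, 0) (0, f2) (a3, 0) (0, f4) (a5, 0) (0, f0) +
    stasheff_form5 i j (0, f1) (a2, 0) (0, f3) (a4, 0) (0, f5) (a0, 0)"
  using assms by (simp add: stasheff_form5_def nat_form_eq Y_TD algebra_simps)

lemma G_A: "a \<in> grd A i \<Longrightarrow> (a, 0) \<in> G i"
  and G_D: "f \<in> D (i + d - 1) \<Longrightarrow> (0, f) \<in> G i"
  by (simp_all add: grd_B)

lemma stasheff_form3_eq_0:
  assumes stasheff_word3 and x: "x \<in> G i" and y: "y \<in> G j" and z: "z \<in> G k" and w: "w \<in> G l"
  shows "stasheff_form3 i j x y z w = 0"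
proof -
  have b: "stasheff_form3 j q (b, 0) (0, g) (a, 0) (0, f) = 0"
    if "b \<in> grd A j" "g \<in> D (q + d - 1)" "a \<in> grd A i" "f \<in> D (p + d - 1)" for j q i p b g a f
    using assms(1)[unfolded stasheff_word3_def, rule_format, OF that] by simp
  obtain a1 f1 a2 f2 a3 f3 a0 f0 where e: "x = (a1, f1)" "y = (a2, f2)" "z = (a3, f3)" "w = (a0, f0)"
    and A: "a1 \<in> grd A i" "a2 \<in> grd A j" "a3 \<in> grd A k" "a0 \<in> grd A l"
    and D: "f1 \<in> D (i + d - 1)" "f2 \<in> D (j + d - 1)" "f3 \<in> D (k + d - 1)" "f0 \<in> D (l + d - 1)"
    using x y z w by (metis GE)
  show ?thesis
    unfolding e stasheff_form3_words[OF D.total_grd[OF D(1)] D.total_grd[OF D(2)] D.total_grd[OF D(3)] D.total_grd[OF D(4)]]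
      stasheff_form3_rotate[OF G_D[OF D(1)] G_A[OF A(2)] G_D[OF D(3)] G_A[OF A(4)]]
      b[OF A(1) D(2) A(3) D(4)] b[OF A(4) D(1) A(2) D(3)] by simp
qed

lemma stasheff_form4_eq_0:
  assumes stasheff_word4 and x: "x \<in> G i" and y: "y \<in> G j" and z: "z \<in> G k" and u: "u \<in> G n" and w: "w \<in> G l"
  shows "stasheff_form4 i x y z u w = 0"
proof -
  have b: "stasheff_form4 j (b, 0) (c, 0) (0, g) (a, 0) (0, f) = 0"
    if "b \<in> grd A j" "c \<in> grd A l" "g \<in> D (q + d - 1)" "a \<in> grd A i" "f \<in> D (p + d - 1)" for j l q i p b c g a f
    using assms(1)[unfolded stasheff_word4_def, rule_format, OF that] by simp
  obtain a1 f1 a2 f2 a3 f3 a4 f4 a0 f0 where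
    e: "x = (a1, f1)" "y = (a2, f2)" "z = (a3, f3)" "u = (a4, f4)" "w = (a0, f0)"
    and A: "a1 \<in> grd A i" "a2 \<in> grd A j" "a3 \<in> grd A k" "a4 \<in> grd A n" "a0 \<in> grd A l"
    and D: "f1 \<in> D (i + d - 1)" "f2 \<in> D (j + d - 1)" "f3 \<in> D (k + d - 1)" "f4 \<in> D (n + d - 1)"
      "f0 \<in> D (l + d - 1)"
    using x y z u w by (metis GE)
  note GA = A[THEN G_A] and GD = D[THEN G_D]
  \<comment> \<open>Each surviving word is rotated until its two cyclically adjacent elements of A
    stand in front. This takes no, four, three, one and two rotations in the five cases.\<close>
  have 1: "stasheff_form4 i (a1, 0) (a2, 0) (0, f3) (a4, 0) (0, f0) = 0"
    by (rule b[OF A(1) A(2) D(3) A(4) D(5)])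
  have 2: "stasheff_form4 i (0, f1) (a2, 0) (a3, 0) (0, f4) (a0, 0) = 0"
    unfolding stasheff_form4_rotate[OF GD(1) GA(2) GA(3) GD(4) GA(5)] stasheff_form4_rotate[OF GA(5) GD(1) GA(2) GA(3) GD(4)]
      stasheff_form4_rotate[OF GD(4) GA(5) GD(1) GA(2) GA(3)] stasheff_form4_rotate[OF GA(3) GD(4) GA(5) GD(1) GA(2)]
      b[OF A(2) A(3) D(4) A(5) D(1)] by simp
  have 3: "stasheff_form4 i (a1, 0) (0, f2) (a3, 0) (a4, 0) (0, f0) = 0"
    unfolding stasheff_form4_rotate[OF GA(1) GD(2) GA(3) GA(4) GD(5)] stasheff_form4_rotate[OF GD(5) GA(1) GD(2) GA(3) GA(4)]
      stasheff_form4_rotate[OF GA(4) GD(5) GA(1) GD(2) GA(3)]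
      b[OF A(3) A(4) D(5) A(1) D(2)] by simp
  have 4: "stasheff_form4 i (a1, 0) (0, f2) (a3, 0) (0, f4) (a0, 0) = 0"
    unfolding stasheff_form4_rotate[OF GA(1) GD(2) GA(3) GD(4) GA(5)]
      b[OF A(5) A(1) D(2) A(3) D(4)] by simp
  have 5: "stasheff_form4 i (0, f1) (a2, 0) (0, f3) (a4, 0) (a0, 0) = 0"
    unfolding stasheff_form4_rotate[OF GD(1) GA(2) GD(3) GA(4) GA(5)] stasheff_form4_rotate[OF GA(5) GD(1) GA(2) GD(3) GA(4)]
      b[OF A(4) A(5) D(1) A(2) D(3)] by simp
  show ?thesis
    unfolding e stasheff_form4_words[OF D.total_grd[OF D(1)] D.total_grd[OF D(2)] D.total_grd[OF D(3)] D.total_grd[OF D(4)]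
        D.total_grd[OF D(5)]] 1 2 3 4 5 by simp
qed

lemma stasheff_form5_eq_0:
  assumes stasheff_word5 and x: "x \<in> G i" and y: "y \<in> G j" and z: "z \<in> G k" and u: "u \<in> G n" and v: "v \<in> G r" and w: "w \<in> G l"
  shows "stasheff_form5 i j x y z u v w = 0"
proof -
  have b: "stasheff_form5 l r (c, 0) (0, h) (b, 0) (0, g) (a, 0) (0, f) = 0"
    if "c \<in> grd A l" "h \<in> D (r + d - 1)" "b \<in> grd A j" "g \<in> D (q + d - 1)" "a \<in> grd A i" "f \<in> D (p + d - 1)"
    for l r j q i p c h b g a f
    using assms(1)[unfolded stasheff_word5_def, rule_format, OF that] by simp
  obtain a1 f1 a2 f2 a3 f3 a4 f4 a5 f5 a0 f0 where
    e: "x = (a1, f1)" "y = (a2, f2)" "z = (a3, f3)" "u = (a4, f4)" "v = (a5, f5)" "w = (a0, f0)"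
    and A: "a1 \<in> grd A i" "a2 \<in> grd A j" "a3 \<in> grd A k" "a4 \<in> grd A n" "a5 \<in> grd A r" "a0 \<in> grd A l"
    and D: "f1 \<in> D (i + d - 1)" "f2 \<in> D (j + d - 1)" "f3 \<in> D (k + d - 1)" "f4 \<in> D (n + d - 1)"
      "f5 \<in> D (r + d - 1)" "f0 \<in> D (l + d - 1)"
    using x y z u v w by (metis GE)
  note GA = A[THEN G_A] and GD = D[THEN G_D]
  show ?thesis
    unfolding e stasheff_form5_words[OF D.total_grd[OF D(1)] D.total_grd[OF D(2)] D.total_grd[OF D(3)] D.total_grd[OF D(4)]
        D.total_grd[OF D(5)] D.total_grd[OF D(6)]]
      stasheff_form5_rotate[OF GD(1) GA(2) GD(3) GA(4) GD(5) GA(6)]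
      b[OF A(1) D(2) A(3) D(4) A(5) D(6)] b[OF A(6) D(1) A(2) D(3) A(4) D(5)] by simp
qed

section \<open>The Stasheff sums\<close>

text \<open>The Stasheff sums are computed for any \<open>m\<close> with these values. The results
  then apply both to a given structure and to the structure \<open>mop\<close> constructed from
  \<open>M\<close>.\<close>

definition realizes :: "(nat \<Rightarrow> ('a \<times> ('a \<Rightarrow> 'k)) list \<Rightarrow> 'a \<times> ('a \<Rightarrow> 'k)) \<Rightarrow> bool" where
  "realizes m \<longleftrightarrow> (\<forall>x \<in> TB. m 1 [x] = m1 x) \<and>
     (\<forall>x \<in> TB. \<forall>y \<in> TB. m 2 [x, y] = m2 x y) \<and>
     (\<forall>x \<in> TB. \<forall>y \<in> TB. \<forall>z \<in> TB. m 3 [x, y, z] = M x y z) \<and>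
     (\<forall>n \<ge> 4. \<forall>xs \<in> op_dom B n. m n xs = 0)"

definition stasheff_term ::
  "(nat \<Rightarrow> ('a \<times> ('a \<Rightarrow> 'k)) list \<Rightarrow> 'a \<times> ('a \<Rightarrow> 'k)) \<Rightarrow> (int \<times> ('a \<times> ('a \<Rightarrow> 'k))) list \<Rightarrow>
   nat \<times> nat \<times> nat \<Rightarrow> 'a \<times> ('a \<Rightarrow> 'k)"
  where "stasheff_term m xs = (\<lambda>(r, s, t).
     ksg (int r + int s * int t + (2 - int s) * sum_list (map fst (take r xs)))
       (m (r + 1 + t) (map snd (take r xs) @ [m s (map snd (take s (drop r xs)))] @ map snd (drop (r + s) xs))))"

definition stasheff_set :: "nat \<Rightarrow> (nat \<times> nat \<times> nat) set" where
  "stasheff_set n = {(r, s, t). r + s + t = n \<and> s \<ge> 1}"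

lemma finite_stasheff_set: "finite (stasheff_set n)"
  by (rule finite_subset[of _ "{..n} \<times> {..n} \<times> {..n}"]) (auto simp: stasheff_set_def)

context
  fixes m assumes m: "realizes m"
begin

lemma realizes_simps:
  "x \<in> TB \<Longrightarrow> m (Suc 0) [x] = m1 x"
  "x \<in> TB \<Longrightarrow> y \<in> TB \<Longrightarrow> m 2 [x, y] = m2 x y"
  "x \<in> TB \<Longrightarrow> y \<in> TB \<Longrightarrow> z \<in> TB \<Longrightarrow> m 3 [x, y, z] = M x y z"
  using m by (auto simp: realizes_def)

lemma realizes_ge_4: "n \<ge> 4 \<Longrightarrow> length xs = n \<Longrightarrow> set xs \<subseteq> TB \<Longrightarrow> m n xs = 0"
  using m by (auto simp: realizes_def op_dom_def)

lemma length_cases_123: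
  assumes "1 \<le> length xs" "length xs \<le> 3"
  obtains x where "xs = [x]" | x y where "xs = [x, y]" | x y z where "xs = [x, y, z]"
  using assms by (cases xs; cases "tl xs"; cases "tl (tl xs)"; cases "tl (tl (tl xs))") auto

lemma realizes_total:
  assumes "1 \<le> length xs" "set xs \<subseteq> TB" shows "m (length xs) xs \<in> TB"
proof (cases "length xs \<le> 3")
  case True
  show ?thesis
    using assms(2) by (rule_tac length_cases_123[OF assms(1) True])
      (auto simp: realizes_simps m1_total m2_total M_total numeral_2_eq_2[symmetric] numeral_3_eq_3[symmetric])
next
  case False
  then show ?thesis using realizes_ge_4[of "length xs" xs] assms by simp
qed

lemma m_0: "m1 0 = 0" "y \<in> TB \<Longrightarrow> m2 0 y = 0" "y \<in> TB \<Longrightarrow> m2 y 0 = 0"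
  "y \<in> TB \<Longrightarrow> z \<in> TB \<Longrightarrow> M 0 y z = 0"
  "y \<in> TB \<Longrightarrow> z \<in> TB \<Longrightarrow> M y 0 z = 0"
  "y \<in> TB \<Longrightarrow> z \<in> TB \<Longrightarrow> M y z 0 = 0"
  by (auto simp: zero_prod_def m1_B m2_B total_B TD_lin)

lemma realizes_insert_0:
  assumes "set us \<subseteq> TB" "set vs \<subseteq> TB"
  shows "m (length us + 1 + length vs) (us @ [0] @ vs) = 0"
proof (cases "length us + 1 + length vs \<le> 3")
  case True
  then consider "us = []" "vs = []" | x where "us = [x]" "vs = []" | x where "us = []" "vs = [x]"
    | x y where "us = [x, y]" "vs = []" | x y where "us = [x]" "vs = [y]" | x y where "us = []" "vs = [x, y]"
    by (cases us; cases "tl us"; cases vs; cases "tl vs") auto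
  then show ?thesis
    by cases (use assms in \<open>auto simp: realizes_simps m_0 numeral_2_eq_2[symmetric] numeral_3_eq_3[symmetric]\<close>)
next
  case False
  then show ?thesis using assms by (intro realizes_ge_4) auto
qed

text \<open>An operation of arity at least four vanishes. If it is the inner one, the outer
  operation receives a zero argument and vanishes by linearity.\<close>

lemma stasheff_term_0:
  assumes "length xs = n" "hlist B xs" "(r, s, t) \<in> stasheff_set n" "s \<ge> 4 \<or> r + 1 + t \<ge> 4"
  shows "stasheff_term m xs (r, s, t) = 0"
proof -
  have tot: "\<And>p. p \<in> set xs \<Longrightarrow> snd p \<in> TB"
    using assms(2) B.total_grd by (fastforce simp: hlist_def)
  have n: "r + s + t = n" "s \<ge> 1" using assms(3) by (auto simp: stasheff_set_def)
  have 1: "set (map snd (take r xs)) \<subseteq> TB" "set (map snd (drop (r + s) xs)) \<subseteq> TB"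
    "set (map snd (take s (drop r xs))) \<subseteq> TB"
    unfolding set_map image_subset_iff by (blast dest: in_set_takeD in_set_dropD intro: tot)+
  have 2: "length (map snd (take r xs)) = r" "length (map snd (drop (r + s) xs)) = t"
    "length (map snd (take s (drop r xs))) = s" using n assms(1) by auto
  have "m (r + 1 + t) (map snd (take r xs) @ [m s (map snd (take s (drop r xs)))] @ map snd (drop (r + s) xs)) = 0"
  proof (cases "s \<ge> 4")
    case True
    then have "m s (map snd (take s (drop r xs))) = 0" using 1 2 by (intro realizes_ge_4)
    then show ?thesis using realizes_insert_0[OF 1(1,2)] unfolding 2 by simp
  next
    case False
    then have "r + 1 + t \<ge> 4" using assms by auto
    moreover have "m s (map snd (take s (drop r xs))) \<in> TB"
      using realizes_total[of "map snd (take s (drop r xs))"] 1 2 n(2) by simp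
    ultimately show ?thesis using 1 2 by (intro realizes_ge_4) auto
  qed
  then show ?thesis by (simp add: stasheff_term_def)
qed

text \<open>\<open>T\<close> is meant to be an explicit list of the triples in which both arities
  are at most three, over which the sum can be expanded by simplification.\<close>

lemma stasheff_sum_subset:
  assumes "length xs = n" "hlist B xs" "T \<subseteq> stasheff_set n"
    and "\<And>r s t. (r, s, t) \<in> stasheff_set n \<Longrightarrow> s < 4 \<Longrightarrow> r + 1 + t < 4 \<Longrightarrow> (r, s, t) \<in> T"
  shows "(\<Sum>p\<in>stasheff_set n. stasheff_term m xs p) = (\<Sum>p\<in>T. stasheff_term m xs p)"
proof (rule sum.mono_neutral_right[OF finite_stasheff_set assms(3)], rule ballI)
  fix p assume p: "p \<in> stasheff_set n - T"
  obtain r s t where [simp]: "p = (r, s, t)" by (cases p)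
  show "stasheff_term m xs p = 0"
    using stasheff_term_0[OF assms(1,2), of r s t] p assms(4)[of r s t] by force
qed

lemma stasheff_set_cases:
  "(r, s, t) \<in> stasheff_set 3 \<Longrightarrow> (r, s, t) \<in> {(0, 3, 0), (0, 2, 1), (1, 2, 0), (0, 1, 2), (1, 1, 1), (2, 1, 0)}"
  "(r, s, t) \<in> stasheff_set 4 \<Longrightarrow> s < 4 \<Longrightarrow> r + 1 + t < 4 \<Longrightarrow>
    (r, s, t) \<in> {(0, 3, 1), (1, 3, 0), (0, 2, 2), (1, 2, 1), (2, 2, 0)}"
  "(r, s, t) \<in> stasheff_set 5 \<Longrightarrow> s < 4 \<Longrightarrow> r + 1 + t < 4 \<Longrightarrow> (r, s, t) \<in> {(0, 3, 2), (1, 3, 1), (2, 3, 0)}"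
  unfolding stasheff_set_def mem_Collect_eq prod.case insert_iff prod.inject empty_iff by presburger+

lemma stasheff_1:
  assumes "x \<in> G i"
  shows "(\<Sum>p\<in>stasheff_set 1. stasheff_term m [(i, x)] p) = m1 (m1 x)"
proof -
  have "(\<Sum>p\<in>stasheff_set 1. stasheff_term m [(i, x)] p) = (\<Sum>p\<in>{(0, 1, 0)}. stasheff_term m [(i, x)] p)"
    by (rule stasheff_sum_subset) (use assms in \<open>auto simp: hlist_def stasheff_set_def\<close>)
  then show ?thesis
    using assms by (simp add: stasheff_term_def realizes_simps B.total_grd m1_total)
qed

lemma stasheff_2:
  assumes "x \<in> G i" "y \<in> G j"
  shows "(\<Sum>p\<in>stasheff_set 2. stasheff_term m [(i, x), (j, y)] p) =
    m1 (m2 x y) - (m2 (m1 x) y + ksg i (m2 x (m1 y)))"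
proof -
  let ?t = "stasheff_term m [(i, x), (j, y)]"
  have "(\<Sum>p\<in>stasheff_set 2. ?t p) = (\<Sum>p\<in>{(0, 2, 0), (0, 1, 1), (1, 1, 0)}. ?t p)"
    by (rule stasheff_sum_subset) (use assms in \<open>auto simp: hlist_def stasheff_set_def\<close>)
  then show ?thesis
    using B.total_grd[OF assms(1)] B.total_grd[OF assms(2)]
    by (simp add: stasheff_term_def realizes_simps m1_total m2_total numeral_2_eq_2[symmetric])
      (simp add: ksg_def)
qed

text \<open>The associator of \<open>m2\<close> is kept apart because it vanishes on its own; the
  remaining terms are the ones paired in \<open>stasheff_form3\<close>.\<close>

lemma stasheff_3:
  assumes "x \<in> G i" "y \<in> G j" "z \<in> G k"
  shows "(\<Sum>p\<in>stasheff_set 3. stasheff_term m [(i, x), (j, y), (k, z)] p) =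
    (m2 (m2 x y) z - m2 x (m2 y z)) +
    (m1 (M x y z) + M (m1 x) y z + ksg i (M x (m1 y) z) + ksg (i + j) (M x y (m1 z)))"
proof -
  let ?t = "stasheff_term m [(i, x), (j, y), (k, z)]"
  have "(\<Sum>p\<in>stasheff_set 3. ?t p) =
      (\<Sum>p\<in>{(0, 3, 0), (0, 2, 1), (1, 2, 0), (0, 1, 2), (1, 1, 1), (2, 1, 0)}. ?t p)"
    by (rule stasheff_sum_subset[OF _ _ _ stasheff_set_cases(1)])
      (simp_all add: hlist_def assms stasheff_set_def)
  then show ?thesis
    using B.total_grd[OF assms(1)] B.total_grd[OF assms(2)] B.total_grd[OF assms(3)]
    by (simp add: stasheff_term_def realizes_simps m1_total m2_total M_total
        numeral_2_eq_2[symmetric] numeral_3_eq_3[symmetric])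
      (simp add: ksg_def)
qed

lemma stasheff_4:
  assumes "x \<in> G i" "y \<in> G j" "z \<in> G k" "u \<in> G l"
  shows "(\<Sum>p\<in>stasheff_set 4. stasheff_term m [(i, x), (j, y), (k, z), (l, u)] p) =
    - m2 (M x y z) u + ksg (1 + i) (m2 x (M y z u)) + M (m2 x y) z u - M x (m2 y z) u + M x y (m2 z u)"
proof -
  let ?t = "stasheff_term m [(i, x), (j, y), (k, z), (l, u)]"
  have "(\<Sum>p\<in>stasheff_set 4. ?t p) =
      (\<Sum>p\<in>{(0, 3, 1), (1, 3, 0), (0, 2, 2), (1, 2, 1), (2, 2, 0)}. ?t p)"
    by (rule stasheff_sum_subset[OF _ _ _ stasheff_set_cases(2)])
      (simp_all add: hlist_def assms stasheff_set_def)
  then show ?thesis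
    using B.total_grd[OF assms(1)] B.total_grd[OF assms(2)] B.total_grd[OF assms(3)] B.total_grd[OF assms(4)]
    by (simp add: stasheff_term_def realizes_simps m1_total m2_total M_total
        numeral_2_eq_2[symmetric] numeral_3_eq_3[symmetric])
      (simp add: ksg_def)
qed

lemma stasheff_5:
  assumes "x \<in> G i" "y \<in> G j" "z \<in> G k" "u \<in> G l" "v \<in> G n"
  shows "(\<Sum>p\<in>stasheff_set 5. stasheff_term m [(i, x), (j, y), (k, z), (l, u), (n, v)] p) =
    M (M x y z) u v + ksg i (M x (M y z u) v) + ksg (i + j) (M x y (M z u v))"
proof -
  let ?t = "stasheff_term m [(i, x), (j, y), (k, z), (l, u), (n, v)]"
  have "(\<Sum>p\<in>stasheff_set 5. ?t p) = (\<Sum>p\<in>{(0, 3, 2), (1, 3, 1), (2, 3, 0)}. ?t p)"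
    by (rule stasheff_sum_subset[OF _ _ _ stasheff_set_cases(3)])
      (simp_all add: hlist_def assms stasheff_set_def)
  then show ?thesis
    using B.total_grd[OF assms(1)] B.total_grd[OF assms(2)] B.total_grd[OF assms(3)] B.total_grd[OF assms(4)]
      B.total_grd[OF assms(5)]
    by (simp add: stasheff_term_def realizes_simps m1_total m2_total M_total
        numeral_2_eq_2[symmetric] numeral_3_eq_3[symmetric])
      (simp add: ksg_def)
qed

text \<open>If both arities are at most three, then s is at most 3 and r + t at most 2, so a
  surviving triple has sum at most five.\<close>

lemma stasheff_ge_6:
  assumes "n \<ge> 6" "length xs = n" "hlist B xs"
  shows "(\<Sum>p\<in>stasheff_set n. stasheff_term m xs p) = 0"
proof -
  have "(\<Sum>p\<in>stasheff_set n. stasheff_term m xs p) = (\<Sum>p\<in>{}. stasheff_term m xs p)"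
    by (rule stasheff_sum_subset) (use assms in \<open>auto simp: stasheff_set_def\<close>)
  then show ?thesis by simp
qed

lemma \<gamma>_stasheff_3:
  assumes "x \<in> G i" "y \<in> G j" "z \<in> G k" "w \<in> TB"
  shows "\<gamma> (\<Sum>p\<in>stasheff_set 3. stasheff_term m [(i, x), (j, y), (k, z)] p) w = stasheff_form3 i j x y z w"
  using B.total_grd[OF assms(1)] B.total_grd[OF assms(2)] B.total_grd[OF assms(3)] assms(4)
  by (simp add: stasheff_3[OF assms(1-3)] m2_assoc stasheff_form3_def \<gamma>_add_left \<gamma>_ksg_left
      B.total_add B.total_ksg m1_total M_total)

lemma \<gamma>_stasheff_4:
  assumes "x \<in> G i" "y \<in> G j" "z \<in> G k" "u \<in> G l" "w \<in> TB"
  shows "\<gamma> (\<Sum>p\<in>stasheff_set 4. stasheff_term m [(i, x), (j, y), (k, z), (l, u)] p) w = stasheff_form4 i x y z u w"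
  using B.total_grd[OF assms(1)] B.total_grd[OF assms(2)] B.total_grd[OF assms(3)] B.total_grd[OF assms(4)] assms(5)
  unfolding stasheff_4[OF assms(1-4)]
  by (simp add: stasheff_form4_def \<gamma>_add_left \<gamma>_ksg_left \<gamma>_minus_left
      B.total_add B.total_ksg B.total_minus \<gamma>_diff_left B_total_diff m2_total M_total)

lemma \<gamma>_stasheff_5:
  assumes "x \<in> G i" "y \<in> G j" "z \<in> G k" "u \<in> G l" "v \<in> G n" "w \<in> TB"
  shows "\<gamma> (\<Sum>p\<in>stasheff_set 5. stasheff_term m [(i, x), (j, y), (k, z), (l, u), (n, v)] p) w = stasheff_form5 i j x y z u v w"
  using B.total_grd[OF assms(1)] B.total_grd[OF assms(2)] B.total_grd[OF assms(3)] B.total_grd[OF assms(4)]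
    B.total_grd[OF assms(5)] assms(6)
  by (simp add: stasheff_5[OF assms(1-5)] stasheff_form5_def \<gamma>_add_left \<gamma>_ksg_left
      B.total_add B.total_ksg m1_total M_total)

lemma stasheff_total:
  assumes "length xs = n" "hlist B xs"
  shows "(\<Sum>p\<in>stasheff_set n. stasheff_term m xs p) \<in> TB"
proof (rule B.total_sum)
  fix p assume p: "p \<in> stasheff_set n"
  obtain r s t where [simp]: "p = (r, s, t)" by (cases p)
  show "stasheff_term m xs p \<in> TB"
  proof (cases "s \<ge> 4 \<or> r + 1 + t \<ge> 4")
    case True
    then show ?thesis using stasheff_term_0[OF assms, of r s t] p by simp
  next
    case False
    have tot: "\<And>p. p \<in> set xs \<Longrightarrow> snd p \<in> TB"
    using assms(2) B.total_grd by (fastforce simp: hlist_def)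
    have n: "r + s + t = n" "s \<ge> 1" using p by (auto simp: stasheff_set_def)
    have sub: "set (map snd (take s (drop r xs))) \<subseteq> TB" "set (map snd (take r xs)) \<subseteq> TB"
      "set (map snd (drop (r + s) xs)) \<subseteq> TB"
      unfolding set_map image_subset_iff by (blast dest: in_set_takeD in_set_dropD intro: tot)+
    have "length (map snd (take s (drop r xs))) = s" using n assms(1) by simp
    then have "m s (map snd (take s (drop r xs))) \<in> TB"
      using realizes_total[OF _ sub(1)] n(2) by simp
    moreover define ys where
      "ys = map snd (take r xs) @ [m s (map snd (take s (drop r xs)))] @ map snd (drop (r + s) xs)"
    ultimately have "set ys \<subseteq> TB" using sub by auto
    moreover have "length ys = r + 1 + t" using n assms(1) by (simp add: ys_def)
    ultimately have "m (r + 1 + t) ys \<in> TB" using realizes_total[of ys] by simp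
    then show ?thesis by (simp add: stasheff_term_def ys_def B.total_ksg)
  qed
qed

text \<open>One and two arguments give the dg algebra identities of the square-zero extension. For
  three to five, the sum is paired with an arbitrary homogeneous element and vanishes by
  nondegeneracy.\<close>

lemma stasheff_identities:
  assumes stasheff_word3 stasheff_word4 stasheff_word5 "n \<ge> 1" and xs: "length xs = n" "hlist B xs"
  shows "(\<Sum>p\<in>stasheff_set n. stasheff_term m xs p) = 0"
proof -
  consider "n = 1" | "n = 2" | "n = 3" | "n = 4" | "n = 5" | "n \<ge> 6" using assms(4) by linarith
  then show ?thesis
  proof cases
    case 1
    then obtain i x where "xs = [(i, x)]" "x \<in> G i"
      using xs by (auto simp: length_Suc_conv hlist_def)
    then show ?thesis using stasheff_1 1 m1_m1 B.total_grd by simp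
  next
    case 2
    then obtain i x j y where "xs = [(i, x), (j, y)]" "x \<in> G i" "y \<in> G j"
      using xs by (auto simp: length_Suc_conv hlist_def numeral_2_eq_2)
    then show ?thesis using stasheff_2 2 m1_m2 by simp
  next
    case 3
    then obtain i x j y k z where e: "xs = [(i, x), (j, y), (k, z)]" "x \<in> G i" "y \<in> G j" "z \<in> G k"
      using xs by (auto simp: length_Suc_conv hlist_def numeral_3_eq_3)
    show ?thesis
      by (rule \<gamma>_hom_separates[OF stasheff_total[OF xs]])
        (use stasheff_form3_eq_0[OF assms(1)] e 3 B.total_grd in \<open>simp add: \<gamma>_stasheff_3\<close>)
  next
    case 4
    then obtain i x j y k z l u where
      e: "xs = [(i, x), (j, y), (k, z), (l, u)]" "x \<in> G i" "y \<in> G j" "z \<in> G k" "u \<in> G l"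
      using xs by (auto simp: length_Suc_conv hlist_def eval_nat_numeral)
    show ?thesis
      by (rule \<gamma>_hom_separates[OF stasheff_total[OF xs]])
        (use stasheff_form4_eq_0[OF assms(2)] e 4 B.total_grd in \<open>simp add: \<gamma>_stasheff_4\<close>)
  next
    case 5
    then obtain i x j y k z l u r v where
      e: "xs = [(i, x), (j, y), (k, z), (l, u), (r, v)]" "x \<in> G i" "y \<in> G j" "z \<in> G k" "u \<in> G l" "v \<in> G r"
      using xs by (auto simp: length_Suc_conv hlist_def eval_nat_numeral)
    show ?thesis
      by (rule \<gamma>_hom_separates[OF stasheff_total[OF xs]])
        (use stasheff_form5_eq_0[OF assms(3)] e 5 B.total_grd in \<open>simp add: \<gamma>_stasheff_5\<close>)
  qed (use xs in \<open>simp add: stasheff_ge_6\<close>)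
qed

lemma base_identities:
  assumes "\<And>n xs. n \<ge> 1 \<Longrightarrow> length xs = n \<Longrightarrow> hlist B xs \<Longrightarrow> (\<Sum>p\<in>stasheff_set n. stasheff_term m xs p) = 0"
  shows stasheff_word3 stasheff_word4 stasheff_word5
proof -
  have z: "w \<in> TB \<Longrightarrow> \<gamma> 0 w = 0" for w
    by (cases w) (simp add: zero_prod_def total_B nat_form_eq lin_0 TD_lin)
  show stasheff_word3
    unfolding stasheff_word3_def
  proof (intro allI ballI)
    fix j q i p b g a f assume h: "b \<in> grd A j" "g \<in> D q" "a \<in> grd A i" "f \<in> D p"
    have G: "(b, 0) \<in> G j" "(0, g) \<in> G (q - d + 1)" "(a, 0) \<in> G i" "(0, f) \<in> G (p - d + 1)"
      using h by (simp_all add: grd_B)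
    show "stasheff_form3 j (q - d + 1) (b, 0) (0, g) (a, 0) (0, f) = 0"
      using \<gamma>_stasheff_3[OF G(1-3) B.total_grd[OF G(4)]] G B.total_grd[OF G(4)]
      by (subst (asm) assms) (auto simp: hlist_def z)
  qed
  show stasheff_word4
    unfolding stasheff_word4_def
  proof (intro allI ballI)
    fix j l q i p b c g a f assume h: "b \<in> grd A j" "c \<in> grd A l" "g \<in> D q" "a \<in> grd A i" "f \<in> D p"
    have G: "(b, 0) \<in> G j" "(c, 0) \<in> G l" "(0, g) \<in> G (q - d + 1)" "(a, 0) \<in> G i" "(0, f) \<in> G (p - d + 1)"
      using h by (simp_all add: grd_B)
    show "stasheff_form4 j (b, 0) (c, 0) (0, g) (a, 0) (0, f) = 0"
      using \<gamma>_stasheff_4[OF G(1-4) B.total_grd[OF G(5)]] G B.total_grd[OF G(5)]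
      by (subst (asm) assms) (auto simp: hlist_def z)
  qed
  show stasheff_word5
    unfolding stasheff_word5_def
  proof (intro allI ballI)
    fix l r j q i p c h b g a f
    assume h: "c \<in> grd A l" "h \<in> D r" "b \<in> grd A j" "g \<in> D q" "a \<in> grd A i" "f \<in> D p"
    have G: "(c, 0) \<in> G l" "(0, h) \<in> G (r - d + 1)" "(b, 0) \<in> G j" "(0, g) \<in> G (q - d + 1)" "(a, 0) \<in> G i"
      "(0, f) \<in> G (p - d + 1)"
      using h by (simp_all add: grd_B)
    show "stasheff_form5 l (r - d + 1) (c, 0) (0, h) (b, 0) (0, g) (a, 0) (0, f) = 0"
      using \<gamma>_stasheff_5[OF G(1-5) B.total_grd[OF G(6)]] G B.total_grd[OF G(6)]
      by (subst (asm) assms) (auto simp: hlist_def z)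
  qed
qed

end

end

context dga
begin

text \<open>If the values in all other degrees vanish, a representation of \<open>T\<close> can be
  truncated to the summands of total degree \<open>e\<close> without changing any value on
  homogeneous functionals, hence without changing \<open>T\<close>.\<close>

lemma tpow_deg_iff:
  assumes T: "T \<in> tpow A 2"
  shows "T \<in> tpow_deg A 2 e \<longleftrightarrow> (\<forall>p q. \<forall>f \<in> D p. \<forall>g \<in> D q. p + q + e \<noteq> 0 \<longrightarrow> T [f, g] = 0)"
proof
  assume "T \<in> tpow_deg A 2 e"
  then obtain L where L: "trep A 2 T L" "\<forall>xs \<in> set L. sum_list (map fst xs) = e"
    by (auto simp: tpow_deg_def)
  show "\<forall>p q. \<forall>f \<in> D p. \<forall>g \<in> D q. p + q + e \<noteq> 0 \<longrightarrow> T [f, g] = 0"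
  proof (intro allI ballI impI)
    fix p q f g assume f: "f \<in> D p" and g: "g \<in> D q" and pq: "p + q + e \<noteq> 0"
    have "T [f, g] = (\<Sum>xs\<leftarrow>L. ptens A (map snd xs) [f, g])"
      using L by (simp add: trep_def sum_list_fun_apply)
    also have "\<dots> = (\<Sum>xs\<leftarrow>L. 0)"
    proof (intro arg_cong[where f = sum_list] map_cong refl)
      fix xs assume xs: "xs \<in> set L"
      then have "length xs = 2" "hlist A xs" "sum_list (map fst xs) = e" using L by (auto simp: trep_def)
      then obtain i u j v where "xs = [(i, u), (j, v)]" "u \<in> grd A i" "v \<in> grd A j" "i + j = e"
        by (auto simp: length_Suc_conv numeral_2_eq_2 hlist_def)
      moreover from this have "i + p \<noteq> 0 \<or> j + q \<noteq> 0" using pq by linarith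
      ultimately show "ptens A (map snd xs) [f, g] = 0"
        using D_zero[OF f, of u i] D_zero[OF g, of v j] by (auto simp: D_lin[OF f] D_lin[OF g])
    qed
    finally show "T [f, g] = 0" by simp
  qed
next
  assume z: "\<forall>p q. \<forall>f \<in> D p. \<forall>g \<in> D q. p + q + e \<noteq> 0 \<longrightarrow> T [f, g] = 0"
  obtain Q where Q: "quads Q T" using quadsE[OF T] .
  define Q' where "Q' = filter (\<lambda>(i, u, j, v). i + j = e) Q"
  define T' where "T' = (\<Sum>(i, u, j, v) \<leftarrow> Q'. ptens A [u, v])"
  have Q': "quads Q' T'" using Q by (auto simp: quads_def Q'_def T'_def)
  have "T = T'"
  proof (rule tens2_ext[OF T quads_tpow[OF Q']])
    fix p q f g assume f: "f \<in> D p" and g: "g \<in> D q"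
    note lin = D_lin[OF f] D_lin[OF g]
    have T: "T [f, g] = (\<Sum>(i, u, j, v)\<leftarrow>Q. f u * g v)" by (rule quads_apply[OF Q lin])
    have T': "T' [f, g] = (\<Sum>(i, u, j, v)\<leftarrow>Q. if i + j = e then f u * g v else 0)"
      unfolding quads_apply[OF Q' lin] Q'_def by (induction Q) auto
    show "T [f, g] = T' [f, g]"
    proof (cases "p + q + e = 0")
      case True
      show ?thesis unfolding T T'
      proof (rule sum_list_split_cong)
        fix i u j v assume "(i, u, j, v) \<in> set Q"
        then have uv: "u \<in> grd A i" "v \<in> grd A j" using quads_in[OF Q] by blast+
        show "f u * g v = (if i + j = e then f u * g v else 0)"
        proof (cases "i + p = 0 \<and> j + q = 0")
          case False
          then show ?thesis using D_zero[OF f uv(1)] D_zero[OF g uv(2)] by auto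
        next
          case ij: True
          then have "i + j = e" using True by linarith
          then show ?thesis by simp
        qed
      qed
    next
      case False
      have "T' [f, g] = (\<Sum>(i, u, j, v)\<leftarrow>Q. 0)"
        unfolding T'
      proof (rule sum_list_split_cong)
        fix i u j v assume "(i, u, j, v) \<in> set Q"
        then have uv: "u \<in> grd A i" "v \<in> grd A j" using quads_in[OF Q] by blast+
        have "i + p \<noteq> 0 \<or> j + q \<noteq> 0 \<or> i + j \<noteq> e" using False by linarith
        then show "(if i + j = e then f u * g v else 0) = 0"
          using D_zero[OF f uv(1)] D_zero[OF g uv(2)] by auto
      qed
      then show ?thesis using z f g False by (simp add: split_def)
    qed
  qed
  moreover have "T' = (\<Sum>xs\<leftarrow>map (\<lambda>(i, u, j, v). [(i, u), (j, v)]) Q'. ptens A (map snd xs))"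
    by (simp add: T'_def comp_def split_def)
  then have "trep A 2 T' (map (\<lambda>(i, u, j, v). [(i, u), (j, v)]) Q')"
    using Q' by (fastforce simp: trep_def quads_def hlist_def)
  then have "T' \<in> tpow_deg A 2 e" by (force simp: tpow_deg_def Q'_def)
  ultimately show "T \<in> tpow_deg A 2 e" by simp
qed

end

context m3_operation
begin

section \<open>The bracket attached to the ternary operation\<close>

text \<open>The exponent \<open>p * q\<close> removes the Koszul sign contained in \<open>fun_tens\<close>.\<close>

definition bracket :: "('a \<Rightarrow> 'a \<Rightarrow> ('k, 'a) tens) \<Rightarrow> bool" where
  "bracket br \<longleftrightarrow> bilinear_into_tens2 A br \<and>
     (\<forall>i j p q. \<forall>a \<in> grd A i. \<forall>b \<in> grd A j. \<forall>f \<in> D p. \<forall>g \<in> D q.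
        br a b [f, g] = sg (p * q + j * (i + q + 1)) * f (\<theta> (X b g a)))"

lemma eval_zero:
  assumes "a \<in> grd A i" "b \<in> grd A j" "f \<in> D p" "g \<in> D q" "i + j + p + q \<noteq> d"
  shows "f (\<theta> (X b g a)) = 0"
  using D_zero[OF assms(3) \<theta>_grd[OF X_grd[OF assms(2,4,1)]]] assms(5) by simp

lemma \<theta>_minus: "\<theta> (- x) = - \<theta> x"
  using \<theta>_scale[of "- 1" x] by simp

lemma eval_\<theta>: "a \<in> grd A i \<Longrightarrow> f \<in> D p \<Longrightarrow> f (\<theta> a) = sg (d * i) * f a"
  by (simp add: \<theta>_hom lin_ksg[OF D_lin])

text \<open>Two rotations, the first from X to Y and the second back to X. This is the skew-symmetry
  of the bracket before the sign of the bracket formula is inserted.\<close>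

lemma eval_skew:
  assumes a: "a \<in> grd A i" and b: "b \<in> grd A j" and f: "f \<in> D p" and g: "g \<in> D q"
  shows "f (\<theta> (X b g a)) = sg ((p - d + 1) * (j + q - d + 1 + i) + i * (p - d + 1 + j + q - d + 1)) * g (\<theta> (X a f b))"
proof -
  have f': "f \<in> D (p - d + 1 + d - 1)" and g': "g \<in> D (q - d + 1 + d - 1)" using f g by simp_all
  show ?thesis
    unfolding cyc1[OF b g' a f'] cyc2[OF f' b g' a]
    by (simp add: sg_add[symmetric] mult.assoc[symmetric] del: mult.assoc)
      (rule disjI2, rule sg_eqI, auto)
qed

context
  fixes br assumes br: "bracket br"
begin

lemma bracket_bilinear: "bilinear_into_tens2 A br"
  using br by (simp add: bracket_def)

lemmas bracket_tens = bilinear_tens[OF bracket_bilinear]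

lemma bracket_apply:
  "a \<in> grd A i \<Longrightarrow> b \<in> grd A j \<Longrightarrow> f \<in> D p \<Longrightarrow> g \<in> D q \<Longrightarrow>
   br a b [f, g] = sg (p * q + j * (i + q + 1)) * f (\<theta> (X b g a))"
  using br by (auto simp: bracket_def)

lemma bracket_deg:
  assumes "a \<in> grd A i" "b \<in> grd A j" shows "br a b \<in> tpow_deg A 2 (i + j - d)"
  unfolding tpow_deg_iff[OF bracket_tens(1)]
  using bracket_apply[OF assms] eval_zero[OF assms] by auto

lemma bracket_skew:
  assumes a: "a \<in> grd A i" and b: "b \<in> grd A j"
  shows "- ksg ((i - d) * (j - d)) (br b a) = flip A (br a b)"
proof (rule tens2_ext)
  show "flip A (br a b) \<in> tpow A 2" by (rule flip_tpow[OF bracket_tens(1)])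
  show "- ksg ((i - d) * (j - d)) (br b a) \<in> tpow A 2"
    using tpow_minus[of _ 1] tpow2_ksg[OF bracket_tens(1)] by (simp add: numeral_2_eq_2)
  fix p q f g assume f: "f \<in> D p" and g: "g \<in> D q"
  show "(- ksg ((i - d) * (j - d)) (br b a)) [f, g] = flip A (br a b) [f, g]"
  proof (cases "i + j + p + q = d")
    case True
    then have p: "p = d - i - j - q" by simp
    show ?thesis
      by (simp add: flip_apply[OF bracket_tens(1) f g] bracket_apply[OF a b g f] bracket_apply[OF b a f g]
          eval_skew[OF b a f g] ksg_fun_apply ksg_field)
        (auto simp: sg_def p)
  next
    case False
    then show ?thesis
      using eval_zero[OF a b g f] eval_zero[OF b a f g]
      by (simp add: flip_apply[OF bracket_tens(1) f g] bracket_apply[OF a b g f] bracket_apply[OF b a f g]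
          ksg_fun_apply ksg_field)
  qed
qed

text \<open>The defect of compatibility with the differential. Its four terms correspond one by one
  to those of the form: the differential meets f on the outer side, and b, g or a on the inner
  side.\<close>

lemma bracket_dif_eval:
  assumes a: "a \<in> grd A i" and b: "b \<in> grd A j" and f: "f \<in> D p" and g: "g \<in> D q"
  shows "dif2 A (br a b) [f, g] - (br (dif A a) b [f, g] + sg (i - d) * br a (dif A b) [f, g]) =
    sg (p * q + j * (i + q) + q + j + d) * stasheff_form3 j (q - d + 1) (b, 0) (0, g) (a, 0) (0, f)"
proof -
  note df = D_dif[OF f] and dg = D_dif[OF g] and da = dif_A_grd[OF a] and db = dif_A_grd[OF b]
  let ?F = "\<lambda>f b g a. f (\<theta> (X b g a))"
  \<comment> \<open>The differential raises the degree by one, so it commutes with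
    \<open>\<theta>\<close> up to the sign of d.\<close>
  have t: "\<theta> (dif A x) = ksg d (dif A (\<theta> x))" for x
    by (induction x rule: A_hom_induct)
      (simp_all add: \<theta>_add ksg_add \<theta>_hom \<theta>_hom[OF dif_A_grd] dif_A_ksg algebra_simps)
  have 1: "f (\<theta> (dif A (X b g a))) = sg d * ?F (\<lambda>x. f (dif A x)) b g a"
    by (simp add: t lin_ksg[OF D_lin[OF f]])
  have g': "g \<in> D (q - d + 1 + d - 1)" using g by simp
  have 2: "X b (\<lambda>x. - sg (q - d + 1) * g (dif A x)) a = smul A (- sg (q - d + 1)) (X b (\<lambda>x. g (dif A x)) a)"
    by (rule X_scale(2)[OF D.total_grd[OF dg]])
  have "\<gamma> (m1 (M (b, 0) (0, g) (a, 0))) (0, f) = sg d * ?F (\<lambda>x. f (dif A x)) b g a"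
    using D.total_grd[OF f] 1 by (simp add: m1_B)
  moreover have "\<gamma> (M (m1 (b, 0)) (0, g) (a, 0)) (0, f) = ?F f (dif A b) g a"
    using D.total_grd[OF f] D.total_grd[OF g] by (simp add: m1_B)
  moreover have "\<gamma> (M (b, 0) (m1 (0, g)) (a, 0)) (0, f) = - sg (q - d + 1) * ?F f b (\<lambda>x. g (dif A x)) a"
    unfolding m1_hom[OF g', of 0] M_eq 2 using D.total_grd[OF f]
    by (simp add: nat_form_eq \<theta>_scale lin_scale[OF D_lin[OF f]] lin_minus[OF D_lin[OF f]] \<theta>_minus)
  moreover have "\<gamma> (M (b, 0) (0, g) (m1 (a, 0))) (0, f) = ?F f b g (dif A a)"
    using D.total_grd[OF f] D.total_grd[OF g] by (simp add: m1_B)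
  ultimately have psi: "stasheff_form3 j (q - d + 1) (b, 0) (0, g) (a, 0) (0, f) = sg d * ?F (\<lambda>x. f (dif A x)) b g a
      + ?F f (dif A b) g a - sg (j + (q - d + 1)) * ?F f b (\<lambda>x. g (dif A x)) a
      + sg (j + (q - d + 1)) * ?F f b g (dif A a)"
    unfolding stasheff_form3_def sg_add[of j] by simp
  show ?thesis
  proof (cases "i + j + p + q + 1 = d")
    case True
    then have p: "p = d - 1 - i - j - q" by simp
    show ?thesis
      unfolding psi dif2_apply[OF bracket_tens(1) f g] bracket_apply[OF a b df g] bracket_apply[OF a b f dg]
        bracket_apply[OF da b f g] bracket_apply[OF a db f g]
      by (auto simp: sg_def p)
  next
    case False
    then show ?thesis
      unfolding psi dif2_apply[OF bracket_tens(1) f g] bracket_apply[OF a b df g] bracket_apply[OF a b f dg]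
        bracket_apply[OF da b f g] bracket_apply[OF a db f g]
      using eval_zero[OF a b df g] eval_zero[OF a b f dg] eval_zero[OF da b f g] eval_zero[OF a db f g]
      by simp
  qed
qed

lemma bracket_dif_iff:
  "(\<forall>i j. \<forall>a \<in> grd A i. \<forall>b \<in> grd A j.
      dif2 A (br a b) = br (dif A a) b + ksg (i - d) (br a (dif A b))) \<longleftrightarrow> stasheff_word3"
proof
  assume *: "\<forall>i j. \<forall>a \<in> grd A i. \<forall>b \<in> grd A j.
      dif2 A (br a b) = br (dif A a) b + ksg (i - d) (br a (dif A b))"
  show stasheff_word3
    unfolding stasheff_word3_def
  proof (intro allI ballI)
    fix j q i p b g a f assume h: "b \<in> grd A j" "g \<in> D q" "a \<in> grd A i" "f \<in> D p"
    have "dif2 A (br a b) = br (dif A a) b + ksg (i - d) (br a (dif A b))" using * h by blast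
    then show "stasheff_form3 j (q - d + 1) (b, 0) (0, g) (a, 0) (0, f) = 0"
      using bracket_dif_eval[OF h(3,1,4,2)] by (simp add: ksg_fun_apply ksg_field)
  qed
next
  assume *: stasheff_word3
  show "\<forall>i j. \<forall>a \<in> grd A i. \<forall>b \<in> grd A j.
      dif2 A (br a b) = br (dif A a) b + ksg (i - d) (br a (dif A b))"
  proof (intro allI ballI)
    fix i j a b assume a: "a \<in> grd A i" and b: "b \<in> grd A j"
    show "dif2 A (br a b) = br (dif A a) b + ksg (i - d) (br a (dif A b))"
    proof (rule tens2_ext)
      fix p q f g assume f: "f \<in> D p" and g: "g \<in> D q"
      have "stasheff_form3 j (q - d + 1) (b, 0) (0, g) (a, 0) (0, f) = 0" using * a b f g by (simp add: stasheff_word3_def)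
      then show "dif2 A (br a b) [f, g] = (br (dif A a) b + ksg (i - d) (br a (dif A b))) [f, g]"
        using bracket_dif_eval[OF a b f g] by (simp add: ksg_fun_apply ksg_field)
    qed (intro dif2_tpow tpow_add tpow2_ksg bracket_tens(1))+
  qed
qed

text \<open>On this word two of the five terms vanish, because \<open>M\<close> would be applied to
  a word that does not alternate. In the other three, the product bc stands in the first argument, c
  acts on g from the left, and b multiplies the value of X. These are the three terms of the Leibniz
  rule.\<close>

lemma bracket_leibniz_eval:
  assumes a: "a \<in> grd A i" and b: "b \<in> grd A j" and c: "c \<in> grd A l" and f: "f \<in> D p" and g: "g \<in> D q"
  shows "br a (mul A b c) [f, g] - (br a b [f, \<lambda>y. g (mul A y c)] + sg ((i - d) * j) * br a c [\<lambda>y. f (mul A b y), g]) =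
    sg (p * q + (j + l) * (i + q + 1)) * stasheff_form4 j (b, 0) (c, 0) (0, g) (a, 0) (0, f)"
proof -
  note fb = D_lmul[OF f b] and gc = D_rmul[OF g c] and bc = mul_A_grd[OF b c]
  let ?F = "\<lambda>f b g a. f (\<theta> (X b g a))"
  have la: "la c g = (\<lambda>x. sg (d * l) * g (mul A x c))"
    by (simp add: la_eq[OF D.total_grd[OF g]] \<theta>_hom[OF c] mul_A_ksg lin_ksg[OF D_lin[OF g]])
  have 1: "X b (la c g) a = smul A (sg (d * l)) (X b (\<lambda>x. g (mul A x c)) a)"
    unfolding la by (rule X_scale(2)[OF D.total_grd[OF gc]])
  have 2: "f (\<theta> (mul A b (X c g a))) = sg (d * j) * ?F (\<lambda>y. f (mul A b y)) c g a"
    by (simp add: \<theta>_mul \<theta>_hom[OF b] mul_A_ksg lin_ksg[OF D_lin[OF f]])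
  have psi: "stasheff_form4 j (b, 0) (c, 0) (0, g) (a, 0) (0, f) = - sg (j + d * j) * ?F (\<lambda>y. f (mul A b y)) c g a
      + ?F f (mul A b c) g a - sg (d * l) * ?F f b (\<lambda>y. g (mul A y c)) a"
    using D.total_grd[OF f] D.total_grd[OF g] la_TD[OF D.total_grd[OF g]] lin_0[OF D_lin[OF f]] lin_0[OF D_lin[OF g]]
    by (simp add: stasheff_form4_def m2_B 1 2 \<theta>_scale lin_scale[OF D_lin[OF f]] sg_add ra_TD)
      (simp add: sg_def)
  show ?thesis
  proof (cases "i + j + l + p + q = d")
    case True
    then have p: "p = d - i - j - l - q" by simp
    \<comment> \<open>The functionals y \<mapsto> g(yc) and y \<mapsto> f(by) have degrees q + l and
      p + j, and with these degrees they enter the signs of their brackets.\<close>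
    have "sg (p * (q + l) + j * (i + (q + l) + 1)) = (sg (p * q + (j + l) * (i + q + 1)) * sg (d * l) :: 'k)"
      "sg ((i - d) * j) * sg ((p + j) * q + l * (i + q + 1)) =
        (sg (p * q + (j + l) * (i + q + 1)) * sg (j + d * j) :: 'k)"
      unfolding sg_add[symmetric] p
      by (rule sg_eqI; cases "even i"; cases "even j"; cases "even l"; cases "even q"; cases "even d"; simp)+
    then show ?thesis
      unfolding psi bracket_apply[OF a bc f g] bracket_apply[OF a b f gc] bracket_apply[OF a c fb g]
      by algebra
  next
    case False
    then show ?thesis
      unfolding psi bracket_apply[OF a bc f g] bracket_apply[OF a b f gc] bracket_apply[OF a c fb g]
      using eval_zero[OF a bc f g] eval_zero[OF a b f gc] eval_zero[OF a c fb g]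
      by simp
  qed
qed

lemma bracket_leibniz_iff:
  "(\<forall>i j l. \<forall>a \<in> grd A i. \<forall>b \<in> grd A j. \<forall>c \<in> grd A l.
        br a (mul A b c) =
          tlift A 2 (\<lambda>xs. let (p, x) = xs ! 0; (q, y) = xs ! 1 in ptens A [x, mul A y c]) (br a b)
          + ksg ((i - d) * j)
              (tlift A 2 (\<lambda>xs. let (p, x) = xs ! 0; (q, y) = xs ! 1 in ptens A [mul A b x, y]) (br a c)))
    \<longleftrightarrow> stasheff_word4" (is "?L \<longleftrightarrow> _")
proof
  assume *: ?L
  show stasheff_word4
    unfolding stasheff_word4_def
  proof (intro allI ballI)
    fix j l q i p b c g a f
    assume h: "b \<in> grd A j" "c \<in> grd A l" "g \<in> D q" "a \<in> grd A i" "f \<in> D p"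
    note lin = D_lin[OF h(5)] D_lin[OF h(3)]
    have "br a (mul A b c) [f, g] =
          (tlift A 2 (\<lambda>xs. let (p, x) = xs ! 0; (q, y) = xs ! 1 in ptens A [x, mul A y c]) (br a b)
          + ksg ((i - d) * j)
              (tlift A 2 (\<lambda>xs. let (p, x) = xs ! 0; (q, y) = xs ! 1 in ptens A [mul A b x, y]) (br a c))) [f, g]"
      using *[rule_format, OF h(4,1,2)] by (rule fun_cong)
    then have "br a (mul A b c) [f, g] = br a b [f, \<lambda>y. g (mul A y c)] + sg ((i - d) * j) * br a c [\<lambda>y. f (mul A b y), g]"
      unfolding plus_fun_apply ksg_fun_apply ksg_field rmul2(2)[OF bracket_tens(1) h(2) lin]
        lmul2(2)[OF bracket_tens(1) h(1) lin] .
    then show "stasheff_form4 j (b, 0) (c, 0) (0, g) (a, 0) (0, f) = 0"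
      using bracket_leibniz_eval[OF h(4,1,2,5,3)] by simp
  qed
next
  assume *: stasheff_word4
  show ?L
  proof (intro allI ballI, rule tens2_ext)
    fix i j l a b c p q f g
    assume h: "a \<in> grd A i" "b \<in> grd A j" "c \<in> grd A l" "f \<in> D p" "g \<in> D q"
    note lin = D_lin[OF h(4)] D_lin[OF h(5)]
    have "stasheff_form4 j (b, 0) (c, 0) (0, g) (a, 0) (0, f) = 0" using * h by (simp add: stasheff_word4_def)
    then have "br a (mul A b c) [f, g] = br a b [f, \<lambda>y. g (mul A y c)] + sg ((i - d) * j) * br a c [\<lambda>y. f (mul A b y), g]"
      using bracket_leibniz_eval[OF h] by simp
    then show "br a (mul A b c) [f, g] =
          (tlift A 2 (\<lambda>xs. let (p, x) = xs ! 0; (q, y) = xs ! 1 in ptens A [x, mul A y c]) (br a b)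
          + ksg ((i - d) * j)
              (tlift A 2 (\<lambda>xs. let (p, x) = xs ! 0; (q, y) = xs ! 1 in ptens A [mul A b x, y]) (br a c))) [f, g]"
      unfolding plus_fun_apply ksg_fun_apply ksg_field rmul2(2)[OF bracket_tens(1) h(3) lin]
        lmul2(2)[OF bracket_tens(1) h(2) lin] .
  next
    fix i j l a b c assume h: "a \<in> grd A i" "b \<in> grd A j" "c \<in> grd A l"
    show "tlift A 2 (\<lambda>xs. let (p, x) = xs ! 0; (q, y) = xs ! 1 in ptens A [x, mul A y c]) (br a b)
          + ksg ((i - d) * j)
              (tlift A 2 (\<lambda>xs. let (p, x) = xs ! 0; (q, y) = xs ! 1 in ptens A [mul A b x, y]) (br a c)) \<in> tpow A 2"
      by (intro tpow_add tpow2_ksg rmul2(1)[OF bracket_tens(1) h(3)] lmul2(1)[OF bracket_tens(1) h(2)])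
  qed (rule bracket_tens(1))
qed

text \<open>Contraction undoes the bracket formula up to a sign. A functional \<open>e\<close> with
  nonzero value has degree d - j - l - r, and inserting this degree makes the sign independent of
  \<open>e\<close>.\<close>

lemma bracket_ctr:
  assumes b: "b \<in> grd A j" and c: "c \<in> grd A l" and h: "h \<in> D r"
  shows "ctr h (br b c) = ksg ((j + l + r + d) * (r + d) + l * (j + r + 1)) (X c h b)"
proof (rule D_separates_eq)
  fix n e assume e: "e \<in> D n"
  have x: "X c h b \<in> grd A (j + l + r - d)" by (rule X_grd[OF c h b])
  show "e (ctr h (br b c)) = e (ksg ((j + l + r + d) * (r + d) + l * (j + r + 1)) (X c h b))"
    unfolding ctr_apply[OF bracket_tens(1) D_lin[OF e] D_lin[OF h]] bracket_apply[OF b c e h] lin_ksg[OF D_lin[OF e]]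
      eval_\<theta>[OF x e]
  proof (cases "j + l + r - d + n = 0")
    case True
    then have n: "n = d - j - l - r" by simp
    show "sg (n * r + l * (j + r + 1)) * (sg (d * (j + l + r - d)) * e (X c h b)) =
        sg ((j + l + r + d) * (r + d) + l * (j + r + 1)) * e (X c h b)"
      by (auto simp: sg_def n)
  qed (simp add: D_zero[OF e x])
qed

lemma triple_eval:
  assumes a: "a \<in> grd A i" and b: "b \<in> grd A j" and c: "c \<in> grd A l"
    and f: "f \<in> D p" and g: "g \<in> D q" and h: "h \<in> D r"
  shows "triple_L d A br [(i', a), (j', b), (l', c)] [f, g, h] =
    sg ((j + l + r + d) * (r + d + i + q + 1) + l * (j + r + 1) + p * q) * f (\<theta> (X (X c h b) g a))"
proof -
  have x: "X c h b \<in> grd A (j + l + r - d)" by (rule X_grd[OF c h b])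
  have "br a (ksg e y) [f, g] = sg e * br a y [f, g]" for e y
    by (simp add: ksg_scale[OF A.vector_space] bracket_tens(5))
  then show ?thesis
    unfolding triple_L(2)[OF bracket_bilinear D_lin[OF f] D_lin[OF g] D_lin[OF h]] bracket_ctr[OF b c h]
    by (simp add: bracket_apply[OF a x f g] sg_add[symmetric] mult.assoc[symmetric] del: mult.assoc)
      (rule disjI2, rule sg_eqI, auto)
qed

text \<open>The first term of the form is an iterated X already. The other two pass through Y and
  are rotated until they become iterated X as well. The three results are the rotations by two
  places of a single expression, as are the summands of the double Jacobi identity.\<close>

lemma cyclic_terms:
  assumes c: "c \<in> grd A l" and h: "h \<in> D r" and b: "b \<in> grd A j" and g: "g \<in> D q" and a: "a \<in> grd A i"
    and f: "f \<in> D p"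
  shows "stasheff_form5 l (r - d + 1) (c, 0) (0, h) (b, 0) (0, g) (a, 0) (0, f) =
    f (\<theta> (X (X c h b) g a))
    + sg (l + (p - d + 1) * (l + r + j + q + i + 1) + i * (p + d + l + r + j + q)
        + 1 + i + p + l + d) * g (\<theta> (X (X a f c) h b))
    + sg (l + r - d + 1 + (p - d + 1) * (l + r + j + q + i + 1) + (j + q + i - d) * (p + l + r))
        * h (\<theta> (X (X b g a) f c))"
proof -
  have G: "(c, 0) \<in> G l" "(0, h) \<in> G (r - d + 1)" "(b, 0) \<in> G j" "(0, g) \<in> G (q - d + 1)" "(a, 0) \<in> G i"
    "(0, f) \<in> G (p - d + 1)"
    using c h b g a f by (simp_all add: grd_B)
  note T = D.total_grd[OF f] D.total_grd[OF g] D.total_grd[OF h]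
  let ?c = "(c, 0) :: 'a \<times> ('a \<Rightarrow> 'k)" and ?b = "(b, 0) :: 'a \<times> ('a \<Rightarrow> 'k)" and ?a = "(a, 0) :: 'a \<times> ('a \<Rightarrow> 'k)"
    and ?h = "(0, h) :: 'a \<times> ('a \<Rightarrow> 'k)" and ?g = "(0, g) :: 'a \<times> ('a \<Rightarrow> 'k)" and ?f = "(0, f) :: 'a \<times> ('a \<Rightarrow> 'k)"
  note hbg = M_G[OF G(2,3,4)] and afc = M_G[OF G(5,6,1)] and bga = M_G[OF G(3,4,5)]
  \<comment> \<open>Two rotations of the outer operation move the value of \<open>M\<close> on h, b,
    g into the second entry of the form. Symmetry exchanges it with the value on a, f, c, and one
    rotation of h, b, g then leaves g alone.\<close>
  have "\<gamma> (M ?c (M ?h ?b ?g) ?a) ?f =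
      sg ((p - d + 1) * (l + r + j + q + i + 1) + i * (p + d + l + r + j + q)
        + 1 + i + p + l + d) * \<gamma> (M (M ?a ?f ?c) ?h ?b) ?g"
    by (rule sg_trans[OF M_cyclic[OF G(1) hbg G(5,6)] sg_trans[OF M_cyclic[OF G(6,1) hbg G(5)]
      sg_trans[OF \<gamma>_sym[OF afc hbg] M_cyclic[OF G(2,3,4) afc] refl] refl]])
      (cases "even i"; cases "even j"; cases "even l"; cases "even q"; cases "even r"; cases "even p"; cases "even d"; simp)
  moreover have "\<gamma> (M ?c ?h (M ?b ?g ?a)) ?f =
      sg ((p - d + 1) * (l + r + j + q + i + 1) + (j + q + i - d) * (p + l + r)) * \<gamma> (M (M ?b ?g ?a) ?f ?c) ?h"
    by (rule sg_trans[OF M_cyclic[OF G(1,2) bga G(6)] M_cyclic[OF G(6,1,2) bga]])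
      (cases "even i"; cases "even j"; cases "even l"; cases "even q"; cases "even r"; cases "even p"; cases "even d"; simp)
  moreover have "sg (l + (p - d + 1) * (l + r + j + q + i + 1) + i * (p + d + l + r + j + q) + 1 + i + p + l + d) =
      (sg l * sg ((p - d + 1) * (l + r + j + q + i + 1) + i * (p + d + l + r + j + q) + 1 + i + p + l + d) :: 'k)"
    "sg (l + r - d + 1 + (p - d + 1) * (l + r + j + q + i + 1) + (j + q + i - d) * (p + l + r)) =
      (sg (l + (r - d + 1)) * sg ((p - d + 1) * (l + r + j + q + i + 1) + (j + q + i - d) * (p + l + r)) :: 'k)"
    unfolding sg_add[symmetric] by (rule arg_cong[where f = sg], simp only: algebra_simps)+
  moreover have "stasheff_form5 l (r - d + 1) ?c ?h ?b ?g ?a ?f = \<gamma> (M (M ?c ?h ?b) ?g ?a) ?f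
      + sg l * \<gamma> (M ?c (M ?h ?b ?g) ?a) ?f + sg (l + (r - d + 1)) * \<gamma> (M ?c ?h (M ?b ?g ?a)) ?f"
    by (simp only: stasheff_form5_def)
  moreover have "\<gamma> (M (M ?c ?h ?b) ?g ?a) ?f = f (\<theta> (X (X c h b) g a))"
    "\<gamma> (M (M ?a ?f ?c) ?h ?b) ?g = g (\<theta> (X (X a f c) h b))"
    "\<gamma> (M (M ?b ?g ?a) ?f ?c) ?h = h (\<theta> (X (X b g a) f c))"
    using T by simp_all
  ultimately show ?thesis by (simp only: mult.assoc)
qed

text \<open>Both sides are signed sums of the same three iterated values. They all vanish unless the
  degrees of a, b, c, f, g, h add up to 2d; eliminating p reduces the comparison of signs to
  parities.\<close>

lemma bracket_jacobi_eval:
  assumes a: "a \<in> grd A i" and b: "b \<in> grd A j" and c: "c \<in> grd A l"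
    and f: "f \<in> D p" and g: "g \<in> D q" and h: "h \<in> D r"
  shows "triple_L d A br [(i - d, a), (j - d, b), (l - d, c)] [f, g, h]
    + sg ((j - d) * (i - d) + (l - d) * (i - d) + p * (q + r)) * triple_L d A br [(j - d, b), (l - d, c), (i - d, a)] [g, h, f]
    + sg ((l - d) * (i - d) + (l - d) * (j - d) + r * (p + q)) * triple_L d A br [(l - d, c), (i - d, a), (j - d, b)] [h, f, g]
    = sg ((j + l + r + d) * (r + d + i + q + 1) + l * (j + r + 1) + p * q) *
      stasheff_form5 l (r - d + 1) (c, 0) (0, h) (b, 0) (0, g) (a, 0) (0, f)"
proof (cases "i + j + l + p + q + r = 2 * d")
  case True
  then have p: "p = 2 * d - i - j - l - q - r" by simp
  have "sg ((j - d) * (i - d) + (l - d) * (i - d) + p * (q + r)) *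
        sg ((l + i + p + d) * (p + d + j + r + 1) + i * (l + p + 1) + q * r) =
      (sg ((j + l + r + d) * (r + d + i + q + 1) + l * (j + r + 1) + p * q) *
       sg (l + (p - d + 1) * (l + r + j + q + i + 1) + i * (p + d + l + r + j + q)
        + 1 + i + p + l + d) :: 'k)"
    "sg ((l - d) * (i - d) + (l - d) * (j - d) + r * (p + q)) *
        sg ((i + j + q + d) * (q + d + l + p + 1) + j * (i + q + 1) + r * p) =
      (sg ((j + l + r + d) * (r + d + i + q + 1) + l * (j + r + 1) + p * q) *
       sg (l + r - d + 1 + (p - d + 1) * (l + r + j + q + i + 1) + (j + q + i - d) * (p + l + r)) :: 'k)"
    unfolding sg_add[symmetric] p
    by (rule sg_eqI; cases "even i"; cases "even j"; cases "even l"; cases "even q"; cases "even r"; cases "even d"; simp)+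
  then show ?thesis
    unfolding cyclic_terms[OF c h b g a f] triple_eval[OF a b c f g h] triple_eval[OF b c a g h f]
      triple_eval[OF c a b h f g]
    by algebra
next
  case False
  have "f (\<theta> (X (X c h b) g a)) = 0"
    by (rule eval_zero[OF a X_grd[OF c h b] f g]) (use False in linarith)
  moreover have "g (\<theta> (X (X a f c) h b)) = 0"
    by (rule eval_zero[OF b X_grd[OF a f c] g h]) (use False in linarith)
  moreover have "h (\<theta> (X (X b g a) f c)) = 0"
    by (rule eval_zero[OF c X_grd[OF b g a] h f]) (use False in linarith)
  ultimately show ?thesis
    unfolding cyclic_terms[OF c h b g a f] triple_eval[OF a b c f g h] triple_eval[OF b c a g h f]
      triple_eval[OF c a b h f g] by simp
qed

lemma sum_C3: "(\<Sum>\<sigma>\<in>C3. F \<sigma>) = F id + F rot3 + F (rot3 \<circ> rot3)" for F :: "_ \<Rightarrow> 'w::ab_group_add"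
proof -
  have r: "rot3 \<noteq> id" "rot3 \<circ> rot3 \<noteq> id" "rot3 \<circ> rot3 \<noteq> rot3"
    by (auto simp: rot3_def fun_eq_iff intro!: exI[of _ 0])
  then show ?thesis unfolding C3_def by (auto simp: add.assoc)
qed

lemma jacobi_sum:
  defines "S \<equiv> \<lambda>xs. \<Sum>\<sigma> \<in> C3. ksg (perm_exp (inv \<sigma>) (map fst xs)) (tau A 3 \<sigma> (triple_L d A br (perm_list (inv \<sigma>) xs)))"
  shows "S [(i', a), (j', b), (l', c)] \<in> tpow A 3"
    "f \<in> D p \<Longrightarrow> g \<in> D q \<Longrightarrow> h \<in> D r \<Longrightarrow> S [(i', a), (j', b), (l', c)] [f, g, h] =
      triple_L d A br [(i', a), (j', b), (l', c)] [f, g, h]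
    + sg (j' * i' + l' * i' + p * (q + r)) * triple_L d A br [(j', b), (l', c), (i', a)] [g, h, f]
    + sg (l' * i' + l' * j' + r * (p + q)) * triple_L d A br [(l', c), (i', a), (j', b)] [h, f, g]"
proof -
  have C: "id \<in> C3" "rot3 \<in> C3" "rot3 \<circ> rot3 \<in> C3" by (simp_all add: C3_def)
  have r: "rot3 \<noteq> id" "rot3 \<circ> rot3 \<noteq> id" "rot3 \<circ> rot3 \<noteq> rot3"
    by (auto simp: rot3_def fun_eq_iff intro!: exI[of _ 0])
  note L = triple_L(1)[OF bracket_bilinear]
  have S: "S [(i', a), (j', b), (l', c)] = tau A 3 id (triple_L d A br [(i', a), (j', b), (l', c)])
    + ksg (j' * i' + l' * i') (tau A 3 rot3 (triple_L d A br [(j', b), (l', c), (i', a)]))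
    + ksg (l' * i' + l' * j') (tau A 3 (rot3 \<circ> rot3) (triple_L d A br [(l', c), (i', a), (j', b)]))"
    by (simp add: S_def sum_C3 inv_rot3 inv_rot3_rot3 perm_exp_3 perm_list_3)
  show "S [(i', a), (j', b), (l', c)] \<in> tpow A 3"
    unfolding S by (intro tpow_add tpow3_ksg tau3(1)[OF L] C)
  show "S [(i', a), (j', b), (l', c)] [f, g, h] =
      triple_L d A br [(i', a), (j', b), (l', c)] [f, g, h]
    + sg (j' * i' + l' * i' + p * (q + r)) * triple_L d A br [(j', b), (l', c), (i', a)] [g, h, f]
    + sg (l' * i' + l' * j' + r * (p + q)) * triple_L d A br [(l', c), (i', a), (j', b)] [h, f, g]"
    if f: "f \<in> D p" and g: "g \<in> D q" and h: "h \<in> D r"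
    unfolding S plus_fun_apply ksg_fun_apply ksg_field tau3(2)[OF L C(1) f g h] tau3(2)[OF L C(2) f g h]
      tau3(2)[OF L C(3) f g h] if_not_P[OF r(1)] if_not_P[OF r(2)] if_not_P[OF r(3)] if_P[OF refl]
    by (simp add: sg_add)
qed

lemma bracket_jacobi_iff:
  "(\<forall>xs. length xs = 3 \<and> hlist (shift d A) xs \<longrightarrow>
        (\<Sum>\<sigma> \<in> C3. ksg (perm_exp (inv \<sigma>) (map fst xs))
           (tau A 3 \<sigma> (triple_L d A br (perm_list (inv \<sigma>) xs)))) = 0) \<longleftrightarrow> stasheff_word5" (is "?L \<longleftrightarrow> _")
proof
  assume *: ?L
  show stasheff_word5
    unfolding stasheff_word5_def
  proof (intro allI ballI)
    fix l r j q i p c h b g a f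
    assume h: "c \<in> grd A l" "h \<in> D r" "b \<in> grd A j" "g \<in> D q" "a \<in> grd A i" "f \<in> D p"
    have "length [(i - d, a), (j - d, b), (l - d, c)] = 3 \<and> hlist (shift d A) [(i - d, a), (j - d, b), (l - d, c)]"
      using h by (simp add: hlist_def shift_def)
    from *[rule_format, OF this] jacobi_sum(2)[OF h(6,4,2), of "i - d" a "j - d" b "l - d" c]
      bracket_jacobi_eval[OF h(5,3,1,6,4,2)]
    show "stasheff_form5 l (r - d + 1) (c, 0) (0, h) (b, 0) (0, g) (a, 0) (0, f) = 0" by simp
  qed
next
  assume *: stasheff_word5
  show ?L
  proof (intro allI impI, rule tens3_ext)
    fix xs assume "length xs = 3 \<and> hlist (shift d A) xs"
    then obtain i a j b l c where xs: "xs = [(i, a), (j, b), (l, c)]"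
      and h: "a \<in> grd A (i + d)" "b \<in> grd A (j + d)" "c \<in> grd A (l + d)"
      by (auto simp: length_Suc_conv numeral_3_eq_3 hlist_def shift_def)
    show "(\<Sum>\<sigma> \<in> C3. ksg (perm_exp (inv \<sigma>) (map fst xs))
           (tau A 3 \<sigma> (triple_L d A br (perm_list (inv \<sigma>) xs)))) \<in> tpow A 3"
      unfolding xs by (rule jacobi_sum(1))
    fix p q r f g e assume f: "f \<in> D p" "g \<in> D q" "e \<in> D r"
    have "stasheff_form5 (l + d) (r - d + 1) (c, 0) (0, e) (b, 0) (0, g) (a, 0) (0, f) = 0"
      using * h f by (simp add: stasheff_word5_def)
    then show "(\<Sum>\<sigma> \<in> C3. ksg (perm_exp (inv \<sigma>) (map fst xs))
           (tau A 3 \<sigma> (triple_L d A br (perm_list (inv \<sigma>) xs)))) [f, g, e] = 0 [f, g, e]"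
      using jacobi_sum(2)[OF f, of i a j b l c] bracket_jacobi_eval[OF h f] by (simp add: xs)
  qed simp
qed

lemma all_shift: "(\<forall>i. P (i + d)) \<longleftrightarrow> (\<forall>i. P i)" for P :: "int \<Rightarrow> bool"
  by (metis diff_add_cancel)

text \<open>The degree and the skew-symmetry follow from the bracket formula by
  \<open>bracket_deg\<close> and \<open>bracket_skew\<close>. Each of the three other axioms is
  equivalent to one Stasheff word.\<close>

lemma double_Poisson_iff: "double_Poisson d A br \<longleftrightarrow> stasheff_word3 \<and> stasheff_word4 \<and> stasheff_word5"
proof -
  have 1: "(\<forall>i j. \<forall>a \<in> grd (shift d A) i. \<forall>b \<in> grd (shift d A) j. br a b \<in> tpow_deg A 2 (i + j + d))"
    using bracket_deg by (force simp: shift_def algebra_simps)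
  have 2: "(\<forall>i j. \<forall>a \<in> grd (shift d A) i. \<forall>b \<in> grd (shift d A) j. - ksg (i * j) (br b a) = flip A (br a b))"
    using bracket_skew[of _ "_ + d" _ "_ + d"] by (simp add: shift_def)
  have k: "br (ksg d x) y = ksg d (br x y)" "br y (ksg d x) = ksg d (br y x)" for x y
    by (auto simp: ksg_scale[OF A.vector_space] ksg_scale[OF vector_space_tens] bracket_tens)
  \<comment> \<open>The differential of A[d] carries the sign of d, which cancels the sign of d in
    the axiom. The quantifiers then only have to be shifted from degrees in A[d] to degrees in
    A.\<close>
  have "(\<forall>i j. \<forall>a \<in> grd (shift d A) i. \<forall>b \<in> grd (shift d A) j. dif2 A (br a b) =
          ksg d (br (dif (shift d A) a) b + ksg i (br a (dif (shift d A) b)))) \<longleftrightarrow>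
    (\<forall>i j. \<forall>a \<in> grd A (i + d). \<forall>b \<in> grd A (j + d).
      dif2 A (br a b) = br (dif A a) b + ksg (i + d - d) (br a (dif A b)))"
    by (simp add: shift_def k ksg_add add.commute[of d] mult_2[symmetric]) (simp add: ksg_def)
  also have "\<dots> \<longleftrightarrow> stasheff_word3"
    unfolding bracket_dif_iff[symmetric]
    using all_shift[of "\<lambda>i. \<forall>j. \<forall>a \<in> grd A i. \<forall>b \<in> grd A (j + d).
        dif2 A (br a b) = br (dif A a) b + ksg (i - d) (br a (dif A b))"]
      all_shift[of "\<lambda>j. \<forall>a \<in> grd A i. \<forall>b \<in> grd A j.
        dif2 A (br a b) = br (dif A a) b + ksg (i - d) (br a (dif A b))" for i]
    by simp
  finally show ?thesis
    unfolding double_Poisson_def bracket_leibniz_iff bracket_jacobi_iff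
    using bracket_bilinear 1 2 by simp
qed

end

end

section \<open>From pre-Calabi-Yau structures to ternary operations and back\<close>

lemma op_domI: "length xs = n \<Longrightarrow> set xs \<subseteq> total (grd V) \<Longrightarrow> xs \<in> op_dom V n"
  by (simp add: op_dom_def)

context dga
begin

definition X_of :: "(nat \<Rightarrow> ('a \<times> ('a \<Rightarrow> 'k)) list \<Rightarrow> 'a \<times> ('a \<Rightarrow> 'k)) \<Rightarrow> 'a \<Rightarrow> ('a \<Rightarrow> 'k) \<Rightarrow> 'a \<Rightarrow> 'a" where
  "X_of m b g a = fst (m 3 [(b, 0), (0, g), (a, 0)])"

definition Y_of :: "(nat \<Rightarrow> ('a \<times> ('a \<Rightarrow> 'k)) list \<Rightarrow> 'a \<times> ('a \<Rightarrow> 'k)) \<Rightarrow> ('a \<Rightarrow> 'k) \<Rightarrow> 'a \<Rightarrow> ('a \<Rightarrow> 'k) \<Rightarrow> ('a \<Rightarrow> 'k)" where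
  "Y_of m f b g = snd (m 3 [(0, f), (b, 0), (0, g)])"

lemma summand_simps: "summand A True = {0} \<times> TD" "summand A False = UNIV \<times> {0}"
  by (simp_all add: summand_def)

context
  fixes m assumes m: "m \<in> fm_nice_pre_CY d A"
begin

lemma m_A_infinity: "A_infinity B m"
  using m by (simp add: fm_nice_pre_CY_def pre_CY_def cyclic_A_infinity_def)

lemma m_total: "n \<ge> 1 \<Longrightarrow> xs \<in> op_dom B n \<Longrightarrow> m n xs \<in> TB"
  using m_A_infinity by (auto simp: A_infinity_def multilinear_op_def)

lemma m3_total: "x \<in> TB \<Longrightarrow> y \<in> TB \<Longrightarrow> z \<in> TB \<Longrightarrow> m 3 [x, y, z] \<in> TB"
  by (rule m_total) (auto intro: op_domI)

lemma m3_multilinear: "multilinear_op B 3 (m 3)"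
  using m_A_infinity by (simp add: A_infinity_def)

lemma m3_add:
  assumes "x \<in> TB" "x' \<in> TB" "y \<in> TB" "z \<in> TB"
  shows "m 3 [x + x', y, z] = m 3 [x, y, z] + m 3 [x', y, z]"
    "m 3 [y, x + x', z] = m 3 [y, x, z] + m 3 [y, x', z]"
    "m 3 [y, z, x + x'] = m 3 [y, z, x] + m 3 [y, z, x']"
proof -
  have ml: "m 3 (xs[k := u + v]) = m 3 (xs[k := u]) + m 3 (xs[k := v])"
    if "xs \<in> op_dom B 3" "k < 3" "u \<in> TB" "v \<in> TB" for xs k u v
    using m3_multilinear that unfolding multilinear_op_def by blast
  show "m 3 [x + x', y, z] = m 3 [x, y, z] + m 3 [x', y, z]"
    using ml[of "[x, y, z]" 0 x x'] assms by (simp add: op_dom_def)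
  show "m 3 [y, x + x', z] = m 3 [y, x, z] + m 3 [y, x', z]"
    using ml[of "[y, x, z]" 1 x x'] assms by (simp add: op_dom_def)
  show "m 3 [y, z, x + x'] = m 3 [y, z, x] + m 3 [y, z, x']"
    using ml[of "[y, z, x]" 2 x x'] assms by (simp add: op_dom_def numeral_2_eq_2)
qed

lemma m3_scale:
  assumes "x \<in> TB" "y \<in> TB" "z \<in> TB"
  shows "m 3 [smul B c x, y, z] = smul B c (m 3 [x, y, z])"
    "m 3 [y, smul B c x, z] = smul B c (m 3 [y, x, z])"
    "m 3 [y, z, smul B c x] = smul B c (m 3 [y, z, x])"
proof -
  have ml: "m 3 (xs[k := smul B c u]) = smul B c (m 3 (xs[k := u]))"
    if "xs \<in> op_dom B 3" "k < 3" "u \<in> TB" for xs k u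
    using m3_multilinear that unfolding multilinear_op_def by blast
  show "m 3 [smul B c x, y, z] = smul B c (m 3 [x, y, z])"
    using ml[of "[x, y, z]" 0 x] assms by (simp add: op_dom_def)
  show "m 3 [y, smul B c x, z] = smul B c (m 3 [y, x, z])"
    using ml[of "[y, x, z]" 1 x] assms by (simp add: op_dom_def)
  show "m 3 [y, z, smul B c x] = smul B c (m 3 [y, z, x])"
    using ml[of "[y, z, x]" 2 x] assms by (simp add: op_dom_def numeral_2_eq_2)
qed

lemma m3_good:
  assumes "x \<in> summand A i" "y \<in> summand A j" "z \<in> summand A k"
  shows "if i \<noteq> j \<and> j \<noteq> k then m 3 [x, y, z] \<in> summand A i else m 3 [x, y, z] = 0"
proof -
  have "good_map A 3 (m 3)"
    using m by (simp add: fm_nice_pre_CY_def nice_def good_def)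
  then have "if alternating [i, j, k] then m 3 [x, y, z] \<in> summand A ([i, j, k] ! 0) else m 3 [x, y, z] = 0"
    using assms unfolding good_map_def
    by (elim allE[of _ "[i, j, k]"] allE[of _ "[x, y, z]"])
      (auto simp: less_Suc_eq numeral_3_eq_3)
  moreover have "alternating [i, j, k] \<longleftrightarrow> i \<noteq> j \<and> j \<noteq> k"
    by (auto simp: alternating_def less_Suc_eq)
  ultimately show ?thesis by (simp only: nth_Cons_0)
qed

lemma m3_A: "g \<in> TD \<Longrightarrow> m 3 [(b, 0), (0, g), (a, 0)] = (X_of m b g a, 0)"
  using m3_good[of "(b, 0)" False "(0, g)" True "(a, 0)" False]
  by (auto simp: summand_simps X_of_def)

lemma m3_D: "f \<in> TD \<Longrightarrow> g \<in> TD \<Longrightarrow> m 3 [(0, f), (b, 0), (0, g)] = (0, Y_of m f b g)"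
  using m3_good[of "(0, f)" True "(b, 0)" False "(0, g)" True]
  by (auto simp: summand_simps Y_of_def)

text \<open>Splitting the three arguments into their summands gives eight words, of which goodness
  leaves the two alternating ones.\<close>

lemma m3_eq:
  assumes f: "f1 \<in> TD" "f2 \<in> TD" "f3 \<in> TD"
  shows "m 3 [(a1, f1), (a2, f2), (a3, f3)] = (X_of m a1 f2 a3, Y_of m f1 a2 f3)"
proof -
  let ?a = "\<lambda>a. (a, 0) :: 'a \<times> ('a \<Rightarrow> 'k)" and ?f = "\<lambda>f. (0, f) :: 'a \<times> ('a \<Rightarrow> 'k)"
  have T: "?a a \<in> TB" "?f f1 \<in> TB" "?f f2 \<in> TB" "?f f3 \<in> TB"
    "(a, f1) \<in> TB" "(a, f2) \<in> TB" "(a, f3) \<in> TB" for a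
    using f by (auto simp: total_B)
  have S: "?a a \<in> summand A False" "?f f1 \<in> summand A True" "?f f2 \<in> summand A True" "?f f3 \<in> summand A True" for a
    using f by (auto simp: summand_simps)
  have z: "m 3 [?a a1, ?a a2, ?a a3] = 0" "m 3 [?a a1, ?a a2, ?f f3] = 0" "m 3 [?a a1, ?f f2, ?f f3] = 0"
    "m 3 [?f f1, ?f f2, ?f f3] = 0" "m 3 [?f f1, ?f f2, ?a a3] = 0" "m 3 [?f f1, ?a a2, ?a a3] = 0"
    using m3_good[OF S(1) S(1) S(1)] m3_good[OF S(1) S(1) S(4)] m3_good[OF S(1) S(3) S(4)]
      m3_good[OF S(2) S(3) S(4)] m3_good[OF S(2) S(3) S(1)] m3_good[OF S(2) S(1) S(1)]
    by auto
  have "m 3 [(a1, f1), (a2, f2), (a3, f3)] = m 3 [?a a1 + ?f f1, ?a a2 + ?f f2, ?a a3 + ?f f3]" by simp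
  also have "\<dots> = m 3 [?a a1, ?f f2, ?a a3] + m 3 [?f f1, ?a a2, ?f f3]"
    using T B.total_add by (simp add: m3_add z del: add_Pair)
  finally show ?thesis using f by (simp add: m3_A m3_D)
qed

lemma m3_degree:
  assumes "x \<in> G i" "y \<in> G j" "z \<in> G k" shows "m 3 [x, y, z] \<in> G (i + j + k - 1)"
proof -
  have "\<forall>n \<ge> 1. \<forall>xs. length xs = n \<and> hlist B xs \<longrightarrow>
        m n (map snd xs) \<in> grd B (sum_list (map fst xs) + 2 - int n)"
    using m_A_infinity by (simp add: A_infinity_def)
  from this[rule_format, of 3 "[(i, x), (j, y), (k, z)]"] assms show ?thesis
    by (simp add: hlist_def algebra_simps)
qed

lemma m3_cyclic:
  assumes "x \<in> G i" "y \<in> G j" "z \<in> G k" "w \<in> G l"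
  shows "\<gamma> (m 3 [x, y, z]) w = sg (1 + l * (i + j + k)) * \<gamma> (m 3 [w, x, y]) z"
proof -
  have "\<forall>n \<ge> 1. \<forall>xs i a. length xs = n \<and> hlist B xs \<and> a \<in> grd B i \<longrightarrow>
        \<gamma> (m n (map snd xs)) a =
          ksg (int n + i * sum_list (map fst xs)) (\<gamma> (m n (a # butlast (map snd xs))) (last (map snd xs)))"
    using m by (simp add: fm_nice_pre_CY_def pre_CY_def cyclic_A_infinity_def)
  from this[rule_format, of 3 "[(i, x), (j, y), (k, z)]" w l] assms show ?thesis
    by (simp add: hlist_def ksg_field add.assoc sg_def)
qed

lemma m3_operation_of: "m3_operation d A (X_of m) (Y_of m)"
proof
  note T = total_B[THEN eq_refl, THEN subsetD]
  have tA: "(a, 0) \<in> TB" and tD: "f \<in> TD \<Longrightarrow> (0, f) \<in> TB" for a f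
    by (auto simp: total_B)
  have sc: "smul B c (a, 0) = (smul A c a, 0)" "smul B c (0, f) = (0, \<lambda>x. c * f x)" for c a f
    by (auto simp: smul_B zero_fun_def)
  show "X_of m (b + b') g a = X_of m b g a + X_of m b' g a" if "g \<in> TD" for b b' g a
    using m3_add(1)[of "(b, 0)" "(b', 0)" "(0, g)" "(a, 0)"] tA tD that by (simp add: X_of_def)
  show "X_of m b (g + g') a = X_of m b g a + X_of m b g' a" if "g \<in> TD" "g' \<in> TD" for b g g' a
    using m3_add(2)[of "(0, g)" "(0, g')" "(b, 0)" "(a, 0)"] tA tD that by (simp add: X_of_def)
  show "X_of m b g (a + a') = X_of m b g a + X_of m b g a'" if "g \<in> TD" for b g a a'
    using m3_add(3)[of "(a, 0)" "(a', 0)" "(b, 0)" "(0, g)"] tA tD[OF that] by (simp add: X_of_def)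
  show "X_of m (smul A c b) g a = smul A c (X_of m b g a)" if "g \<in> TD" for c b g a
    using m3_scale(1)[of "(b, 0)" "(0, g)" "(a, 0)" c] tA tD that by (simp add: sc m3_A)
  show "X_of m b (\<lambda>x. c * g x) a = smul A c (X_of m b g a)" if "g \<in> TD" for c b g a
    using m3_scale(2)[of "(0, g)" "(b, 0)" "(a, 0)" c] tA tD that D.total_scale[OF that, of c] by (simp add: sc m3_A)
  show "X_of m b g (smul A c a) = smul A c (X_of m b g a)" if "g \<in> TD" for c b g a
    using m3_scale(3)[of "(a, 0)" "(b, 0)" "(0, g)" c] tA tD that by (simp add: sc m3_A)
  show "X_of m b g a \<in> grd A (i + j + q - d)" if h: "b \<in> grd A j" "g \<in> D q" "a \<in> grd A i" for b j g q a i
  proof -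
    have "(b, 0) \<in> G j" "(0, g) \<in> G (q - d + 1)" "(a, 0) \<in> G i" using h by (simp_all add: grd_B)
    from m3_degree[OF this] show ?thesis
      using D.total_grd[OF h(2)] by (simp add: m3_A grd_B algebra_simps)
  qed
  show "Y_of m f b g \<in> TD" if "f \<in> TD" "g \<in> TD" for f b g
    using m3_total[OF tD[OF that(1)] tA tD[OF that(2)]] by (simp add: m3_D that total_B)
  show "Y_of m (f + f') b g = Y_of m f b g + Y_of m f' b g" if "f \<in> TD" "f' \<in> TD" "g \<in> TD" for f f' b g
    using m3_add(1)[of "(0, f)" "(0, f')" "(b, 0)" "(0, g)"] tA tD that by (simp add: Y_of_def)
  show "Y_of m f (b + b') g = Y_of m f b g + Y_of m f b' g" if "f \<in> TD" "g \<in> TD" for f b b' g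
    using m3_add(2)[of "(b, 0)" "(b', 0)" "(0, f)" "(0, g)"] tA tD that by (simp add: Y_of_def)
  show "Y_of m f b (g + g') = Y_of m f b g + Y_of m f b g'" if "f \<in> TD" "g \<in> TD" "g' \<in> TD" for f b g g'
    using m3_add(3)[of "(0, g)" "(0, g')" "(0, f)" "(b, 0)"] tA tD that by (simp add: Y_of_def)
  show "Y_of m (\<lambda>x. c * f x) b g = (\<lambda>x. c * Y_of m f b g x)" if "f \<in> TD" "g \<in> TD" for c f b g
    using m3_scale(1)[of "(0, f)" "(b, 0)" "(0, g)" c] tA tD that D.total_scale[OF that(1), of c]
    by (simp add: sc m3_D)
  show "Y_of m f (smul A c b) g = (\<lambda>x. c * Y_of m f b g x)" if "f \<in> TD" "g \<in> TD" for c f b g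
    using m3_scale(2)[of "(b, 0)" "(0, f)" "(0, g)" c] tA tD that by (simp add: sc m3_D)
  show "Y_of m f b (\<lambda>x. c * g x) = (\<lambda>x. c * Y_of m f b g x)" if "f \<in> TD" "g \<in> TD" for c f b g
    using m3_scale(3)[of "(0, g)" "(0, f)" "(b, 0)" c] tA tD that D.total_scale[OF that(2), of c]
    by (simp add: sc m3_D)
  show "Y_of m f b g \<in> D (p + q + j - d)" if h: "f \<in> D p" "b \<in> grd A j" "g \<in> D q" for f p b j g q
  proof -
    have "(0, f) \<in> G (p - d + 1)" "(b, 0) \<in> G j" "(0, g) \<in> G (q - d + 1)" using h by (simp_all add: grd_B)
    from m3_degree[OF this] show ?thesis
      using D.total_grd[OF h(1)] D.total_grd[OF h(3)] by (simp add: m3_D grd_B algebra_simps)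
  qed
  show "f0 (\<theta> (X_of m a1 f2 a3)) = sg (1 + l * (i + j + k)) * Y_of m f0 a1 f2 a3"
    if h: "a1 \<in> grd A i" "f2 \<in> D (j + d - 1)" "a3 \<in> grd A k" "f0 \<in> D (l + d - 1)" for a1 i f2 j a3 k f0 l
  proof -
    have "(a1, 0) \<in> G i" "(0, f2) \<in> G j" "(a3, 0) \<in> G k" "(0, f0) \<in> G l" using h by (simp_all add: grd_B)
    from m3_cyclic[OF this] show ?thesis
      using D.total_grd[OF h(2)] D.total_grd[OF h(4)] by (simp add: m3_A m3_D)
  qed
  show "Y_of m f1 a2 f3 a0 = sg (1 + l * (i + j + k)) * f3 (\<theta> (X_of m a0 f1 a2))"
    if h: "f1 \<in> D (i + d - 1)" "a2 \<in> grd A j" "f3 \<in> D (k + d - 1)" "a0 \<in> grd A l" for f1 i a2 j f3 k a0 l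
  proof -
    have "(0, f1) \<in> G i" "(a2, 0) \<in> G j" "(0, f3) \<in> G k" "(a0, 0) \<in> G l" using h by (simp_all add: grd_B)
    from m3_cyclic[OF this] show ?thesis
      using D.total_grd[OF h(1)] D.total_grd[OF h(3)] by (simp add: m3_A m3_D)
  qed
qed

lemma realizes_of: "m3_operation.realizes d A (X_of m) (Y_of m) m"
proof -
  interpret m3_operation d A "X_of m" "Y_of m" by (rule m3_operation_of)
  show ?thesis
    unfolding realizes_def
  proof (intro conjI ballI allI impI)
    fix x y z assume "x \<in> TB" "y \<in> TB" "z \<in> TB"
    then show "m 3 [x, y, z] = M x y z" by (auto simp: total_B m3_eq)
  qed (use m in \<open>auto simp: fm_nice_pre_CY_def fully_manageable_def nice_def small_def\<close>)
qed

lemma base_of: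
  "m3_operation.stasheff_word3 d A (X_of m) (Y_of m)" "m3_operation.stasheff_word4 d A (X_of m) (Y_of m)"
  "m3_operation.stasheff_word5 d A (X_of m) (Y_of m)"
proof -
  interpret m3_operation d A "X_of m" "Y_of m" by (rule m3_operation_of)
  have "(\<Sum>p\<in>stasheff_set n. stasheff_term m xs p) = 0" if "n \<ge> 1" "length xs = n" "hlist B xs" for n xs
    using m_A_infinity that unfolding A_infinity_def stasheff_set_def stasheff_term_def by blast
  from base_identities[OF realizes_of this] show stasheff_word3 stasheff_word4 stasheff_word5 by blast+
qed

end

end

section \<open>The A-infinity structure built from a ternary operation\<close>

context m3_operation
begin

lemma is_bracket_of_iff:
  assumes "realizes m" shows "is_bracket_of d A m br \<longleftrightarrow> bracket br"
proof -
  have "fun_tens A f q g (br a b) = ksg (j * (i + q + 1)) (\<gamma> (m 3 [(b, 0), (0, g), (a, 0)]) (0, f)) \<longleftrightarrow>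
      br a b [f, g] = sg (p * q + j * (i + q + 1)) * f (\<theta> (X b g a))"
    if "bilinear_into_tens2 A br" "f \<in> D p" "g \<in> D q" for f p g q a i b j
  proof -
    have "m 3 [(b, 0), (0, g), (a, 0)] = (X b g a, 0)"
      using assms D.total_grd[OF that(3)] by (simp add: realizes_def total_B)
    then show ?thesis
      using D.total_grd[OF that(2)]
      by (simp add: fun_tens_apply[OF bilinear_tens(1)[OF that(1)] that(2) D_lin[OF that(3)]] ksg_field
          sg_add[of "p * q"] sg_mult_eq_iff mult.assoc)
  qed
  then show ?thesis unfolding is_bracket_of_def bracket_def by blast
qed

text \<open>Outside of its domain the operation is \<open>undefined\<close>, as
  \<open>A_infinity\<close> prescribes, so that equality of structures is equality of
  functions.\<close>

definition mop :: "nat \<Rightarrow> ('a \<times> ('a \<Rightarrow> 'k)) list \<Rightarrow> 'a \<times> ('a \<Rightarrow> 'k)" where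
  "mop n xs = (if n \<ge> 1 \<and> xs \<in> op_dom B n
     then if n = 1 then m1 (xs ! 0) else if n = 2 then m2 (xs ! 0) (xs ! 1)
       else if n = 3 then M (xs ! 0) (xs ! 1) (xs ! 2) else 0
     else undefined)"

lemma realizes_mop: "realizes mop"
  by (auto simp: realizes_def mop_def op_dom_def numeral_2_eq_2 numeral_3_eq_3)

lemma mop_total: "n \<ge> 1 \<Longrightarrow> xs \<in> op_dom B n \<Longrightarrow> mop n xs \<in> TB"
  using realizes_total[OF realizes_mop, of xs] by (auto simp: op_dom_def)

lemma M_add:
  assumes "x \<in> TB" "x' \<in> TB" "y \<in> TB" "z \<in> TB"
  shows "M (x + x') y z = M x y z + M x' y z" "M y (x + x') z = M y x z + M y x' z" "M y z (x + x') = M y z x + M y z x'"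
  using assms by (auto simp: total_B X_add Y_add)

lemma M_scale:
  assumes "x \<in> TB" "y \<in> TB" "z \<in> TB"
  shows "M (smul B c x) y z = smul B c (M x y z)" "M y (smul B c x) z = smul B c (M y x z)"
    "M y z (smul B c x) = smul B c (M y z x)"
  using assms by (auto simp: total_B smul_B X_scale Y_scale)

lemma list_cases_1_2_3:
  assumes "n = length xs" "n \<ge> 1"
  obtains x where "n = 1" "xs = [x]" | x y where "n = 2" "xs = [x, y]" | x y z where "n = 3" "xs = [x, y, z]" | "n \<ge> 4"
proof -
  consider "n = 1" | "n = 2" | "n = 3" | "n \<ge> 4" using assms(2) by linarith
  then show ?thesis
    by cases (use assms that in \<open>auto simp: length_Suc_conv numeral_2_eq_2 numeral_3_eq_3\<close>)
qed

lemma mop_simps: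
  "x \<in> TB \<Longrightarrow> mop 1 [x] = m1 x"
  "x \<in> TB \<Longrightarrow> y \<in> TB \<Longrightarrow> mop 2 [x, y] = m2 x y"
  "x \<in> TB \<Longrightarrow> y \<in> TB \<Longrightarrow> z \<in> TB \<Longrightarrow> mop 3 [x, y, z] = M x y z"
  using realizes_mop by (auto simp: realizes_def)

lemma mop_ge_4: "n \<ge> 4 \<Longrightarrow> xs \<in> op_dom B n \<Longrightarrow> mop n xs = 0"
  by (simp add: mop_def)

lemma op_dom_update: "xs \<in> op_dom V n \<Longrightarrow> u \<in> total (grd V) \<Longrightarrow> xs[k := u] \<in> op_dom V n"
  using set_update_subset_insert[of xs k u] by (auto simp: op_dom_def)

lemma mop_multilinear: "n \<ge> 1 \<Longrightarrow> multilinear_op B n (mop n)"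
  unfolding multilinear_op_def
proof (intro conjI ballI allI impI)
  fix xs k u v c assume n: "n \<ge> 1" and xs: "xs \<in> op_dom B n" and k: "k < n"
    and uv: "u \<in> TB" "v \<in> TB"
  note tot = B.total_add[OF uv] B.total_scale[OF uv(1)]
  have "mop n (xs[k := u + v]) = mop n (xs[k := u]) + mop n (xs[k := v]) \<and>
      mop n (xs[k := smul B c u]) = smul B c (mop n (xs[k := u]))"
  proof (rule list_cases_1_2_3[of n xs])
    fix x assume "n = 1" "xs = [x]"
    then show ?thesis using k uv tot by (simp add: mop_simps[unfolded One_nat_def] m1_add m1_scale)
  next
    fix x y assume e: "n = 2" "xs = [x, y]"
    have "k = 0 \<or> k = 1" using k e by auto
    then show ?thesis using uv tot xs e by (auto simp: mop_simps m2_add m2_scale op_dom_def)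
  next
    fix x y z assume e: "n = 3" "xs = [x, y, z]"
    have "k = 0 \<or> k = 1 \<or> k = 2" using k e by auto
    then show ?thesis using uv tot xs e
      by (elim disjE) (auto simp: mop_simps M_add M_scale op_dom_def numeral_2_eq_2[symmetric] eval_nat_numeral(2)[symmetric])
  next
    assume "n \<ge> 4"
    then show ?thesis using op_dom_update[OF xs] uv tot by (simp add: mop_ge_4)
  qed (use xs n in \<open>auto simp: op_dom_def\<close>)
  then show "mop n (xs[k := u + v]) = mop n (xs[k := u]) + mop n (xs[k := v])"
    "mop n (xs[k := smul B c u]) = smul B c (mop n (xs[k := u]))" by blast+
qed (simp add: mop_total)

lemma hlist_op_dom: "length xs = n \<Longrightarrow> hlist B xs \<Longrightarrow> map snd xs \<in> op_dom B n"
  using B.total_grd by (fastforce simp: op_dom_def hlist_def)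

lemma mop_degree:
  assumes n: "n \<ge> 1" and xs: "length xs = n" "hlist B xs"
  shows "mop n (map snd xs) \<in> G (sum_list (map fst xs) + 2 - int n)"
proof (rule list_cases_1_2_3[of n xs])
  fix x assume "n = 1" "xs = [x]"
  then show ?thesis using xs B.total_grd m1_G
    by (cases x) (auto simp: mop_simps[unfolded One_nat_def] hlist_def add.commute)
next
  fix x y assume "n = 2" "xs = [x, y]"
  then show ?thesis using xs B.total_grd m2_G
    by (cases x; cases y) (auto simp: mop_simps hlist_def)
next
  fix x y z assume e: "n = 3" "xs = [x, y, z]"
  then show ?thesis using xs B.total_grd M_G[of "snd x" "fst x" "snd y" "fst y" "snd z" "fst z"]
    by (cases x; cases y; cases z) (auto simp: mop_simps hlist_def algebra_simps)
next
  assume "n \<ge> 4"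
  then show ?thesis using hlist_op_dom[OF xs] by (simp add: mop_ge_4)
qed (use xs n in auto)

lemma mop_cyclic:
  assumes n: "n \<ge> 1" and xs: "length xs = n" "hlist B xs" and a: "a \<in> G i"
  shows "\<gamma> (mop n (map snd xs)) a =
    ksg (int n + i * sum_list (map fst xs)) (\<gamma> (mop n (a # butlast (map snd xs))) (last (map snd xs)))"
proof -
  note aT = B.total_grd[OF a]
  show ?thesis
  proof (rule list_cases_1_2_3[of n xs])
    fix x assume e: "n = 1" "xs = [x]"
    then show ?thesis using xs a aT B.total_grd m1_cyclic[of "snd x" "fst x" a i]
      by (cases x; cases a) (auto simp: mop_simps[unfolded One_nat_def] hlist_def ksg_field)
  next
    fix x y assume "n = 2" "xs = [x, y]"
    then show ?thesis using xs a aT B.total_grd m2_cyclic[of "snd x" "fst x" "snd y" "fst y" a i]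
      by (cases x; cases y; cases a) (auto simp: mop_simps hlist_def ksg_field sg_def)
  next
    fix x y z assume e: "n = 3" "xs = [x, y, z]"
    have h: "snd x \<in> G (fst x)" "snd y \<in> G (fst y)" "snd z \<in> G (fst z)"
      using xs(2) e by (simp_all add: hlist_def split_def)
    have "sg (3 + i * (fst x + (fst y + fst z))) = (sg (1 + i * (fst x + fst y + fst z)) :: 'k)"
      by (rule sg_eqI) (simp add: add.assoc)
    then show ?thesis
      using M_cyclic[OF h a] B.total_grd[OF h(1)] B.total_grd[OF h(2)] B.total_grd[OF h(3)] aT
      by (simp add: e mop_simps ksg_field)
  next
    assume n4: "n \<ge> 4"
    define ys where "ys = map snd xs"
    have ys: "ys \<in> op_dom B n" unfolding ys_def by (rule hlist_op_dom[OF xs])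
    have "ys \<noteq> []" using n4 xs(1) by (auto simp: ys_def)
    then have "set (butlast ys) \<subseteq> TB" "last ys \<in> TB" "length (a # butlast ys) = n"
      using ys n4 in_set_butlastD[of _ ys] last_in_set[of ys] by (auto simp: op_dom_def)
    then have "a # butlast ys \<in> op_dom B n" "last ys \<in> TB"
      using B.total_grd[OF a] by (auto simp: op_dom_def)
    moreover have "w \<in> TB \<Longrightarrow> \<gamma> 0 w = 0" for w
      using \<gamma>_scale_left[of 0 w 0] by simp
    ultimately show ?thesis using n4 ys B.total_grd[OF a] by (simp add: mop_ge_4 flip: ys_def)
  qed (use xs n in auto)
qed

lemma mop_A_infinity: "stasheff_word3 \<Longrightarrow> stasheff_word4 \<Longrightarrow> stasheff_word5 \<Longrightarrow> A_infinity B mop"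
  unfolding A_infinity_def
proof (intro conjI allI impI graded_B mop_multilinear)
  assume base: stasheff_word3 stasheff_word4 stasheff_word5
  show "mop n xs = undefined" if "\<not> (1 \<le> n \<and> xs \<in> op_dom B n)" for n xs
    using that by (auto simp: mop_def)
  show "mop n (map snd xs) \<in> G (sum_list (map fst xs) + 2 - int n)"
    if "1 \<le> n" "length xs = n \<and> hlist B xs" for n xs
    using mop_degree that by blast
  show "(\<Sum>(r, s, t) \<in> {(r, s, t). r + s + t = n \<and> s \<ge> 1}.
           ksg (int r + int s * int t + (2 - int s) * sum_list (map fst (take r xs)))
             (mop (r + 1 + t)
                (map snd (take r xs) @ [mop s (map snd (take s (drop r xs)))]
                 @ map snd (drop (r + s) xs)))) = 0"
    if "1 \<le> n" "length xs = n \<and> hlist B xs" for n xs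
    using stasheff_identities[OF realizes_mop base that(1), of xs] that(2)
    unfolding stasheff_set_def stasheff_term_def by blast
qed

lemma alternating_3: "alternating [i, j, k] \<longleftrightarrow> i \<noteq> j \<and> j \<noteq> k"
  by (auto simp: alternating_def less_Suc_eq)

lemma summand_total: "x \<in> summand A i \<Longrightarrow> x \<in> TB"
  by (cases i) (auto simp: summand_simps total_B)

lemma mop_good_map:
  assumes n: "odd n" shows "good_map A n (mop n)"
  unfolding good_map_def
proof (intro allI impI)
  fix "is" xs assume *: "length is = n \<and> length xs = n \<and> (\<forall>j<n. xs ! j \<in> summand A (is ! j))"
  have "n \<ge> 1" using n by (cases n) auto
  then show "if alternating is then mop n xs \<in> summand A (is ! 0) else mop n xs = 0"
  proof (rule list_cases_1_2_3[of n xs, rotated])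
    fix x assume e: "n = 1" "xs = [x]"
    then obtain i where i: "is = [i]" using * by (auto simp: length_Suc_conv)
    have "x \<in> summand A i" using * e i by simp
    moreover from this have "m1 x \<in> summand A i"
      by (cases i) (auto simp: summand_simps m1_B dif_dual_TD D.total_ksg)
    ultimately show ?thesis using e i summand_total by (simp add: mop_simps[unfolded One_nat_def] alternating_def)
  next
    fix x y z assume e: "n = 3" "xs = [x, y, z]"
    then obtain i j k where i: "is = [i, j, k]" using * by (auto simp: length_Suc_conv numeral_3_eq_3)
    have s: "x \<in> summand A i" "y \<in> summand A j" "z \<in> summand A k"
      using *[THEN conjunct2, THEN conjunct2, rule_format, of 0] *[THEN conjunct2, THEN conjunct2, rule_format, of 1]
        *[THEN conjunct2, THEN conjunct2, rule_format, of 2] e i by simp_all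
    then have "mop n xs = M x y z" using e summand_total by (simp add: mop_simps)
    then show ?thesis
      using s unfolding i alternating_3
      by (cases i; cases j; cases k) (auto simp: summand_simps Y_TD zero_prod_def)
  next
    assume n4: "n \<ge> 4"
    have "xs \<in> op_dom B n" using * summand_total by (fastforce simp: op_dom_def in_set_conv_nth)
    then have "mop n xs = 0" using n4 by (simp add: mop_ge_4)
    moreover have "0 \<in> summand A i" for i by (cases i) (auto simp: summand_simps zero_prod_def)
    ultimately show ?thesis by simp
  qed (use * n in auto)
qed

lemma mop_fm_nice: "stasheff_word3 \<Longrightarrow> stasheff_word4 \<Longrightarrow> stasheff_word5 \<Longrightarrow> mop \<in> fm_nice_pre_CY d A"
proof -
  assume base: stasheff_word3 stasheff_word4 stasheff_word5
  have "mop n xs \<in> summand A False" if "n \<ge> 1" "length xs = n" "set xs \<subseteq> summand A False" for n xs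
  proof (rule list_cases_1_2_3[of n xs])
    assume "n \<ge> 4"
    moreover have "xs \<in> op_dom B n" using that summand_total by (auto simp: op_dom_def)
    ultimately show ?thesis by (simp add: mop_ge_4 summand_simps zero_prod_def)
  qed (use that summand_total[of _ False] in
    \<open>auto simp: mop_simps mop_simps[unfolded One_nat_def] summand_simps m1_B m2_B\<close>)
  moreover have "ksg (i * j) (\<gamma> y x) = \<gamma> x y" if "x \<in> G i" "y \<in> G j" for i j x y
    using \<gamma>_sym[OF that] by (simp add: ksg_field)
  ultimately have "pre_CY d A mop"
    unfolding pre_CY_def cyclic_A_infinity_def
    using mop_A_infinity[OF base] bilinear_form_\<gamma> nondegenerate_\<gamma> mop_cyclic by blast
  moreover have "fully_manageable d A mop"
    by (simp add: fully_manageable_def mop_simps[unfolded One_nat_def] mop_simps)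
  moreover have "nice d A mop"
    using mop_good_map by (auto simp: nice_def good_def small_def essentially_odd_def mop_ge_4)
  ultimately show ?thesis by (simp add: fm_nice_pre_CY_def)
qed

end

section \<open>Finite rank, finite type and existence of the bracket\<close>

context dga
begin

text \<open>Places a contraction in its degree: its values on functionals are values of a bracket,
  while its components are not accessible directly.\<close>

lemma grd_iff_D: "x \<in> grd A k \<longleftrightarrow> (\<forall>p. \<forall>f \<in> D p. p + k \<noteq> 0 \<longrightarrow> f x = 0)"
proof
  assume "x \<in> grd A k"
  then show "\<forall>p. \<forall>f \<in> D p. p + k \<noteq> 0 \<longrightarrow> f x = 0" using D_zero by (metis add.commute)
next
  assume *: "\<forall>p. \<forall>f \<in> D p. p + k \<noteq> 0 \<longrightarrow> f x = 0"
  have z: "pr i x = 0" if "i \<noteq> k" for i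
  proof (rule ccontr)
    assume "pr i x \<noteq> 0"
    then obtain f where f: "lin f" "f (pr i x) = 1" by (rule functional_exists)
    have "(\<lambda>y. f (pr i y)) \<in> D (- i)" using pr_D[OF f(1), of "- i"] by simp
    then show False using * that f(2) by force
  qed
  have "x = (\<Sum>i\<in>{k}. pr i x)"
    by (rule gdecomp_sum_superset[OF A.hcomp_decomp]) (use z in auto)
  then show "x \<in> grd A k" using A.hcomp_in[of x k] by simp
qed

text \<open>Applying g e to a linear relation among the vectors w isolates the coefficient of w e,
  so these vectors are independent. A functional may then be prescribed on all of them at once,
  however many there are, and projecting makes it homogeneous.\<close>

lemma indicator_functional:
  assumes "\<And>e. e \<in> E \<Longrightarrow> g e \<in> D q" "\<And>e. e \<in> E \<Longrightarrow> w e \<in> grd A (- q)"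
    and "\<And>e e'. e \<in> E \<Longrightarrow> e' \<in> E \<Longrightarrow> g e (w e') = (if e = e' then 1 else 0)"
  obtains h where "h \<in> D q" "\<And>e. e \<in> E \<Longrightarrow> h (w e) = 1"
proof -
  interpret P: vector_space_pair "smul A" "(*) :: 'k \<Rightarrow> 'k \<Rightarrow> 'k"
    using A.vector_space vector_space_times by (simp add: vector_space_pair_def)
  have "A.vs.independent (w ` E)"
    unfolding A.vs.dependent_explicit
  proof (intro notI, elim exE conjE bexE)
    fix t u v assume t: "finite t" "t \<subseteq> w ` E" and s: "(\<Sum>v\<in>t. smul A (u v) v) = 0" and v: "v \<in> t" "u v \<noteq> 0"
    obtain e where e: "e \<in> E" "v = w e" using t v by auto
    have "0 = g e (\<Sum>v\<in>t. smul A (u v) v)" using s lin_0[OF D_lin[OF assms(1)[OF e(1)]]] by simp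
    also have "\<dots> = (\<Sum>v'\<in>t. u v' * g e v')"
      using D_lin[OF assms(1)[OF e(1)]] by (simp add: lin_sum lin_scale)
    also have "\<dots> = (\<Sum>v'\<in>t. if v' = v then u v else 0)"
    proof (intro sum.cong refl)
      fix v' assume "v' \<in> t"
      then obtain e' where e': "e' \<in> E" "v' = w e'" using t by auto
      show "u v' * g e v' = (if v' = v then u v else 0)"
      proof (cases "e = e'")
        case True
        then show ?thesis using e e' assms(3)[of e e] by simp
      next
        case False
        then have "g e v' = 0" "g e v = 1" using e e' assms(3) by auto
        then show ?thesis by auto
      qed
    qed
    also have "\<dots> = u v" using t v by simp
    finally show False using v by simp
  qed
  from P.linear_independent_extend[OF this, of "\<lambda>_. 1"]
  obtain h where h: "lin h" "\<And>e. e \<in> E \<Longrightarrow> h (w e) = 1" by auto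
  show ?thesis
  proof (rule that)
    show "(\<lambda>x. h (pr (- q) x)) \<in> D q" by (rule pr_D[OF h(1)])
    show "h (pr (- q) (w e)) = 1" if "e \<in> E" for e
      using h(2)[OF that] A.hcomp_grd[OF assms(2)[OF that]] by simp
  qed
qed

text \<open>
  A pair of adjoint maps \<open>F : (A\<^sup>-\<^sup>q)\<^sup># \<rightarrow> A\<^sup>k\<close> and \<open>F' : (A\<^sup>k)\<^sup># \<rightarrow> A\<^sup>-\<^sup>q\<close> makes the image of \<open>F\<close> a reflexive
  vector space. Hence \<open>F\<close> has finite rank, even though \<open>A\<^sup>-\<^sup>q\<close> and \<open>A\<^sup>k\<close> may be infinite-dimensional: were a
  basis of the image infinite, some element of the image would have all coordinates equal to 1.
\<close>

lemma adjoint_tensor: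
  assumes F: "\<And>g. g \<in> D q \<Longrightarrow> F g \<in> grd A k" and F': "\<And>f. f \<in> D (- k) \<Longrightarrow> F' f \<in> grd A (- q)"
    and adj: "\<And>f g. f \<in> D (- k) \<Longrightarrow> g \<in> D q \<Longrightarrow> f (F g) = g (F' f)"
  obtains T where "T \<in> tpow A 2"
    "\<And>p q' f g. f \<in> D p \<Longrightarrow> g \<in> D q' \<Longrightarrow> T [f, g] = (if q' = q then f (F g) else 0)"
proof -
  \<comment> \<open>The basis is taken inside the image itself and not only inside its span, so that
    every basis vector has a preimage under \<open>F\<close>.\<close>
  obtain E where E: "E \<subseteq> F ` D q" "A.vs.independent E" "F ` D q \<subseteq> A.vs.span E"
    using A.vs.maximal_independent_subset[of "F ` D q"] by blast
  \<comment> \<open>A basis of the whole of A makes the coordinates functionals on A.\<close>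
  define E' where "E' = A.vs.extend_basis E"
  have E': "A.vs.independent E'" "E \<subseteq> E'" "A.vs.span E' = UNIV"
    using A.vs.independent_extend_basis[OF E(2)] A.vs.extend_basis_superset[OF E(2)]
      A.vs.span_extend_basis[OF E(2)] by (simp_all add: E'_def)
  define c where "c e x = A.vs.representation E' x e" for e x
  have c: "lin (c e)" for e
    using A.vs.representation_add[OF E'(1)] A.vs.representation_scale[OF E'(1)] E'(3)
    by (auto simp: lin_iff c_def)
  \<comment> \<open>Restricted to degree k, a coordinate functional becomes homogeneous of degree
    -k, as the adjoint \<open>F'\<close> demands; its values on the image of \<open>F\<close> do not
    change.\<close>
  define \<phi> where "\<phi> e = (\<lambda>x. c e (pr k x))" for e
  have \<phi>: "\<phi> e \<in> D (- k)" for e using pr_D[OF c[of e], of "- k"] by (simp add: \<phi>_def)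
  have Ek: "e \<in> grd A k" if "e \<in> E" for e using that E(1) F by auto
  have \<phi>_eq: "\<phi> e x = c e x" if "x \<in> grd A k" for e x
    using that by (simp add: \<phi>_def A.hcomp_grd)
  define w where "w e = F' (\<phi> e)" for e
  have w: "w e \<in> grd A (- q)" for e using F'[OF \<phi>] by (simp add: w_def)
  have "\<forall>e\<in>E. \<exists>g. g \<in> D q \<and> F g = e" using E(1) by blast
  then obtain g where g: "\<And>e. e \<in> E \<Longrightarrow> g e \<in> D q" "\<And>e. e \<in> E \<Longrightarrow> F (g e) = e" by metis
  have gw: "g e (w e') = (if e = e' then 1 else 0)" if "e \<in> E" "e' \<in> E" for e e'
  proof -
    have "g e (w e') = \<phi> e' (F (g e))" unfolding w_def using adj[OF \<phi> g(1)[OF that(1)]] by simp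
    also have "\<dots> = c e' e" using \<phi>_eq[OF Ek[OF that(1)]] g(2)[OF that(1)] by simp
    also have "\<dots> = (if e = e' then 1 else 0)"
      using A.vs.representation_basis[OF E'(1), of e] that E'(2) by (auto simp: c_def)
    finally show ?thesis .
  qed
  obtain h where h: "h \<in> D q" "\<And>e. e \<in> E \<Longrightarrow> h (w e) = 1"
    using indicator_functional[of E g q w, OF g(1) w gw] by blast
  have "E \<subseteq> {e. A.vs.representation E' (F h) e \<noteq> 0}"
  proof
    fix e assume "e \<in> E"
    then have "c e (F h) = 1" using adj[OF \<phi> h(1)] h(2) \<phi>_eq[OF F[OF h(1)]] by (simp add: w_def)
    then show "e \<in> {e. A.vs.representation E' (F h) e \<noteq> 0}" by (simp add: c_def)
  qed
  then have fin: "finite E" using A.vs.finite_representation finite_subset by blast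
  \<comment> \<open>The tensor of the finite-rank map \<open>F\<close>: by adjointness the
    coordinate of F g at e equals g (w e).\<close>
  have T: "(\<Sum>e\<in>E. ptens A [e, w e]) \<in> tpow A 2"
    by (intro tpow_sum tpow_ptens2[OF Ek w])
  show ?thesis
  proof (rule that[OF T])
    fix p q' f g assume f: "f \<in> D p" and g: "g \<in> D q'"
    have ev: "(\<Sum>e\<in>E. ptens A [e, w e]) [f, g] = (\<Sum>e\<in>E. f e * g (w e))"
      by (simp add: sum_fun_apply D_lin[OF f] D_lin[OF g])
    show "(\<Sum>e\<in>E. ptens A [e, w e]) [f, g] = (if q' = q then f (F g) else 0)"
    proof (cases "q' = q")
      case True
      then have g: "g \<in> D q" using g by simp
      have sp: "F g \<in> A.vs.span E" using E(3) g by blast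
      have "F g = (\<Sum>e\<in>E. smul A (A.vs.representation E (F g) e) e)"
        by (rule A.vs.sum_representation_eq[OF E(2) sp fin subset_refl, symmetric])
      also have "\<dots> = (\<Sum>e\<in>E. smul A (c e (F g)) e)"
        using A.vs.representation_extend[OF E'(1) sp E'(2)] by (simp add: c_def)
      finally have "f (F g) = f (\<Sum>e\<in>E. smul A (c e (F g)) e)" by simp
      also have "\<dots> = (\<Sum>e\<in>E. c e (F g) * f e)"
        using D_lin[OF f] by (simp add: lin_sum lin_scale)
      also have "\<dots> = (\<Sum>e\<in>E. f e * g (w e))"
        using adj[OF \<phi> g] \<phi>_eq[OF F[OF g]] by (simp add: w_def mult.commute)
      finally show ?thesis using True ev by simp
    next
      case False
      then have "g (w e) = 0" for e using D_zero[OF g w] by auto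
      then show ?thesis using False ev by simp
    qed
  qed
qed

end

context m3_operation
begin

definition finite_type :: bool where
  "finite_type \<longleftrightarrow> (\<forall>a b. finite {q. \<exists>g \<in> D q. X b g a \<noteq> 0})"

lemma finite_type_iff: "realizes m \<Longrightarrow> finite_type_m3 A m \<longleftrightarrow> finite_type"
proof -
  assume m: "realizes m"
  have "m 3 [(b, 0), (0, g), (a, 0)] \<noteq> 0 \<longleftrightarrow> X b g a \<noteq> 0" if "g \<in> D q" for b g a q
    using m D.total_grd[OF that] by (simp add: realizes_def total_B zero_prod_def)
  then have "{q. \<exists>g \<in> D q. m 3 [(b, 0), (0, g), (a, 0)] \<noteq> 0} = {q. \<exists>g \<in> D q. X b g a \<noteq> 0}" for a b
    by auto
  then show ?thesis by (simp add: finite_type_m3_def finite_type_def)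
qed

lemma finite_typeI:
  assumes "\<And>i j a b. a \<in> grd A i \<Longrightarrow> b \<in> grd A j \<Longrightarrow> finite {q. \<exists>g \<in> D q. X b g a \<noteq> 0}"
  shows finite_type
  unfolding finite_type_def
proof (intro allI)
  fix a b show "finite {q. \<exists>g \<in> D q. X b g a \<noteq> 0}"
  proof (induction a rule: A_hom_induct)
    case (hom i a)
    show ?case
    proof (induction b rule: A_hom_induct)
      case (hom j b)
      then show ?case using assms \<open>a \<in> grd A i\<close> by blast
    next
      case (add b b')
      then show ?case
        by (rule_tac finite_subset[OF _ finite_UnI[OF add]]) (auto simp: X_add D.total_grd)
    qed
  next
    case (add a a')
    then show ?case
      by (rule_tac finite_subset[OF _ finite_UnI[OF add]]) (auto simp: X_add D.total_grd)
  qed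
qed

text \<open>A tensor is a finite sum. If X b g a is nonzero, some functional detects it, so g is
  nonzero on the second factor of one of the summands and has the opposite degree.\<close>

lemma bracket_finite_type:
  assumes br: "bracket br" shows finite_type
proof (rule finite_typeI)
  fix i j a b assume a: "a \<in> grd A i" and b: "b \<in> grd A j"
  obtain Q where Q: "quads Q (br a b)" using quadsE[OF bracket_tens(1)[OF br]] .
  have "{q. \<exists>g \<in> D q. X b g a \<noteq> 0} \<subseteq> (\<lambda>(i, u, j, v). - j) ` set Q"
  proof
    fix q assume "q \<in> {q. \<exists>g \<in> D q. X b g a \<noteq> 0}"
    then obtain g where g: "g \<in> D q" "X b g a \<noteq> 0" by blast
    have "\<theta> (X b g a) \<noteq> 0" using g(2) by (metis \<theta>_0 \<theta>_\<theta>)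
    then obtain p f where f: "f \<in> D p" "f (\<theta> (X b g a)) \<noteq> 0" using D_separates by blast
    then have "br a b [f, g] \<noteq> 0" using bracket_apply[OF br a b f(1) g(1)] by simp
    then have "(\<Sum>(i, u, j, v)\<leftarrow>Q. f u * g v) \<noteq> 0"
      using quads_apply[OF Q D_lin[OF f(1)] D_lin[OF g(1)]] by simp
    then obtain i' u j' v where uv: "(i', u, j', v) \<in> set Q" "f u * g v \<noteq> 0"
      using sum_list_split_cong[of Q "\<lambda>i u j v. f u * g v" "\<lambda>_ _ _ _. 0"] by (force simp: split_def)
    then have "j' + q = 0" using D_zero[OF g(1) quads_in(2)[OF Q uv(1)]] by auto
    then have "q = - j'" by simp
    then show "q \<in> (\<lambda>(i, u, j, v). - j) ` set Q" using uv(1) by force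
  qed
  then show "finite {q. \<exists>g \<in> D q. X b g a \<noteq> 0}" by (rule finite_subset) simp
qed

text \<open>If X b g a is nonzero with g of degree q, then A is nonzero in the degrees -q and i + j
  + q - d. These add up to i + j - d, which does not depend on q.\<close>

lemma pairwise_finite_type: "pairwise_finite_support A \<Longrightarrow> finite_type"
proof (rule finite_typeI)
  fix i j a b assume fs: "pairwise_finite_support A" and a: "a \<in> grd A i" and b: "b \<in> grd A j"
  have "{q. \<exists>g \<in> D q. X b g a \<noteq> 0} \<subseteq> uminus ` {l. grd A l \<noteq> {0} \<and> grd A (i + j - d - l) \<noteq> {0}}"
  proof
    fix q assume "q \<in> {q. \<exists>g \<in> D q. X b g a \<noteq> 0}"
    then obtain g where g: "g \<in> D q" "X b g a \<noteq> 0" by blast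
    have "X b g a \<in> grd A (i + j - d - (- q))" using X_grd[OF b g(1) a] by (simp add: algebra_simps)
    then have 1: "grd A (i + j - d - (- q)) \<noteq> {0}" using g(2) by blast
    have "g \<noteq> 0" using g(2) by auto
    then obtain x where "g x \<noteq> 0" by (auto simp: fun_eq_iff)
    then have "g (pr (- q) x) \<noteq> 0" using D_eval[OF g(1)] by metis
    then have "pr (- q) x \<noteq> 0" using lin_0[OF D_lin[OF g(1)]] by auto
    then have 2: "grd A (- q) \<noteq> {0}" using A.hcomp_in[of x "- q"] by force
    from 1 2 show "q \<in> uminus ` {l. grd A l \<noteq> {0} \<and> grd A (i + j - d - l) \<noteq> {0}}"
      by (intro image_eqI[of _ _ "- q"]) auto
  qed
  moreover have "finite {l. grd A l \<noteq> {0} \<and> grd A (i + j - d - l) \<noteq> {0}}"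
    using fs unfolding pairwise_finite_support_def by blast
  ultimately show "finite {q. \<exists>g \<in> D q. X b g a \<noteq> 0}"
    by (rule finite_subset[OF _ finite_imageI])
qed

lemma bracket_unique:
  assumes "bracket br" "bracket br'" shows "br = br'"
proof (intro ext)
  fix a b fs
  have "br a b = br' a b"
  proof (induction a rule: A_hom_induct)
    case (hom i a)
    show ?case
    proof (induction b rule: A_hom_induct)
      case (hom j b)
      show ?case
        by (rule tens2_ext) (auto simp: bracket_tens assms bracket_apply[OF _ \<open>a \<in> grd A i\<close> hom])
    qed (simp add: bracket_tens assms)
  qed (simp add: bracket_tens assms)
  then show "br a b fs = br' a b fs" by simp
qed

text \<open>With i, j and q fixed, the degree of f is fixed too, so all signs of
  \<open>eval_skew\<close> and of both \<open>\<theta>\<close> collapse to one constant. This puts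
  the relation into the form required by \<open>adjoint_tensor\<close>.\<close>

lemma eval_adjoint:
  assumes a: "a \<in> grd A i" and b: "b \<in> grd A j"
  obtains s where "\<And>f g. f \<in> D (- (i + j + q - d)) \<Longrightarrow> g \<in> D q \<Longrightarrow> f (X b g a) = g (smul A (sg s) (X a f b))"
proof -
  let ?p = "- (i + j + q - d)"
  let ?e = "(?p - d + 1) * (j + q - d + 1 + i) + i * (?p - d + 1 + j + q - d + 1)"
  have "f (X b g a) = g (smul A (sg (d * (i + j + q - d) + ?e + d * (j + i + ?p - d))) (X a f b))"
    if f: "f \<in> D ?p" and g: "g \<in> D q" for f g
  proof -
    have "sg (d * (i + j + q - d)) * f (X b g a) = sg ?e * (sg (d * (j + i + ?p - d)) * g (X a f b))"
      using eval_skew[OF a b f g]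
      unfolding eval_\<theta>[OF X_grd[OF b g a] f] eval_\<theta>[OF X_grd[OF a f b] g] .
    then have "f (X b g a) = sg (d * (i + j + q - d)) * (sg ?e * (sg (d * (j + i + ?p - d)) * g (X a f b)))"
      by (rule sg_mult_eq_iff[THEN iffD1])
    then show ?thesis
      unfolding lin_scale[OF D_lin[OF g]] sg_add[of _ "d * (j + i + ?p - d)"] sg_add[of "d * (i + j + q - d)"]
      by (simp only: mult.assoc)
  qed
  then show ?thesis by (rule that)
qed

text \<open>Adjointness yields a tensor for each degree q separately. Finite type leaves finitely
  many q to sum over.\<close>

lemma bracket_hom:
  assumes fin: finite_type and a: "a \<in> grd A i" and b: "b \<in> grd A j"
  obtains T where "T \<in> tpow A 2"
    "\<And>p q f g. f \<in> D p \<Longrightarrow> g \<in> D q \<Longrightarrow> T [f, g] = sg (p * q + j * (i + q + 1)) * f (\<theta> (X b g a))"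
proof -
  let ?k = "\<lambda>q. i + j + q - d"
  have "\<exists>T. T \<in> tpow A 2 \<and> (\<forall>p q' f g. f \<in> D p \<longrightarrow> g \<in> D q' \<longrightarrow>
      T [f, g] = (if q' = q then f (X b g a) else 0))" for q
  proof -
    obtain s where s: "\<And>f g. f \<in> D (- ?k q) \<Longrightarrow> g \<in> D q \<Longrightarrow> f (X b g a) = g (smul A (sg s) (X a f b))"
      using eval_adjoint[OF a b] by metis
    obtain T where "T \<in> tpow A 2"
      "\<And>p q' f g. f \<in> D p \<Longrightarrow> g \<in> D q' \<Longrightarrow> T [f, g] = (if q' = q then f (X b g a) else 0)"
    proof (rule adjoint_tensor[of q "\<lambda>g. X b g a" "?k q" "\<lambda>f. smul A (sg s) (X a f b)"])
      show "X b g a \<in> grd A (?k q)" if "g \<in> D q" for g by (rule X_grd[OF b that a])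
      show "smul A (sg s) (X a f b) \<in> grd A (- q)" if "f \<in> D (- ?k q)" for f
        using A.grd_scale[OF X_grd[OF a that b]] by simp
    qed (use s in blast)+
    then show ?thesis by blast
  qed
  then obtain T where T: "\<And>q. T q \<in> tpow A 2"
    "\<And>q p q' f g. f \<in> D p \<Longrightarrow> g \<in> D q' \<Longrightarrow> T q [f, g] = (if q' = q then f (X b g a) else 0)"
    by metis
  define K where "K = {q. \<exists>g \<in> D q. X b g a \<noteq> 0}"
  have K: "finite K" using fin by (simp add: K_def finite_type_def)
  \<comment> \<open>The degree of f is forced to be the negative of \<open>?k q\<close>. Inserting
    it into the sign of the bracket formula, and adding the sign of \<open>\<theta>\<close> in
    degree \<open>?k q\<close>, gives a constant for each q.\<close>
  let ?s = "\<lambda>q. ?k q * q + j * (i + q + 1) + d * ?k q"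
  show ?thesis
  proof (rule that)
    show "(\<Sum>q\<in>K. ksg (?s q) (T q)) \<in> tpow A 2" by (intro tpow_sum tpow2_ksg T)
    fix p q f g assume f: "f \<in> D p" and g: "g \<in> D q"
    have x: "X b g a \<in> grd A (?k q)" by (rule X_grd[OF b g a])
    have "(\<Sum>q\<in>K. ksg (?s q) (T q)) [f, g] = (\<Sum>q'\<in>K. if q = q' then sg (?s q) * f (X b g a) else 0)"
      by (auto simp: sum_fun_apply ksg_fun_apply ksg_field T(2)[OF f g] intro!: sum.cong)
    also have "\<dots> = (if q \<in> K then sg (?s q) * f (X b g a) else 0)"
      using K by simp
    also have "\<dots> = sg (?s q) * f (X b g a)"
      using g lin_0[OF D_lin[OF f]] by (auto simp: K_def)
    also have "\<dots> = sg (p * q + j * (i + q + 1)) * f (\<theta> (X b g a))"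
    proof (cases "?k q + p = 0")
      case True
      then have p: "p = - ?k q" by simp
      have "sg (?s q) = (sg (p * q + j * (i + q + 1)) * sg (d * ?k q) :: 'k)"
        unfolding sg_add[symmetric] p
        by (rule sg_eqI) (cases "even i"; cases "even j"; cases "even q"; cases "even d"; simp)
      then show ?thesis by (simp add: eval_\<theta>[OF x f])
    next
      case False
      then show ?thesis using D_zero[OF f x] D_zero[OF f \<theta>_grd[OF x]] by simp
    qed
    finally show "(\<Sum>q\<in>K. ksg (?s q) (T q)) [f, g] = sg (p * q + j * (i + q + 1)) * f (\<theta> (X b g a))" .
  qed
qed

text \<open>The right-hand side of the bracket formula contains the degrees of a and b. Its bilinear
  extension says which tensor belongs to arguments that are not homogeneous.\<close>

definition bracket_form :: "int \<Rightarrow> ('a \<Rightarrow> 'k) \<Rightarrow> int \<Rightarrow> ('a \<Rightarrow> 'k) \<Rightarrow> 'a \<Rightarrow> 'a \<Rightarrow> 'k" where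
  "bracket_form p f q g a b = hext (grd A) (\<lambda>i a. hext (grd A) (\<lambda>j b.
     sg (p * q + j * (i + q + 1)) * f (\<theta> (X b g a))) b) a"

lemma bracket_form:
  assumes f: "f \<in> D p" and g: "g \<in> D q"
  shows "bracket_form p f q g (a + a') b = bracket_form p f q g a b + bracket_form p f q g a' b"
    "bracket_form p f q g a (b + b') = bracket_form p f q g a b + bracket_form p f q g a b'"
    "bracket_form p f q g (smul A c a) b = c * bracket_form p f q g a b"
    "bracket_form p f q g a (smul A c b) = c * bracket_form p f q g a b"
    "a \<in> grd A i \<Longrightarrow> b \<in> grd A j \<Longrightarrow> bracket_form p f q g a b = sg (p * q + j * (i + q + 1)) * f (\<theta> (X b g a))"
proof -
  note [simp] = X_add X_scale D.total_grd[OF g] \<theta>_add \<theta>_scale lin_add[OF D_lin[OF f]] lin_scale[OF D_lin[OF f]]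
    lin_0[OF D_lin[OF f]]
  have inner: "hext (grd A) (\<lambda>j b. sg (p * q + j * (i + q + 1)) * f (\<theta> (X b g a))) (b + b') =
      hext (grd A) (\<lambda>j b. sg (p * q + j * (i + q + 1)) * f (\<theta> (X b g a))) b +
      hext (grd A) (\<lambda>j b. sg (p * q + j * (i + q + 1)) * f (\<theta> (X b g a))) b'" for i a b b'
    by (rule A.hext_add) (auto simp: algebra_simps)
  have inner_scale: "hext (grd A) (\<lambda>j b. sg (p * q + j * (i + q + 1)) * f (\<theta> (X b g a))) (smul A c b) =
      c * hext (grd A) (\<lambda>j b. sg (p * q + j * (i + q + 1)) * f (\<theta> (X b g a))) b" for i a b c
    by (rule A.hext_scale[OF vector_space_times]) auto
  show "bracket_form p f q g (a + a') b = bracket_form p f q g a b + bracket_form p f q g a' b"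
    unfolding bracket_form_def
    by (rule A.hext_add) (auto simp: hext_fun_add[symmetric] algebra_simps)
  show "bracket_form p f q g a (b + b') = bracket_form p f q g a b + bracket_form p f q g a b'"
    unfolding bracket_form_def inner hext_fun_add ..
  show "bracket_form p f q g (smul A c a) b = c * bracket_form p f q g a b"
    unfolding bracket_form_def
  proof (rule A.hext_scale[OF vector_space_times])
    show "hext (grd A) (\<lambda>j b. sg (p * q + j * (i + q + 1)) * f (\<theta> (X b g (smul A c u)))) b =
        c * hext (grd A) (\<lambda>j b. sg (p * q + j * (i + q + 1)) * f (\<theta> (X b g u))) b" for i u
      by (subst hext_fun_scale[OF vector_space_times, symmetric]) (simp add: mult.left_commute)
    show "hext (grd A) (\<lambda>j b. sg (p * q + j * (i + q + 1)) * f (\<theta> (X b g 0))) b = 0" for i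
      by (simp add: hext_def)
  qed simp
  show "bracket_form p f q g a (smul A c b) = c * bracket_form p f q g a b"
    unfolding bracket_form_def inner_scale by (rule hext_fun_scale[OF vector_space_times])
  show "bracket_form p f q g a b = sg (p * q + j * (i + q + 1)) * f (\<theta> (X b g a))"
    if "a \<in> grd A i" "b \<in> grd A j"
    unfolding bracket_form_def
    by (subst A.hext_hom[OF that(1)], simp add: hext_def, subst A.hext_hom[OF that(2)]) auto
qed

definition represents :: "'a \<Rightarrow> 'a \<Rightarrow> ('k, 'a) tens \<Rightarrow> bool" where
  "represents a b T \<longleftrightarrow> T \<in> tpow A 2 \<and>
     (\<forall>p q. \<forall>f \<in> D p. \<forall>g \<in> D q. T [f, g] = bracket_form p f q g a b)"

lemma represents_unique: "represents a b S \<Longrightarrow> represents a b T \<Longrightarrow> S = T"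
  by (rule tens2_ext) (auto simp: represents_def)

lemma represents_add:
  "represents a b T \<Longrightarrow> represents a' b T' \<Longrightarrow> represents (a + a') b (T + T')"
  "represents a b T \<Longrightarrow> represents a b' T' \<Longrightarrow> represents a (b + b') (T + T')"
  by (auto simp: represents_def bracket_form intro!: tpow_add)

text \<open>Tensors with prescribed values exist for homogeneous arguments and, by adding them, for
  all. Each is determined by its values on functionals, so their dependence on a and b inherits the
  bilinearity of \<open>bracket_form\<close>.\<close>

lemma bracket_exists:
  assumes finite_type shows "\<exists>br. bracket br"
proof -
  have ex: "\<exists>T. represents a b T" for a b
  proof (induction a rule: A_hom_induct)
    case (hom i a)
    show ?case
    proof (induction b rule: A_hom_induct)
      case (hom j b)
      obtain T where "T \<in> tpow A 2"
        "\<And>p q f g. f \<in> D p \<Longrightarrow> g \<in> D q \<Longrightarrow> T [f, g] = sg (p * q + j * (i + q + 1)) * f (\<theta> (X b g a))"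
        using bracket_hom[OF assms \<open>a \<in> grd A i\<close> hom] by metis
      then show ?case using bracket_form(5)[OF _ _ \<open>a \<in> grd A i\<close> hom] by (auto simp: represents_def)
    next
      case (add b b')
      then show ?case using represents_add(2) by blast
    qed
  next
    case (add a a')
    then show ?case using represents_add(1) by blast
  qed
  define br where "br a b = (THE T. represents a b T)" for a b
  have br: "represents a b (br a b)" for a b
    unfolding br_def using ex[of a b] represents_unique by (metis theI)
  have eq: "br a b = T" if "represents a b T" for a b T
    using represents_unique[OF br that] .
  have tp: "br a b \<in> tpow A 2" for a b using br by (simp add: represents_def)
  have scale: "tsc c T \<in> tpow A 2" if "T \<in> tpow A 2" for c T
    using tpow_scale[of T 1] that by (simp add: numeral_2_eq_2)
  have ev: "br a b [f, g] = bracket_form p f q g a b" if "f \<in> D p" "g \<in> D q" for a b p f q g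
    using br that by (auto simp: represents_def)
  have "br (a + a') b = br a b + br a' b" "br a (b + b') = br a b + br a b'"
    "br (smul A c a) b = tsc c (br a b)" "br a (smul A c b) = tsc c (br a b)" for a a' b b' c
    by (intro eq, auto simp: represents_def bracket_form ev intro!: tpow_add tp scale)+
  then have "bilinear_into_tens2 A br"
    using tp A.vector_space vector_space_tens
    by (simp add: bilinear_into_tens2_def Vector_Spaces.linear_iff)
  then have "bracket br"
    using ev bracket_form(5) by (simp add: bracket_def)
  then show ?thesis by blast
qed

end

section \<open>From double Poisson brackets to ternary operations\<close>

context dga
begin

lemma lin_fun_add: "lin f \<Longrightarrow> lin g \<Longrightarrow> lin (f + g)"
  and lin_fun_scale: "lin f \<Longrightarrow> lin (\<lambda>x. c * f x)"
  by (auto simp: lin_iff algebra_simps)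

lemma ctr_add_right: "S \<in> tpow A 2 \<Longrightarrow> T \<in> tpow A 2 \<Longrightarrow> lin g \<Longrightarrow> ctr g (S + T) = ctr g S + ctr g T"
  by (rule D_separates_eq) (simp add: ctr_apply D_lin tpow_add lin_add)

lemma ctr_add_left:
  assumes "T \<in> tpow A 2" "lin g" "lin h" shows "ctr (g + h) T = ctr g T + ctr h T"
proof -
  have "T [f, g + h] = T [f, g] + T [f, h]" if "lin f" for f
    using tens2_linear_right(1)[OF assms(1) that assms(2,3)] by (simp add: plus_fun_def)
  then show ?thesis
    by (intro D_separates_eq) (simp add: ctr_apply assms D_lin lin_fun_add lin_add)
qed

lemma tpow2_scale: "T \<in> tpow A 2 \<Longrightarrow> tsc c T \<in> tpow A 2"
  using tpow_scale[of T 1] by (simp add: numeral_2_eq_2)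

lemma ctr_scale:
  assumes "T \<in> tpow A 2" "lin g"
  shows "ctr g (tsc c T) = smul A c (ctr g T)" "ctr (\<lambda>x. c * g x) T = smul A c (ctr g T)"
proof -
  show "ctr g (tsc c T) = smul A c (ctr g T)"
    by (rule D_separates_eq) (simp add: ctr_apply assms D_lin tpow2_scale lin_scale)
  show "ctr (\<lambda>x. c * g x) T = smul A c (ctr g T)"
    by (rule D_separates_eq)
      (simp add: ctr_apply assms D_lin lin_fun_scale lin_scale tens2_linear_right(2)[OF assms(1) _ assms(2,2)])
qed

text \<open>
  The sign $(-1)^{1 + l(i + j + k)}$ of the cyclicity condition: the form vanishes unless
  $i + j + k + l = 2 - d$.
\<close>

definition \<epsilon> :: "'a \<Rightarrow> 'a" where
  "\<epsilon> = hext (grd A) (\<lambda>l a. ksg (1 + l * (d + 1)) a)"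

lemma \<epsilon>_hom: "a \<in> grd A l \<Longrightarrow> \<epsilon> a = ksg (1 + l * (d + 1)) a"
  unfolding \<epsilon>_def by (rule A.hext_hom) auto

lemma \<epsilon>_add: "\<epsilon> (x + y) = \<epsilon> x + \<epsilon> y"
  unfolding \<epsilon>_def by (rule A.hext_add) (auto simp: ksg_add)

lemma \<epsilon>_scale: "\<epsilon> (smul A c x) = smul A c (\<epsilon> x)"
  unfolding \<epsilon>_def by (rule A.hext_scale[OF A.vector_space]) (auto simp: ksg_def)

text \<open>
  The sign is dictated by \<open>bracket_def\<close>, where $p$ can be replaced by $d - i - j - q$ because the
  bracket has degree $-d$.
\<close>

definition X_homogeneous :: "('a \<Rightarrow> 'a \<Rightarrow> ('k, 'a) tens) \<Rightarrow> int \<Rightarrow> ('a \<Rightarrow> 'k) \<Rightarrow> 'a \<Rightarrow> 'a \<Rightarrow> 'a" where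
  "X_homogeneous br q g b a = hext (grd A) (\<lambda>j b. hext (grd A) (\<lambda>i a.
     ksg (d * (i + j + 1) + i * q + i * j + j + q) (ctr g (br a b))) a) b"

definition X_br :: "('a \<Rightarrow> 'a \<Rightarrow> ('k, 'a) tens) \<Rightarrow> 'a \<Rightarrow> ('a \<Rightarrow> 'k) \<Rightarrow> 'a \<Rightarrow> 'a" where
  "X_br br b g a = hext (grd (dual A)) (\<lambda>q g. X_homogeneous br q g b a) g"

text \<open>This is \<open>cyc2\<close> turned into a definition, with its sign carried by
  \<open>\<epsilon>\<close>.\<close>

definition Y_br :: "('a \<Rightarrow> 'a \<Rightarrow> ('k, 'a) tens) \<Rightarrow> ('a \<Rightarrow> 'k) \<Rightarrow> 'a \<Rightarrow> ('a \<Rightarrow> 'k) \<Rightarrow> ('a \<Rightarrow> 'k)" where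
  "Y_br br f b g = (\<lambda>a. g (\<theta> (X_br br (\<epsilon> a) f b)))"

context
  fixes br assumes dP: "double_Poisson d A br"
begin

lemma dP_bilinear: "bilinear_into_tens2 A br"
  using dP by (simp add: double_Poisson_def)

lemmas dP_tens = bilinear_tens[OF dP_bilinear]

lemma dP_zero:
  assumes "a \<in> grd A i" "b \<in> grd A j" "f \<in> D p" "g \<in> D q" "i + j + p + q \<noteq> d"
  shows "br a b [f, g] = 0"
proof -
  have "\<forall>i j. \<forall>a \<in> grd (shift d A) i. \<forall>b \<in> grd (shift d A) j. br a b \<in> tpow_deg A 2 (i + j + d)"
    using dP by (simp add: double_Poisson_def)
  from this[rule_format, of a "i - d" b "j - d"] have "br a b \<in> tpow_deg A 2 (i + j - d)"
    using assms by (simp add: shift_def)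
  then show ?thesis using tpow_deg_iff[OF dP_tens(1)] assms(3-5) by force
qed

lemma dP_skew:
  assumes "a \<in> grd A i" "b \<in> grd A j" "f \<in> D p" "g \<in> D q"
  shows "br a b [f, g] = sg (1 + p * q + (i - d) * (j - d)) * br b a [g, f]"
proof -
  have "\<forall>i j. \<forall>a \<in> grd (shift d A) i. \<forall>b \<in> grd (shift d A) j. - ksg (i * j) (br b a) = flip A (br a b)"
    using dP by (simp add: double_Poisson_def)
  from this[rule_format, of a "i - d" b "j - d"] have "- ksg ((i - d) * (j - d)) (br b a) = flip A (br a b)"
    using assms by (simp add: shift_def)
  from fun_cong[OF this, of "[g, f]"] have "- (sg ((i - d) * (j - d)) * br b a [g, f]) = sg (q * p) * br a b [f, g]"
    unfolding flip_apply[OF dP_tens(1) assms(4,3)] by (simp add: ksg_fun_apply ksg_field)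
  then have "br a b [f, g] = sg (q * p) * (- (sg ((i - d) * (j - d)) * br b a [g, f]))" by simp
  also have "\<dots> = sg (1 + p * q + (i - d) * (j - d)) * br b a [g, f]"
    unfolding sg_add mult.commute[of q p] by (simp add: sg_def)
  finally show ?thesis .
qed

lemma X_homogeneous_linear:
  assumes g: "lin g"
  shows "X_homogeneous br q g (b + b') a = X_homogeneous br q g b a + X_homogeneous br q g b' a"
    "X_homogeneous br q g b (a + a') = X_homogeneous br q g b a + X_homogeneous br q g b a'"
    "X_homogeneous br q g (smul A c b) a = smul A c (X_homogeneous br q g b a)"
    "X_homogeneous br q g b (smul A c a) = smul A c (X_homogeneous br q g b a)"
    "lin h \<Longrightarrow> X_homogeneous br q (g + h) b a = X_homogeneous br q g b a + X_homogeneous br q h b a"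
    "X_homogeneous br q (\<lambda>x. c * g x) b a = smul A c (X_homogeneous br q g b a)"
proof -
  let ?s = "\<lambda>i j. d * (i + j + 1) + i * q + i * j + j + q"
  have ks: "ksg e (smul A c x) = smul A c (ksg e x)" for e c x
    by (simp add: ksg_def)
  note [simp] = dP_tens ctr_add_right ctr_add_left ctr_scale g ksg_add ks
  have z: "ctr g 0 = 0" using ctr_scale(1)[OF tpow_0 g, of 0] by (simp add: zero_fun_def)
  have br0: "br 0 b = 0" "br a 0 = 0" for a b
    using dP_tens(3)[of 0 0 b] dP_tens(5)[of a 0 0] by (simp_all add: zero_fun_def)
  have add: "hext (grd A) (\<lambda>i a. ksg (?s i j) (ctr g (br a b))) (a + a') =
      hext (grd A) (\<lambda>i a. ksg (?s i j) (ctr g (br a b))) a + hext (grd A) (\<lambda>i a. ksg (?s i j) (ctr g (br a b))) a'"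
    for j b a a' by (rule A.hext_add) auto
  have scale: "hext (grd A) (\<lambda>i a. ksg (?s i j) (ctr g (br a b))) (smul A c a) =
      smul A c (hext (grd A) (\<lambda>i a. ksg (?s i j) (ctr g (br a b))) a)"
    for j b a c by (rule A.hext_scale[OF A.vector_space]) (auto simp: br0 z)
  show "X_homogeneous br q g (b + b') a = X_homogeneous br q g b a + X_homogeneous br q g b' a"
    unfolding X_homogeneous_def by (rule A.hext_add) (auto simp: hext_fun_add)
  show "X_homogeneous br q g b (a + a') = X_homogeneous br q g b a + X_homogeneous br q g b a'"
    unfolding X_homogeneous_def add hext_fun_add ..
  show "X_homogeneous br q g (smul A c b) a = smul A c (X_homogeneous br q g b a)"
    unfolding X_homogeneous_def
    by (rule A.hext_scale[OF A.vector_space]) (auto simp: hext_fun_scale[OF A.vector_space], simp add: hext_def br0 z)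
  show "X_homogeneous br q g b (smul A c a) = smul A c (X_homogeneous br q g b a)"
    unfolding X_homogeneous_def scale by (rule hext_fun_scale[OF A.vector_space])
  show "X_homogeneous br q (g + h) b a = X_homogeneous br q g b a + X_homogeneous br q h b a" if "lin h"
    using that
    unfolding X_homogeneous_def by (simp add: hext_fun_add)
  show "X_homogeneous br q (\<lambda>x. c * g x) b a = smul A c (X_homogeneous br q g b a)"
    unfolding X_homogeneous_def by (simp add: hext_fun_scale[OF A.vector_space])
qed

lemma X_br_linear:
  assumes g: "g \<in> TD" and g': "g' \<in> TD"
  shows "X_br br (b + b') g a = X_br br b g a + X_br br b' g a"
    "X_br br b (g + g') a = X_br br b g a + X_br br b g' a"
    "X_br br b g (a + a') = X_br br b g a + X_br br b g a'"
    "X_br br (smul A c b) g a = smul A c (X_br br b g a)"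
    "X_br br b (\<lambda>x. c * g x) a = smul A c (X_br br b g a)"
    "X_br br b g (smul A c a) = smul A c (X_br br b g a)"
proof -
  have K0: "X_homogeneous br q 0 b a = 0" for q b a
    using X_homogeneous_linear(5)[OF D_lin[OF D.grd_0] D_lin[OF D.grd_0], of q b a] by simp
  show "X_br br (b + b') g a = X_br br b g a + X_br br b' g a"
    unfolding X_br_def hext_fun_add[symmetric] by (rule D.hext_cong[OF g]) (simp add: X_homogeneous_linear D_lin)
  show "X_br br b g (a + a') = X_br br b g a + X_br br b g a'"
    unfolding X_br_def hext_fun_add[symmetric] by (rule D.hext_cong[OF g]) (simp add: X_homogeneous_linear D_lin)
  show "X_br br b (g + g') a = X_br br b g a + X_br br b g' a"
    unfolding X_br_def by (rule D.hext_add[OF _ g g']) (simp add: X_homogeneous_linear D_lin)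
  show "X_br br (smul A c b) g a = smul A c (X_br br b g a)"
    unfolding X_br_def hext_fun_scale[OF A.vector_space, symmetric]
    by (rule D.hext_cong[OF g]) (simp add: X_homogeneous_linear D_lin)
  show "X_br br b g (smul A c a) = smul A c (X_br br b g a)"
    unfolding X_br_def hext_fun_scale[OF A.vector_space, symmetric]
    by (rule D.hext_cong[OF g]) (simp add: X_homogeneous_linear D_lin)
  show "X_br br b (\<lambda>x. c * g x) a = smul A c (X_br br b g a)"
    unfolding X_br_def
    using D.hext_scale[OF A.vector_space, of "\<lambda>q g. X_homogeneous br q g b a" c g] g
    by (simp add: X_homogeneous_linear D_lin K0)
qed

lemma X_br_hom:
  assumes b: "b \<in> grd A j" and g: "g \<in> D q" and a: "a \<in> grd A i"
  shows "X_br br b g a = ksg (d * (i + j + 1) + i * q + i * j + j + q) (ctr g (br a b))"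
proof -
  have K0: "X_homogeneous br q 0 b a = 0" for q b a
    using X_homogeneous_linear(5)[OF D_lin[OF D.grd_0] D_lin[OF D.grd_0], of q b a] by simp
  have br0: "br 0 b = 0" "br a 0 = 0" for a b
    using dP_tens(3)[of 0 0 b] dP_tens(5)[of a 0 0] by (simp_all add: zero_fun_def)
  have z: "ctr g 0 = 0" using ctr_scale(1)[OF tpow_0 D_lin[OF g], of 0] by (simp add: zero_fun_def)
  have "X_br br b g a = X_homogeneous br q g b a"
    unfolding X_br_def by (rule D.hext_hom[OF g]) (rule K0)
  also have "\<dots> = hext (grd A) (\<lambda>i a. ksg (d * (i + j + 1) + i * q + i * j + j + q) (ctr g (br a b))) a"
    unfolding X_homogeneous_def by (rule A.hext_hom[OF b]) (simp add: hext_def br0 z)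
  also have "\<dots> = ksg (d * (i + j + 1) + i * q + i * j + j + q) (ctr g (br a b))"
    by (rule A.hext_hom[OF a]) (simp add: br0 z)
  finally show ?thesis .
qed

lemma X_br_grd:
  assumes b: "b \<in> grd A j" and g: "g \<in> D q" and a: "a \<in> grd A i"
  shows "X_br br b g a \<in> grd A (i + j + q - d)"
  unfolding X_br_hom[OF assms]
proof (rule A.grd_ksg, unfold grd_iff_D, intro allI ballI impI)
  fix p f assume f: "f \<in> D p" "p + (i + j + q - d) \<noteq> 0"
  then show "f (ctr g (br a b)) = 0"
    using dP_zero[OF a b f(1) g] by (simp add: ctr_apply[OF dP_tens(1) D_lin[OF f(1)] D_lin[OF g]])
qed

lemma X_br_eval:
  assumes a: "a \<in> grd A i" and b: "b \<in> grd A j" and f: "f \<in> D p" and g: "g \<in> D q"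
  shows "br a b [f, g] = sg (p * q + j * (i + q + 1)) * f (\<theta> (X_br br b g a))"
proof -
  have e: "f (\<theta> (X_br br b g a)) =
      sg (d * (i + j + q - d) + (d * (i + j + 1) + i * q + i * j + j + q)) * br a b [f, g]"
    unfolding \<theta>_hom[OF X_br_grd[OF b g a]]
    unfolding X_br_hom[OF b g a] ksg_ksg lin_ksg[OF D_lin[OF f]]
      ctr_apply[OF dP_tens(1) D_lin[OF f] D_lin[OF g]] ..
  show ?thesis
  proof (cases "i + j + p + q = d")
    case True
    then have p: "p = d - i - j - q" by simp
    have "(1 :: 'k) = sg (p * q + j * (i + q + 1)) *
        sg (d * (i + j + q - d) + (d * (i + j + 1) + i * q + i * j + j + q))"
      unfolding sg_add[symmetric] sg_0[symmetric] p
      by (rule sg_eqI) (cases "even i"; cases "even j"; cases "even q"; cases "even d"; simp)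
    then show ?thesis unfolding e mult.assoc[symmetric] by simp
  next
    case False
    then show ?thesis unfolding e using dP_zero[OF a b f g] by simp
  qed
qed

lemma X_br_eval_zero:
  assumes "a \<in> grd A i" "b \<in> grd A j" "f \<in> D p" "g \<in> D q" "i + j + p + q \<noteq> d"
  shows "f (\<theta> (X_br br b g a)) = 0"
  using X_br_eval[OF assms(1-4)] dP_zero[OF assms] by simp

lemma \<epsilon>_eval:
  assumes "a \<in> grd A l" "f \<in> TD" "lin g"
  shows "g (\<theta> (X_br br (\<epsilon> a) f b)) = sg (1 + l * (d + 1)) * g (\<theta> (X_br br a f b))"
  by (simp add: \<epsilon>_hom[OF assms(1)] ksg_scale[OF A.vector_space] X_br_linear[OF assms(2,2)] \<theta>_scale lin_scale[OF assms(3)])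

lemma Y_br_add:
  "f \<in> TD \<Longrightarrow> f' \<in> TD \<Longrightarrow> lin g \<Longrightarrow> Y_br br (f + f') b g = Y_br br f b g + Y_br br f' b g"
  "f \<in> TD \<Longrightarrow> lin g \<Longrightarrow> Y_br br f (b + b') g = Y_br br f b g + Y_br br f b' g"
  "f \<in> TD \<Longrightarrow> Y_br br f b (g + g') = Y_br br f b g + Y_br br f b g'"
  by (simp_all add: Y_br_def X_br_linear \<theta>_add lin_add fun_eq_iff)

lemma Y_br_scale:
  "f \<in> TD \<Longrightarrow> lin g \<Longrightarrow> Y_br br (\<lambda>x. c * f x) b g = (\<lambda>x. c * Y_br br f b g x)"
  "f \<in> TD \<Longrightarrow> lin g \<Longrightarrow> Y_br br f (smul A c b) g = (\<lambda>x. c * Y_br br f b g x)"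
  "Y_br br f b (\<lambda>x. c * g x) = (\<lambda>x. c * Y_br br f b g x)"
  by (simp_all add: Y_br_def X_br_linear \<theta>_scale lin_scale)

lemma Y_br_D:
  assumes f: "f \<in> D p" and b: "b \<in> grd A j" and g: "g \<in> D q"
  shows "Y_br br f b g \<in> D (p + q + j - d)"
  unfolding D_iff
proof (intro conjI allI ballI impI)
  show "lin (Y_br br f b g)"
    using D.total_grd[OF f] D_lin[OF g]
    by (simp add: Y_br_def lin_iff \<epsilon>_add \<epsilon>_scale X_br_linear \<theta>_add \<theta>_scale)
  fix l a assume l: "l \<noteq> - (p + q + j - d)" and a: "a \<in> grd A l"
  have "g (\<theta> (X_br br a f b)) = 0"
    by (rule X_br_eval_zero[OF b a g f]) (use l in linarith)
  then show "Y_br br f b g a = 0"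
    unfolding Y_br_def \<epsilon>_eval[OF a D.total_grd[OF f] D_lin[OF g]] by simp
qed

lemma Y_br_TD:
  assumes f: "f \<in> TD" and g: "g \<in> TD" shows "Y_br br f b g \<in> TD"
  using f
proof (induction rule: D.total_induct)
  case (hom p f)
  note f = hom
  show ?case
  proof (induction b rule: A_hom_induct)
    case (hom j b)
    note b = hom
    from g show ?case
    proof (induction rule: D.total_induct)
      case (hom q g)
      then show ?case using D.total_grd[OF Y_br_D[OF f b hom]] by simp
    next
      case (add g g')
      then show ?case unfolding Y_br_add(3)[OF D.total_grd[OF f]] by (intro D.total_add)
    qed
  next
    case (add b b')
    then show ?case unfolding Y_br_add(2)[OF D.total_grd[OF f] TD_lin[OF g]] by (intro D.total_add)
  qed
next
  case (add f f')
  then show ?case unfolding Y_br_add(1)[OF add(1,2) TD_lin[OF g]] by (intro D.total_add)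
qed

lemma m3_operation_br: "m3_operation d A (X_br br) (Y_br br)"
proof
  fix a1 i f2 j a3 k f0 l
  assume h: "a1 \<in> grd A i" "f2 \<in> D (j + d - 1)" "a3 \<in> grd A k" "f0 \<in> D (l + d - 1)"
  show "f0 (\<theta> (X_br br a1 f2 a3)) = sg (1 + l * (i + j + k)) * Y_br br f0 a1 f2 a3"
    unfolding Y_br_def \<epsilon>_eval[OF h(3) D.total_grd[OF h(4)] D_lin[OF h(2)]]
  proof (cases "i + j + k + l = 2 - d")
    case True
    then have l: "l = 2 - d - i - j - k" by simp
    let ?p = "l + d - 1" and ?q = "j + d - 1"
    have e1: "f0 (\<theta> (X_br br a1 f2 a3)) = sg (?p * ?q + i * (k + ?q + 1)) * br a3 a1 [f0, f2]"
      unfolding X_br_eval[OF h(3,1,4,2)] by simp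
    \<comment> \<open>The bracket formula turns X into a bracket, skew-symmetry exchanges the
      arguments, and the bracket formula leads back to X. Together with the definition of Y this
      gives \<open>cyc1\<close>.\<close>
    have e3: "f0 (\<theta> (X_br br a1 f2 a3)) =
        sg (1 + l * (i + j + k) + (1 + k * (d + 1))) * f2 (\<theta> (X_br br a3 f0 a1))"
      by (rule sg_trans[OF e1 sg_trans[OF dP_skew[OF h(3,1,4,2)] X_br_eval[OF h(1,3,2,4)] refl]], unfold l)
        (cases "even i"; cases "even j"; cases "even k"; cases "even d"; simp)
    show "f0 (\<theta> (X_br br a1 f2 a3)) =
        sg (1 + l * (i + j + k)) * (sg (1 + k * (d + 1)) * f2 (\<theta> (X_br br a3 f0 a1)))"
      unfolding e3 sg_add[of "1 + l * (i + j + k)" "1 + k * (d + 1)"] mult.assoc ..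
  next
    case False
    have "f0 (\<theta> (X_br br a1 f2 a3)) = 0" "f2 (\<theta> (X_br br a3 f0 a1)) = 0"
      by (rule X_br_eval_zero[OF h(3,1,4,2)], use False in linarith)
        (rule X_br_eval_zero[OF h(1,3,2,4)], use False in linarith)
    then show "f0 (\<theta> (X_br br a1 f2 a3)) =
        sg (1 + l * (i + j + k)) * (sg (1 + k * (d + 1)) * f2 (\<theta> (X_br br a3 f0 a1)))" by simp
  qed
next
  fix f1 i a2 j f3 k a0 l
  assume h: "f1 \<in> D (i + d - 1)" "a2 \<in> grd A j" "f3 \<in> D (k + d - 1)" "a0 \<in> grd A l"
  \<comment> \<open>Here the definition of Y already has the required form; only the sign in
    \<open>\<epsilon>\<close> has to be compared with that of the cyclicity condition.\<close>
  show "Y_br br f1 a2 f3 a0 = sg (1 + l * (i + j + k)) * f3 (\<theta> (X_br br a0 f1 a2))"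
    unfolding Y_br_def \<epsilon>_eval[OF h(4) D.total_grd[OF h(1)] D_lin[OF h(3)]]
  proof (cases "i + j + k + l = 2 - d")
    case True
    then have i: "i = 2 - d - j - k - l" by simp
    have "sg (1 + l * (d + 1)) = (sg (1 + l * (i + j + k)) :: 'k)"
      unfolding i by (rule sg_eqI) auto
    then show "sg (1 + l * (d + 1)) * f3 (\<theta> (X_br br a0 f1 a2)) = sg (1 + l * (i + j + k)) * f3 (\<theta> (X_br br a0 f1 a2))"
      by simp
  next
    case False
    have "f3 (\<theta> (X_br br a0 f1 a2)) = 0"
      by (rule X_br_eval_zero[OF h(2,4,3,1)]) (use False in linarith)
    then show "sg (1 + l * (d + 1)) * f3 (\<theta> (X_br br a0 f1 a2)) = sg (1 + l * (i + j + k)) * f3 (\<theta> (X_br br a0 f1 a2))"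
      by simp
  qed
qed (simp_all add: X_br_linear X_br_grd Y_br_add Y_br_scale Y_br_TD Y_br_D TD_lin)

lemma bracket_br: "m3_operation.bracket d A (X_br br) br"
proof -
  interpret m3_operation d A "X_br br" "Y_br br" by (rule m3_operation_br)
  show ?thesis using dP_bilinear X_br_eval by (simp add: bracket_def)
qed

end

section \<open>The bijection\<close>

lemma fm_nice_determined:
  assumes m: "m \<in> fm_nice_pre_CY d A" "m' \<in> fm_nice_pre_CY d A"
    and br: "is_bracket_of d A m br" "is_bracket_of d A m' br"
  shows "m = m'"
proof -
  interpret m: m3_operation d A "X_of m" "Y_of m" by (rule m3_operation_of[OF m(1)])
  interpret m': m3_operation d A "X_of m'" "Y_of m'" by (rule m3_operation_of[OF m(2)])
  have b: "m.bracket br" "m'.bracket br"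
    using br m.is_bracket_of_iff[OF realizes_of[OF m(1)]] m'.is_bracket_of_iff[OF realizes_of[OF m(2)]] by blast+
  \<comment> \<open>In the bracket formula the sign is invertible, so the common bracket determines
    all values of homogeneous functionals on \<open>\<theta>\<close> of X, and
    \<open>\<theta>\<close> is injective.\<close>
  have Xh: "X_of m b g a = X_of m' b g a" if "b \<in> grd A j" "g \<in> D q" "a \<in> grd A i" for b j g q a i
  proof -
    have "\<theta> (X_of m b g a) = \<theta> (X_of m' b g a)"
    proof (rule D_separates_eq)
      fix p f assume "f \<in> D p"
      from m.bracket_apply[OF b(1) that(3,1) this that(2)] m'.bracket_apply[OF b(2) that(3,1) this that(2)]
      show "f (\<theta> (X_of m b g a)) = f (\<theta> (X_of m' b g a))" by (metis sg_sg(2))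
    qed
    then show ?thesis by (metis \<theta>_\<theta>)
  qed
  have Xg: "X_of m b g a = X_of m' b g a" if "g \<in> TD" for b g a
    using that
  proof (induction rule: D.total_induct)
    case (hom q g)
    note g = hom D.total_grd[OF hom]
    show ?case
    proof (induction b rule: A_hom_induct)
      case (hom j b)
      note b = hom
      show ?case
        by (induction a rule: A_hom_induct) (simp_all add: Xh[OF b g(1)] m.X_add m'.X_add g)
    qed (simp add: m.X_add m'.X_add g)
  next
    case (add g g')
    then show ?case unfolding m.X_add(2)[OF add(1,2)] m'.X_add(2)[OF add(1,2)] by simp
  qed
  \<comment> \<open>Cyclicity expresses Y through X, so agreement of the X carries over.\<close>
  have Yh: "Y_of m f b g = Y_of m' f b g" if "f \<in> D p" "b \<in> grd A j" "g \<in> D q" for f p b j g q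
  proof (rule lin_hom_ext)
    show "lin (Y_of m f b g)" "lin (Y_of m' f b g)"
      using D_lin[OF m.Y_D[OF that]] D_lin[OF m'.Y_D[OF that]] .
    fix l a assume a: "a \<in> grd A l"
    have f: "f \<in> D (p - d + 1 + d - 1)" and g: "g \<in> D (q - d + 1 + d - 1)" using that by simp_all
    show "Y_of m f b g a = Y_of m' f b g a"
      unfolding m.cyc2[OF f that(2) g a] m'.cyc2[OF f that(2) g a] Xg[OF D.total_grd[OF that(1)]] ..
  qed
  have Yg: "Y_of m f b g = Y_of m' f b g" if f: "f \<in> TD" and g: "g \<in> TD" for f b g
    using f
  proof (induction rule: D.total_induct)
    case (hom p f)
    note f = hom D.total_grd[OF hom]
    show ?case
    proof (induction b rule: A_hom_induct)
      case (hom j b)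
      note b = hom
      from g show ?case
      proof (induction rule: D.total_induct)
        case (hom q g)
        then show ?case by (rule Yh[OF f(1) b])
      next
        case (add g g')
        then show ?case unfolding m.Y_add(3)[OF f(2) add(1,2)] m'.Y_add(3)[OF f(2) add(1,2)] by simp
      qed
    qed (simp add: m.Y_add m'.Y_add f g)
  next
    case (add f f')
    then show ?case unfolding m.Y_add(1)[OF add(1,2) g] m'.Y_add(1)[OF add(1,2) g] by simp
  qed
  have M: "m.M x y z = m'.M x y z" if "x \<in> TB" "y \<in> TB" "z \<in> TB" for x y z
    using that by (auto simp: total_B m.M_def m'.M_def Xg Yg)
  \<comment> \<open>Full manageability fixes arities one and two, and niceness makes the operations
    from arity four on vanish, so arity three decides.\<close>
  note r = realizes_of[OF m(1), unfolded m.realizes_def] realizes_of[OF m(2), unfolded m'.realizes_def]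
  show ?thesis
  proof (intro ext)
    fix n xs
    show "m n xs = m' n xs"
    proof (cases "n \<ge> 1 \<and> xs \<in> op_dom B n")
      case False
      then show ?thesis
        using m_A_infinity[OF m(1)] m_A_infinity[OF m(2)] by (simp add: A_infinity_def)
    next
      case True
      then have xs: "length xs = n" "set xs \<subseteq> TB" by (auto simp: op_dom_def)
      show ?thesis
        using True xs r M by (rule_tac m.list_cases_1_2_3[of n xs]) (auto simp: One_nat_def[symmetric] simp del: One_nat_def)
    qed
  qed
qed

lemma is_bracket_of_double_Poisson:
  assumes m: "m \<in> fm_nice_pre_CY d A" and br: "is_bracket_of d A m br"
  shows "double_Poisson d A br"
proof -
  interpret m3_operation d A "X_of m" "Y_of m" by (rule m3_operation_of[OF m])
  have "bracket br" using br is_bracket_of_iff[OF realizes_of[OF m]] by blast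
  then show ?thesis using double_Poisson_iff base_of[OF m] by blast
qed

text \<open>Finite type yields the tensors that make up a bracket. Conversely the existence of a
  bracket bounds the degrees, since each of its values is a finite sum.\<close>

lemma finite_type_m3_iff:
  assumes m: "m \<in> fm_nice_pre_CY d A"
  shows "finite_type_m3 A m \<longleftrightarrow> (\<exists>!br. is_bracket_of d A m br)"
proof -
  interpret m3_operation d A "X_of m" "Y_of m" by (rule m3_operation_of[OF m])
  show ?thesis
    unfolding is_bracket_of_iff[OF realizes_of[OF m]] finite_type_iff[OF realizes_of[OF m]]
    using bracket_exists bracket_unique bracket_finite_type by blast
qed

lemma pairwise_finite_support_finite_type:
  assumes m: "m \<in> fm_nice_pre_CY d A" and A: "pairwise_finite_support A"
  shows "finite_type_m3 A m"
proof -
  interpret m3_operation d A "X_of m" "Y_of m" by (rule m3_operation_of[OF m])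
  show ?thesis
    unfolding finite_type_iff[OF realizes_of[OF m]] using A by (rule pairwise_finite_type)
qed

lemma double_Poisson_bracket_of:
  assumes "double_Poisson d A br"
  obtains m where "m \<in> fm_nice_pre_CY d A" "is_bracket_of d A m br"
proof -
  interpret m3_operation d A "X_br br" "Y_br br" by (rule m3_operation_br[OF assms])
  have b: "bracket br" by (rule bracket_br[OF assms])
  then have "stasheff_word3 \<and> stasheff_word4 \<and> stasheff_word5" using double_Poisson_iff assms by blast
  then have "mop \<in> fm_nice_pre_CY d A" using mop_fm_nice by blast
  moreover have "is_bracket_of d A mop br" using b is_bracket_of_iff[OF realizes_mop] by blast
  ultimately show ?thesis by (rule that)
qed

lemma bij_betw_bracket_of:
  "bij_betw (bracket_of d A) {m \<in> fm_nice_pre_CY d A. finite_type_m3 A m} {br. double_Poisson d A br}"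
proof -
  have b: "is_bracket_of d A m (bracket_of d A m)" if "m \<in> fm_nice_pre_CY d A" "finite_type_m3 A m" for m
  proof -
    have "\<exists>!br. is_bracket_of d A m br" using finite_type_m3_iff[OF that(1)] that(2) by simp
    then show ?thesis unfolding bracket_of_def by (rule theI')
  qed
  show ?thesis
  proof (rule bij_betw_imageI)
    show "inj_on (bracket_of d A) {m \<in> fm_nice_pre_CY d A. finite_type_m3 A m}"
    proof (rule inj_onI)
      fix m m' assume "m \<in> {m \<in> fm_nice_pre_CY d A. finite_type_m3 A m}"
        "m' \<in> {m \<in> fm_nice_pre_CY d A. finite_type_m3 A m}" "bracket_of d A m = bracket_of d A m'"
      then show "m = m'" using fm_nice_determined[of m m' "bracket_of d A m"] b[of m] b[of m'] by simp
    qed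
    show "bracket_of d A ` {m \<in> fm_nice_pre_CY d A. finite_type_m3 A m} = {br. double_Poisson d A br}"
    proof (intro equalityI subsetI)
      fix br assume "br \<in> bracket_of d A ` {m \<in> fm_nice_pre_CY d A. finite_type_m3 A m}"
      then show "br \<in> {br. double_Poisson d A br}" using b is_bracket_of_double_Poisson by blast
    next
      fix br assume "br \<in> {br. double_Poisson d A br}"
      then obtain m where m: "m \<in> fm_nice_pre_CY d A" "is_bracket_of d A m br"
        using double_Poisson_bracket_of by blast
      interpret m3_operation d A "X_of m" "Y_of m" by (rule m3_operation_of[OF m(1)])
      have "bracket br" using m is_bracket_of_iff[OF realizes_of[OF m(1)]] by blast
      \<comment> \<open>The structure found has a bracket, hence is of finite type and lies in the
        domain of the map.\<close>
      then have "finite_type_m3 A m"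
        unfolding finite_type_iff[OF realizes_of[OF m(1)]] by (rule bracket_finite_type)
      moreover from this have "bracket_of d A m = br"
        using finite_type_m3_iff[OF m(1)] m b by blast
      ultimately show "br \<in> bracket_of d A ` {m \<in> fm_nice_pre_CY d A. finite_type_m3 A m}" using m(1) by blast
    qed
  qed
qed

end

theorem theorem5p2:
  fixes d :: int and A :: "('k::field_char_0, 'a::ab_group_add) dgalg"
  assumes "dg_algebra A"
  shows "(\<forall>m \<in> fm_nice_pre_CY d A. \<forall>br. is_bracket_of d A m br \<longrightarrow> double_Poisson d A br)
    \<and> (\<forall>m \<in> fm_nice_pre_CY d A. finite_type_m3 A m \<longleftrightarrow> (\<exists>!br. is_bracket_of d A m br))
    \<and> bij_betw (bracket_of d A) {m \<in> fm_nice_pre_CY d A. finite_type_m3 A m} {br. double_Poisson d A br}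
    \<and> (pairwise_finite_support A \<longrightarrow> (\<forall>m \<in> fm_nice_pre_CY d A. finite_type_m3 A m))"
proof -
  interpret dga d A by unfold_locales (rule assms)
  show ?thesis
    using is_bracket_of_double_Poisson finite_type_m3_iff bij_betw_bracket_of pairwise_finite_support_finite_type
    by blast
qed

end
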